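(* Let $d\geq 2$ and $k\geq 2$ be integers, and consider critical Bernoulli bond percolation on the slab $\mathbb{S}=\mathbb{Z}^2\times\{0,\ldots,k-1\}^{d-2}$, with critical threshold $p_c$. For positive integers $m,n$, let $p(m,n)$ be the probability, under the critical measure, that $L(m,n)$ is connected to $R(m,n)$ by an open path in $B(m,n)$. Let $$C_*=\left(\frac{2}{\min(p_c,1-p_c)}\right)^{d\cdot 7^2\cdot k^{d-2}},\qquad c_*=\frac{1}{1+C_*}.$$ Then for all integers $n\geq 1$, $$p(44n,43n)\;\geq\;\frac{c_*^{21}\cdot p(43n,44n)^{198}}{10^{154}} .$$
   Context: The slab $\mathbb{S}=\mathbb{Z}^2\times\{0,\ldots,k-1\}^{d-2}\subset\mathbb{Z}^d$ is regarded as a graph with the nearest-neighbour edges of $\mathbb{Z}^d$ having both endpoints in $\mathbb{S}$. Bernoulli bond percolation on $\mathbb{S}$ with parameter $p\in[0,1]$: each edge is independently open with probability $p$ and closed with probability $1-p$; the corresponding measure is $\mathbb{P}_p$. The critical threshold is $$p_c=\inf\{p:\mathbb{P}_p[\text{the open connected component of }0\text{ in }\mathbb{S}\text{ is infinite}]>0\},$$ and $\mathbb{P}=\mathbb{P}_{p_c}$. Intervals are intervals of integers. For $A\subset\mathbb{Z}^2$ let $\overline{A}=A\times\{0,\ldots,k-1\}^{d-2}$. For positive integers $m,n$ define $$B(m,n)=\overline{[0,m)\times[0,n)},\quad L(m,n)=\overline{\{0\}\times[0,n)},\quad R(m,n)=\overline{\{m-1\}\times[0,n)},$$ let $\mathrm{LR}(m,n)$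 be the event that $L(m,n)$ is connected to $R(m,n)$ by a path of open edges all of whose vertices lie in $B(m,n)$, and let $p(m,n)=\mathbb{P}[\mathrm{LR}(m,n)]$. *)

theory Defs
  imports "HOL-Probability.Probability"
begin

text \<open>
  Points of the d-dimensional integer lattice are extensional functions on \<open>{..<d}\<close>; coordinates
  0 and 1 are the unbounded ones of the slab, coordinates \<open>2, ..., d - 1\<close> range over
  \<open>{0, ..., k - 1}\<close>.
\<close>

type_synonym vertex = "nat \<Rightarrow> int"
type_synonym edge = "vertex set"

definition slab :: "nat \<Rightarrow> nat \<Rightarrow> vertex set" where
  "slab d k = (\<Pi>\<^sub>E i\<in>{..<d}. if i < 2 then UNIV else {0..<int k})"

definition slab_origin :: "nat \<Rightarrow> vertex" where
  "slab_origin d = (\<lambda>i\<in>{..<d}. 0)"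

definition slab_edges :: "nat \<Rightarrow> nat \<Rightarrow> edge set" where
  "slab_edges d k =
     {{x, y} | x y. x \<in> slab d k \<and> y \<in> slab d k \<and> (\<Sum>i<d. \<bar>x i - y i\<bar>) = 1}"

definition percolation :: "nat \<Rightarrow> nat \<Rightarrow> real \<Rightarrow> (edge \<Rightarrow> bool) measure" where
  "percolation d k p = (\<Pi>\<^sub>M e\<in>slab_edges d k. measure_pmf (bernoulli_pmf p))"

text \<open>
  A path is a nonempty list of vertices, consecutive ones being joined by an open edge; a single
  vertex is a path. Vertices may be repeated, which does not affect which sets are connected.
\<close>

definition open_path ::
  "nat \<Rightarrow> nat \<Rightarrow> (edge \<Rightarrow> bool) \<Rightarrow> vertex list \<Rightarrow> bool" where
  "open_path d k \<omega> xs \<longleftrightarrow> xs \<noteq> [] \<and> set xs \<subseteq> slab d k \<and>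
     successively (\<lambda>x y. {x, y} \<in> slab_edges d k \<and> \<omega> {x, y}) xs"

definition open_connected ::
  "nat \<Rightarrow> nat \<Rightarrow> (edge \<Rightarrow> bool) \<Rightarrow> vertex set \<Rightarrow> vertex set \<Rightarrow> vertex set \<Rightarrow> bool" where
  "open_connected d k \<omega> S X Y \<longleftrightarrow>
     (\<exists>xs. open_path d k \<omega> xs \<and> set xs \<subseteq> S \<and> hd xs \<in> X \<and> last xs \<in> Y)"

definition open_cluster :: "nat \<Rightarrow> nat \<Rightarrow> (edge \<Rightarrow> bool) \<Rightarrow> vertex \<Rightarrow> vertex set" where
  "open_cluster d k \<omega> x = {y. open_connected d k \<omega> (slab d k) {x} {y}}"

definition p_crit :: "nat \<Rightarrow> nat \<Rightarrow> real" where
  "p_crit d k = Inf {p \<in> {0..1}.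
     \<P>(\<omega> in percolation d k p. infinite (open_cluster d k \<omega> (slab_origin d))) > 0}"

definition slab_over :: "nat \<Rightarrow> nat \<Rightarrow> (int \<times> int) set \<Rightarrow> vertex set" where
  "slab_over d k A = {x \<in> slab d k. (x 0, x 1) \<in> A}"

definition slab_box :: "nat \<Rightarrow> nat \<Rightarrow> nat \<Rightarrow> nat \<Rightarrow> vertex set" where
  "slab_box d k m n = slab_over d k ({0..<int m} \<times> {0..<int n})"

definition left_side :: "nat \<Rightarrow> nat \<Rightarrow> nat \<Rightarrow> nat \<Rightarrow> vertex set" where
  "left_side d k m n = slab_over d k ({0} \<times> {0..<int n})"

definition right_side :: "nat \<Rightarrow> nat \<Rightarrow> nat \<Rightarrow> nat \<Rightarrow> vertex set" where
  "right_side d k m n = slab_over d k ({int m - 1} \<times> {0..<int n})"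

definition cross_prob :: "nat \<Rightarrow> nat \<Rightarrow> nat \<Rightarrow> nat \<Rightarrow> real" where
  "cross_prob d k m n = \<P>(\<omega> in percolation d k (p_crit d k).
     open_connected d k \<omega> (slab_box d k m n) (left_side d k m n) (right_side d k m n))"

definition C_star :: "nat \<Rightarrow> nat \<Rightarrow> real" where
  "C_star d k = (2 / min (p_crit d k) (1 - p_crit d k)) ^ (d * 7\<^sup>2 * k ^ (d - 2))"

definition c_star :: "nat \<Rightarrow> nat \<Rightarrow> real" where
  "c_star d k = 1 / (1 + C_star d k)"

end

theory Submission
  imports Defs "HOL-Library.List_Lexorder" "HOL-Library.Sublist" "HOL-Combinatorics.Transposition"
begin

text \<open>
  The argument runs at an arbitrary edge probability p strictly between 0 and 1. Write \<open>lr w h\<close> for the probability of a left-right crossing of a box of width w and height h, and K for the constant \<open>Kc\<close>, which depends on p, d and k only. The heart is the bound \<open>lr_lower_bound\<close>: the 16th power of \<open>lr (43n) (44n)\<close> is at most an absolute constant times \<open>K^15\<close> times \<open>lr (44n) (43n)\<close>. Since \<open>C_star \<ge> K\<close>, the factor \<open>c_star ^ 21\<close> absorbs \<open>K^15\<close> and the denominator \<open>10 ^ 154\<close> the absolute constant; the two boundary values of the critical parameter are checked by hand.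

  In the plane two crossing paths can be concatenated. In the slab their projections cross but the paths may pass above each other. \<open>gluing\<close> repairs this at the price of the factor K: choose one path from A to B by a rule, and suppose that C is connected to a vertex above or below it. Changing the edges that touch a single fibre makes C connected to A. The price is a finite-energy factor, provided that the fibre can be recovered from the new configuration. It can if the rule still selects the same path, for then the path is touched from C at one vertex only. A rule that explores paths lexicographically is unaffected by the new edges if the next step of the selected path is preferred to the new edge. Averaging over all families of local preferences makes this favourable case at least as likely as the unfavourable one, because exchanging two ranks turns one into the other (\<open>least_path_swap\<close>). That is where the factor 2 in K comes from.

  Together with the planar fact \<open>crossing\<close> this gives the inequality \<open>gluing_meet\<close>, a substitute for the concatenation of crossing paths. A second application of the same rule, with conditioning on the selected path and reflection in the line at height -1/2, gives \<open>reflection\<close>.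

  For the bound, look at a crossing of the box of size 43n by 44n. If crossings of the lower box of size 43n by 41n have a comparable probability, then the width grows by a direct gluing: a path from the left side to the right half of the bottom and a mirrored path from the right side must meet (\<open>lr_square\<close>). Otherwise crossings are likely to leave every window of height 21n or 41n around their left end, so with good probability a given block of length n on the left side is connected to a level at distance 10n, and also to one at distance 20n (\<open>lr_le_up\<close>). Reflecting in the lower level, either there is a vertical crossing of a box of width 43n and height 44n, which is what is wanted after exchanging the axes, or two blocks on the left side are connected by an arc (\<open>up_dichotomy\<close>). Two interlaced arcs meet, so arcs can be made longer, from 9 to 17, 33 and 65 blocks, and an arc over 65 blocks contains the desired crossing (\<open>arc_power\<close>).
\<close>

section \<open>Finite Bernoulli percolation\<close>

text \<open>
  The expectation of f at a random subset of E that contains each element independently with probability p. Crossing events depend on finitely many edges, so finite sums replace the product measure; the link is \<open>measure_PiM_bernoulli\<close>.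
\<close>
definition bexp :: "real \<Rightarrow> 'a set \<Rightarrow> ('a set \<Rightarrow> real) \<Rightarrow> real" where
  "bexp p E f = (\<Sum>\<omega>\<in>Pow E. p ^ card \<omega> * (1 - p) ^ card (E - \<omega>) * f \<omega>)"

definition bprob :: "real \<Rightarrow> 'a set \<Rightarrow> ('a set \<Rightarrow> bool) \<Rightarrow> real" where
  "bprob p E X = bexp p E (\<lambda>\<omega>. of_bool (X \<omega>))"

lemma bexp_empty [simp]: "bexp p {} f = f {}"
  by (simp add: bexp_def)

text \<open>
  Conditioning on the state of one edge. The further properties follow from this by induction over the set of edges.
\<close>
lemma bexp_insert:
  assumes "finite E" "e \<notin> E"
  shows "bexp p (insert e E) f = p * bexp p E (\<lambda>\<omega>. f (insert e \<omega>)) + (1 - p) * bexp p E f"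
proof -
  have fin: "finite \<omega>" if "\<omega> \<in> Pow E" for \<omega>
    using that assms(1) finite_subset by auto
  have "bexp p (insert e E) f =
    (\<Sum>\<omega>\<in>Pow E. p ^ card \<omega> * (1 - p) ^ card (insert e E - \<omega>) * f \<omega>) +
    (\<Sum>\<omega>\<in>insert e ` Pow E. p ^ card \<omega> * (1 - p) ^ card (insert e E - \<omega>) * f \<omega>)"
    unfolding bexp_def Pow_insert using assms by (intro sum.union_disjoint) auto
  also have "(\<Sum>\<omega>\<in>insert e ` Pow E. p ^ card \<omega> * (1 - p) ^ card (insert e E - \<omega>) * f \<omega>) =
     (\<Sum>\<omega>\<in>Pow E. p ^ card (insert e \<omega>) * (1 - p) ^ card (insert e E - insert e \<omega>) * f (insert e \<omega>))"
    by (subst sum.reindex) (use assms in \<open>auto simp: inj_on_def o_def\<close>)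
  also have "\<dots> = p * bexp p E (\<lambda>\<omega>. f (insert e \<omega>))"
    unfolding bexp_def sum_distrib_left
  proof (rule sum.cong)
    fix \<omega> assume w: "\<omega> \<in> Pow E"
    then have "e \<notin> \<omega>" "insert e E - insert e \<omega> = E - \<omega>" using assms by auto
    then show "p ^ card (insert e \<omega>) * (1 - p) ^ card (insert e E - insert e \<omega>) * f (insert e \<omega>) =
      p * (p ^ card \<omega> * (1 - p) ^ card (E - \<omega>) * f (insert e \<omega>))"
      using fin[OF w] by simp
  qed simp
  also have "(\<Sum>\<omega>\<in>Pow E. p ^ card \<omega> * (1 - p) ^ card (insert e E - \<omega>) * f \<omega>) = (1 - p) * bexp p E f"
    unfolding bexp_def sum_distrib_left
  proof (rule sum.cong)
    fix \<omega> assume w: "\<omega> \<in> Pow E"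
    then have "insert e E - \<omega> = insert e (E - \<omega>)" using assms by auto
    then show "p ^ card \<omega> * (1 - p) ^ card (insert e E - \<omega>) * f \<omega> =
      (1 - p) * (p ^ card \<omega> * (1 - p) ^ card (E - \<omega>) * f \<omega>)"
      using assms by simp
  qed simp
  finally show ?thesis by simp
qed

lemma bexp_cong: "(\<And>\<omega>. \<omega> \<subseteq> E \<Longrightarrow> f \<omega> = g \<omega>) \<Longrightarrow> bexp p E f = bexp p E g"
  unfolding bexp_def by (rule sum.cong) auto

lemma bexp_add: "bexp p E (\<lambda>\<omega>. f \<omega> + g \<omega>) = bexp p E f + bexp p E g"
  by (simp add: bexp_def ring_distribs sum.distrib)

lemma bexp_cmult: "bexp p E (\<lambda>\<omega>. a * f \<omega>) = a * bexp p E f"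
  by (simp add: bexp_def sum_distrib_left mult_ac)

lemma bexp_multc: "bexp p E (\<lambda>\<omega>. f \<omega> * a) = bexp p E f * a"
  by (simp add: bexp_def sum_distrib_left sum_distrib_right mult_ac)

lemma bexp_sum: "bexp p E (\<lambda>\<omega>. \<Sum>i\<in>I. f i \<omega>) = (\<Sum>i\<in>I. bexp p E (f i))"
  unfolding bexp_def by (subst sum.swap) (simp add: sum_distrib_left)

lemma bexp_minus: "bexp p E (\<lambda>\<omega>. - f \<omega>) = - bexp p E f"
  by (simp add: bexp_def sum_negf)

lemma bexp_one: "finite E \<Longrightarrow> bexp p E (\<lambda>_. 1) = 1"
  by (induction E rule: finite_induct) (auto simp: bexp_insert algebra_simps)

lemma bexp_const: "finite E \<Longrightarrow> bexp p E (\<lambda>_. a) = a"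
  using bexp_cmult[of p E a "\<lambda>_. 1"] by (simp add: bexp_one)

lemma bexp_mono:
  assumes "0 \<le> p" "p \<le> 1" "\<And>\<omega>. \<omega> \<subseteq> E \<Longrightarrow> f \<omega> \<le> g \<omega>"
  shows "bexp p E f \<le> bexp p E g"
  unfolding bexp_def using assms by (intro sum_mono mult_left_mono) auto

text \<open>
  Fubini's theorem.
\<close>
lemma bexp_Un:
  assumes "finite E1" "finite E2" "E1 \<inter> E2 = {}"
  shows "bexp p (E1 \<union> E2) f = bexp p E1 (\<lambda>\<alpha>. bexp p E2 (\<lambda>\<beta>. f (\<alpha> \<union> \<beta>)))"
  using assms(1,3)
proof (induction E1 arbitrary: f rule: finite_induct)
  case (insert e E1)
  then show ?case using assms(2) by (simp add: bexp_insert)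
qed auto

lemma bexp_marginal:
  assumes "finite E" "E0 \<subseteq> E" "\<And>\<omega>. \<omega> \<subseteq> E \<Longrightarrow> f \<omega> = f (\<omega> \<inter> E0)"
  shows "bexp p E f = bexp p E0 f"
proof -
  have "bexp p (E0 \<union> (E - E0)) f = bexp p E0 (\<lambda>\<alpha>. bexp p (E - E0) (\<lambda>\<beta>. f (\<alpha> \<union> \<beta>)))"
    using assms by (intro bexp_Un) (auto intro: finite_subset)
  also have "\<dots> = bexp p E0 (\<lambda>\<alpha>. bexp p (E - E0) (\<lambda>\<beta>. f \<alpha>))"
  proof (intro bexp_cong)
    fix \<alpha> \<beta> assume *: "\<alpha> \<subseteq> E0" "\<beta> \<subseteq> E - E0"
    then have "f (\<alpha> \<union> \<beta>) = f ((\<alpha> \<union> \<beta>) \<inter> E0)" using assms by (intro assms(3)) auto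
    also have "(\<alpha> \<union> \<beta>) \<inter> E0 = \<alpha>" using * by auto
    finally show "f (\<alpha> \<union> \<beta>) = f \<alpha>" .
  qed
  also have "\<dots> = bexp p E0 f" using assms by (simp add: bexp_const)
  finally show ?thesis using assms(2) by (simp add: Un_absorb1)
qed

lemma bexp_indep:
  assumes "finite E" "E1 \<subseteq> E" "E2 \<subseteq> E" "E1 \<inter> E2 = {}"
    and f: "\<And>\<omega>. \<omega> \<subseteq> E \<Longrightarrow> f \<omega> = f (\<omega> \<inter> E1)" and g: "\<And>\<omega>. \<omega> \<subseteq> E \<Longrightarrow> g \<omega> = g (\<omega> \<inter> E2)"
  shows "bexp p E (\<lambda>\<omega>. f \<omega> * g \<omega>) = bexp p E f * bexp p E g"
proof -
  have fin: "finite E1" "finite E2" using assms(1-3) finite_subset by blast+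
  have "bexp p E (\<lambda>\<omega>. f \<omega> * g \<omega>) = bexp p (E1 \<union> E2) (\<lambda>\<omega>. f \<omega> * g \<omega>)"
  proof (rule bexp_marginal)
    fix \<omega> assume w: "\<omega> \<subseteq> E"
    have s: "\<omega> \<inter> (E1 \<union> E2) \<subseteq> E" using w by auto
    have e: "\<omega> \<inter> (E1 \<union> E2) \<inter> E1 = \<omega> \<inter> E1" "\<omega> \<inter> (E1 \<union> E2) \<inter> E2 = \<omega> \<inter> E2" by auto
    show "f \<omega> * g \<omega> = f (\<omega> \<inter> (E1 \<union> E2)) * g (\<omega> \<inter> (E1 \<union> E2))"
      using f[OF w] f[OF s] g[OF w] g[OF s] e by simp
  qed (use assms in auto)
  also have "\<dots> = bexp p E1 (\<lambda>\<alpha>. bexp p E2 (\<lambda>\<beta>. f (\<alpha> \<union> \<beta>) * g (\<alpha> \<union> \<beta>)))"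
    using fin assms by (intro bexp_Un) auto
  also have "\<dots> = bexp p E1 (\<lambda>\<alpha>. bexp p E2 (\<lambda>\<beta>. f \<alpha> * g \<beta>))"
  proof (intro bexp_cong arg_cong2[of _ _ _ _ "(*)"])
    fix \<alpha> \<beta> assume *: "\<alpha> \<subseteq> E1" "\<beta> \<subseteq> E2"
    have "(\<alpha> \<union> \<beta>) \<inter> E1 = \<alpha>" "(\<alpha> \<union> \<beta>) \<inter> E2 = \<beta>" "\<alpha> \<union> \<beta> \<subseteq> E" using * assms by auto
    then show "f (\<alpha> \<union> \<beta>) = f \<alpha>" "g (\<alpha> \<union> \<beta>) = g \<beta>" using f[of "\<alpha> \<union> \<beta>"] g[of "\<alpha> \<union> \<beta>"] by auto
  qed
  also have "\<dots> = bexp p E1 f * bexp p E2 g" by (simp add: bexp_cmult bexp_multc)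
  also have "\<dots> = bexp p E f * bexp p E g"
    using bexp_marginal[of E E1 f p] bexp_marginal[of E E2 g p] assms by simp
  finally show ?thesis .
qed

lemma bexp_image:
  assumes "finite E" "inj_on \<phi> E"
  shows "bexp p (\<phi> ` E) f = bexp p E (\<lambda>\<omega>. f (\<phi> ` \<omega>))"
  using assms
proof (induction E arbitrary: f rule: finite_induct)
  case (insert e E)
  then show ?case by (simp add: bexp_insert)
qed auto

text \<open>
  Conditioning on the state of one edge e, the covariance of the two conditional expectations is p(1-p) times the product of two nonnegative increments.
\<close>
lemma harris:
  assumes "finite E" "0 \<le> p" "p \<le> 1" "mono_on (Pow E) f" "mono_on (Pow E) g"
  shows "bexp p E f * bexp p E g \<le> bexp p E (\<lambda>\<omega>. f \<omega> * g \<omega>)"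
  using assms(1,4,5)
proof (induction E arbitrary: f g rule: finite_induct)
  case (insert e E)
  define f1 g1 where "f1 = (\<lambda>\<omega>. f (insert e \<omega>))" and "g1 = (\<lambda>\<omega>. g (insert e \<omega>))"
  have m: "mono_on (Pow E) f" "mono_on (Pow E) g" "mono_on (Pow E) f1" "mono_on (Pow E) g1"
    unfolding f1_def g1_def
    by (auto intro!: mono_onI mono_onD[OF insert.prems(1)] mono_onD[OF insert.prems(2)])
  have "bexp p E f \<le> bexp p E f1" "bexp p E g \<le> bexp p E g1"
    using insert.prems unfolding mono_on_def f1_def g1_def
    by (auto intro!: bexp_mono simp: assms(2,3) subset_insertI2 subset_insertI insert_mono)
  then have "0 \<le> p * (1 - p) * ((bexp p E f1 - bexp p E f) * (bexp p E g1 - bexp p E g))"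
    using assms(2,3) by auto
  then have "(p * bexp p E f1 + (1 - p) * bexp p E f) * (p * bexp p E g1 + (1 - p) * bexp p E g) \<le>
     p * (bexp p E f1 * bexp p E g1) + (1 - p) * (bexp p E f * bexp p E g)"
    by (simp add: algebra_simps)
  also have "\<dots> \<le> p * bexp p E (\<lambda>\<omega>. f1 \<omega> * g1 \<omega>) + (1 - p) * bexp p E (\<lambda>\<omega>. f \<omega> * g \<omega>)"
    using insert.IH m assms(2,3) by (intro add_mono mult_left_mono) auto
  finally show ?case using insert.hyps by (simp add: bexp_insert f1_def g1_def)
qed auto

lemma bprob_cong: "(\<And>\<omega>. \<omega> \<subseteq> E \<Longrightarrow> X \<omega> = Y \<omega>) \<Longrightarrow> bprob p E X = bprob p E Y"
  unfolding bprob_def by (rule bexp_cong) auto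

lemma bprob_mono:
  assumes "0 \<le> p" "p \<le> 1" "\<And>\<omega>. \<omega> \<subseteq> E \<Longrightarrow> X \<omega> \<Longrightarrow> Y \<omega>"
  shows "bprob p E X \<le> bprob p E Y"
  unfolding bprob_def using assms by (intro bexp_mono) auto

lemma bprob_nonneg: "0 \<le> p \<Longrightarrow> p \<le> 1 \<Longrightarrow> 0 \<le> bprob p E X"
  unfolding bprob_def bexp_def by (intro sum_nonneg) auto

lemma bprob_le_1: "finite E \<Longrightarrow> 0 \<le> p \<Longrightarrow> p \<le> 1 \<Longrightarrow> bprob p E X \<le> 1"
  using bexp_mono[of p E "\<lambda>\<omega>. of_bool (X \<omega>)" "\<lambda>_. 1"] by (simp add: bprob_def bexp_one)

lemma bprob_Ex_le:
  assumes "0 \<le> p" "p \<le> 1" "finite I"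
  shows "bprob p E (\<lambda>\<omega>. \<exists>i\<in>I. X i \<omega>) \<le> (\<Sum>i\<in>I. bprob p E (X i))"
  unfolding bprob_def bexp_sum[symmetric]
proof (intro bexp_mono assms(1,2))
  fix \<omega>
  show "of_bool (\<exists>i\<in>I. X i \<omega>) \<le> (\<Sum>i\<in>I. of_bool (X i \<omega>) :: real)"
  proof (cases "\<exists>i\<in>I. X i \<omega>")
    case True
    then obtain i where "i \<in> I" "X i \<omega>" by auto
    then have "of_bool (X i \<omega>) \<le> (\<Sum>i\<in>I. of_bool (X i \<omega>) :: real)"
      by (intro member_le_sum assms) auto
    with \<open>X i \<omega>\<close> show ?thesis by simp
  qed (auto intro: sum_nonneg)
qed

lemma bprob_disj_le:
  assumes "0 \<le> p" "p \<le> 1"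
  shows "bprob p E (\<lambda>\<omega>. X \<omega> \<or> Y \<omega>) \<le> bprob p E X + bprob p E Y"
  unfolding bprob_def bexp_add[symmetric] by (intro bexp_mono assms) auto

text \<open>
  Used with r recording where a surgery took place: the events for different places are disjoint, so that the bounds for all places add up to one probability.
\<close>
lemma bprob_rec_sum_le:
  assumes "0 \<le> p" "p \<le> 1" "finite I"
  shows "(\<Sum>i\<in>I. bprob p E (\<lambda>\<omega>. X \<omega> \<and> r \<omega> = i)) \<le> bprob p E X"
  unfolding bprob_def bexp_sum[symmetric]
proof (intro bexp_mono assms(1,2))
  fix \<omega>
  have "(\<Sum>i\<in>I. of_bool (X \<omega> \<and> r \<omega> = i) :: real) = (\<Sum>i\<in>I. if i = r \<omega> then of_bool (X \<omega>) else 0)"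
    by (intro sum.cong) auto
  also have "\<dots> \<le> of_bool (X \<omega>)" using assms(3) by (simp add: sum.delta')
  finally show "(\<Sum>i\<in>I. of_bool (X \<omega> \<and> r \<omega> = i)) \<le> (of_bool (X \<omega>) :: real)" .
qed

lemma bprob_rec_sum:
  assumes "finite I" "\<And>\<omega>. \<omega> \<subseteq> E \<Longrightarrow> X \<omega> \<Longrightarrow> r \<omega> \<in> I"
  shows "(\<Sum>i\<in>I. bprob p E (\<lambda>\<omega>. X \<omega> \<and> r \<omega> = i)) = bprob p E X"
  unfolding bprob_def bexp_sum[symmetric]
proof (intro bexp_cong)
  fix \<omega> assume "\<omega> \<subseteq> E"
  have "(\<Sum>i\<in>I. of_bool (X \<omega> \<and> r \<omega> = i) :: real) = (\<Sum>i\<in>I. if i = r \<omega> then of_bool (X \<omega>) else 0)"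
    by (intro sum.cong) auto
  also have "\<dots> = of_bool (X \<omega>)" using assms(1) assms(2)[OF \<open>\<omega> \<subseteq> E\<close>] by (auto simp: sum.delta')
  finally show "(\<Sum>i\<in>I. of_bool (X \<omega> \<and> r \<omega> = i)) = (of_bool (X \<omega>) :: real)" .
qed

lemma harris_bprob:
  assumes "finite E" "0 \<le> p" "p \<le> 1"
    "\<And>\<alpha> \<beta>. \<alpha> \<subseteq> \<beta> \<Longrightarrow> \<beta> \<subseteq> E \<Longrightarrow> X \<alpha> \<Longrightarrow> X \<beta>" "\<And>\<alpha> \<beta>. \<alpha> \<subseteq> \<beta> \<Longrightarrow> \<beta> \<subseteq> E \<Longrightarrow> Y \<alpha> \<Longrightarrow> Y \<beta>"
  shows "bprob p E X * bprob p E Y \<le> bprob p E (\<lambda>\<omega>. X \<omega> \<and> Y \<omega>)"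
  unfolding bprob_def of_bool_conj
  by (intro harris assms(1-3) mono_onI) (use assms(4,5) in auto)

lemma harris_bprob_decreasing:
  assumes "finite E" "0 \<le> p" "p \<le> 1"
    "\<And>\<alpha> \<beta>. \<alpha> \<subseteq> \<beta> \<Longrightarrow> \<beta> \<subseteq> E \<Longrightarrow> X \<alpha> \<Longrightarrow> X \<beta>" "\<And>\<alpha> \<beta>. \<alpha> \<subseteq> \<beta> \<Longrightarrow> \<beta> \<subseteq> E \<Longrightarrow> Y \<beta> \<Longrightarrow> Y \<alpha>"
  shows "bprob p E (\<lambda>\<omega>. X \<omega> \<and> Y \<omega>) \<le> bprob p E X * bprob p E Y"
proof -
  have "bexp p E (\<lambda>\<omega>. of_bool (X \<omega>)) * bexp p E (\<lambda>\<omega>. - of_bool (Y \<omega>)) \<le>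
      bexp p E (\<lambda>\<omega>. of_bool (X \<omega>) * - of_bool (Y \<omega>))"
    by (intro harris assms(1-3) mono_onI) (use assms(4,5) in auto)
  then show ?thesis by (simp add: bexp_minus bprob_def of_bool_conj)
qed

lemma bprob_singleton_ge:
  assumes "finite D" "0 \<le> p" "p \<le> 1" "\<beta> \<subseteq> D" "X \<beta>"
  shows "min p (1 - p) ^ card D \<le> bprob p D X"
proof -
  have fb: "finite \<beta>" using assms finite_subset by auto
  have "min p (1 - p) ^ card D = min p (1 - p) ^ card \<beta> * min p (1 - p) ^ card (D - \<beta>)"
    using assms fb by (simp flip: power_add add: card_Diff_subset card_mono)
  also have "\<dots> \<le> p ^ card \<beta> * (1 - p) ^ card (D - \<beta>)"
    using assms by (intro mult_mono power_mono) auto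
  also have "\<dots> = p ^ card \<beta> * (1 - p) ^ card (D - \<beta>) * of_bool (X \<beta>)" using assms by simp
  also have "\<dots> \<le> bprob p D X"
    unfolding bprob_def bexp_def using assms
    by (intro member_le_sum[of \<beta> "Pow D" "\<lambda>\<omega>. p ^ card \<omega> * (1 - p) ^ card (D - \<omega>) * of_bool (X \<omega>)"]) auto
  finally show ?thesis .
qed

text \<open>
  For fixed states outside D, one pattern on D that leads into Y is enough, and it has probability at least \<open>min p (1 - p) ^ card D\<close>.
\<close>
lemma finite_energy:
  assumes "finite E" "0 \<le> p" "p \<le> 1" "D \<subseteq> E"
    and XY: "\<And>\<omega>. \<omega> \<subseteq> E \<Longrightarrow> X \<omega> \<Longrightarrow> \<exists>\<omega>'\<subseteq>E. \<omega>' - D = \<omega> - D \<and> Y \<omega>'"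
  shows "min p (1 - p) ^ card D * bprob p E X \<le> bprob p E Y"
proof -
  let ?m = "min p (1 - p) ^ card D"
  have fD: "finite D" "finite (E - D)" using assms finite_subset by auto
  have un: "bprob p E Z = bexp p (E - D) (\<lambda>\<alpha>. bprob p D (\<lambda>\<beta>. Z (\<alpha> \<union> \<beta>)))" for Z
    using bexp_Un[of "E - D" D p "\<lambda>\<omega>. of_bool (Z \<omega>)"] fD assms(4)
    by (simp add: bprob_def Un_absorb2 Int_commute)
  show ?thesis unfolding un[of X] un[of Y] bexp_cmult[symmetric]
  proof (intro bexp_mono assms(2,3))
    fix \<alpha> assume a: "\<alpha> \<subseteq> E - D"
    show "?m * bprob p D (\<lambda>\<beta>. X (\<alpha> \<union> \<beta>)) \<le> bprob p D (\<lambda>\<beta>. Y (\<alpha> \<union> \<beta>))"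
    proof (cases "\<exists>\<beta>\<subseteq>D. X (\<alpha> \<union> \<beta>)")
      case True
      then obtain \<beta> where b: "\<beta> \<subseteq> D" "X (\<alpha> \<union> \<beta>)" by auto
      then obtain \<omega>' where w: "\<omega>' \<subseteq> E" "\<omega>' - D = \<alpha> \<union> \<beta> - D" "Y \<omega>'"
        using XY[of "\<alpha> \<union> \<beta>"] a assms(4) by auto
      have "\<omega>' = \<alpha> \<union> (\<omega>' \<inter> D)" using w(2) a b(1) by auto
      then have "?m \<le> bprob p D (\<lambda>\<beta>. Y (\<alpha> \<union> \<beta>))"
        using w(3) fD assms by (intro bprob_singleton_ge[of _ _ "\<omega>' \<inter> D"]) auto
      moreover have "?m * bprob p D (\<lambda>\<beta>. X (\<alpha> \<union> \<beta>)) \<le> ?m * 1"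
        using assms fD by (intro mult_left_mono bprob_le_1) auto
      ultimately show ?thesis by simp
    next
      case False
      then have "bprob p D (\<lambda>\<beta>. X (\<alpha> \<union> \<beta>)) = bprob p D (\<lambda>\<beta>. False)" by (intro bprob_cong) auto
      also have "\<dots> = 0" by (simp add: bprob_def bexp_def)
      finally show ?thesis using assms by (simp add: bprob_nonneg)
    qed
  qed
qed

lemma measure_PiM_bernoulli:
  assumes "finite E" "E \<subseteq> I" "0 \<le> p" "p \<le> 1"
    and X: "\<And>\<omega>. X \<omega> \<longleftrightarrow> Y {e \<in> E. \<omega> e}"
  shows "\<P>(\<omega> in (\<Pi>\<^sub>M e\<in>I. measure_pmf (bernoulli_pmf p)). X \<omega>) = bprob p E Y"
proof -
  interpret product_prob_space "\<lambda>_. measure_pmf (bernoulli_pmf p)" I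
    by (intro product_prob_spaceI) (rule prob_space_measure_pmf)
  let ?M = "\<Pi>\<^sub>M e\<in>I. measure_pmf (bernoulli_pmf p)"
  have one: "\<P>(\<omega> in ?M. {e \<in> E. \<omega> e} = \<alpha>) = p ^ card \<alpha> * (1 - p) ^ card (E - \<alpha>)"
    and ms: "{\<omega> \<in> space ?M. {e \<in> E. \<omega> e} = \<alpha>} \<in> sets ?M" if "\<alpha> \<subseteq> E" for \<alpha>
  proof -
    have eq: "{\<omega> \<in> space ?M. {e \<in> E. \<omega> e} = \<alpha>} = {\<omega> \<in> space ?M. \<forall>e\<in>E. \<omega> e \<in> {e \<in> \<alpha>}}"
      using that by auto
    have "emeasure ?M {\<omega> \<in> space ?M. \<forall>e\<in>E. \<omega> e \<in> {e \<in> \<alpha>}} =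
       (\<Prod>e\<in>E. emeasure (measure_pmf (bernoulli_pmf p)) {e \<in> \<alpha>})"
      using assms by (intro emeasure_PiM_Collect) auto
    then have "measure ?M {\<omega> \<in> space ?M. \<forall>e\<in>E. \<omega> e \<in> {e \<in> \<alpha>}} =
       (\<Prod>e\<in>E. measure (measure_pmf (bernoulli_pmf p)) {e \<in> \<alpha>})"
      by (simp add: measure_pmf.emeasure_eq_measure emeasure_eq_measure prod_ennreal prod_nonneg)
    also have "\<dots> = (\<Prod>e\<in>E. if e \<in> \<alpha> then p else 1 - p)"
      using assms by (intro prod.cong) (auto simp: measure_pmf_single)
    also have "\<dots> = p ^ card \<alpha> * (1 - p) ^ card (E - \<alpha>)"
      using that assms(1) by (subst prod.If_cases) (auto simp: Int_absorb1 Diff_eq)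
    finally show "\<P>(\<omega> in ?M. {e \<in> E. \<omega> e} = \<alpha>) = p ^ card \<alpha> * (1 - p) ^ card (E - \<alpha>)"
      unfolding eq .
    show "{\<omega> \<in> space ?M. {e \<in> E. \<omega> e} = \<alpha>} \<in> sets ?M"
      unfolding eq using assms by (intro sets.sets_Collect_finite_All) (auto intro!: sets_Collect_single')
  qed
  have "{\<omega> \<in> space ?M. X \<omega>} = (\<Union>\<alpha>\<in>{\<alpha>. \<alpha> \<subseteq> E \<and> Y \<alpha>}. {\<omega> \<in> space ?M. {e \<in> E. \<omega> e} = \<alpha>})"
    using X by auto
  also have "measure ?M \<dots> = (\<Sum>\<alpha>\<in>{\<alpha>. \<alpha> \<subseteq> E \<and> Y \<alpha>}. \<P>(\<omega> in ?M. {e \<in> E. \<omega> e} = \<alpha>))"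
    using assms(1) ms by (intro finite_measure_finite_Union) (auto simp: disjoint_family_on_def)
  also have "\<dots> = (\<Sum>\<alpha>\<in>{\<alpha>. \<alpha> \<subseteq> E \<and> Y \<alpha>}. p ^ card \<alpha> * (1 - p) ^ card (E - \<alpha>))"
    by (intro sum.cong) (auto simp: one)
  also have "\<dots> = (\<Sum>\<alpha>\<in>Pow E. p ^ card \<alpha> * (1 - p) ^ card (E - \<alpha>) * of_bool (Y \<alpha>))"
    using assms(1) by (intro sum.mono_neutral_cong_left) auto
  finally show ?thesis by (simp add: bprob_def bexp_def)
qed

section \<open>Crossing paths in the plane\<close>

type_synonym site = "int \<times> int"

text \<open>
  Projecting an edge of the slab gives a step of length one or no step at all, so a step may stay where it is.
\<close>
definition nb :: "site \<Rightarrow> site \<Rightarrow> bool" where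
  "nb u v \<longleftrightarrow> \<bar>fst u - fst v\<bar> + \<bar>snd u - snd v\<bar> \<le> 1"

text \<open>
  Keeping only a set Z that contains the path makes it easy to attach straight pieces to a path: take unions.
\<close>
definition lconn :: "site set \<Rightarrow> site \<Rightarrow> site \<Rightarrow> bool" where
  "lconn Z u v \<longleftrightarrow> (\<exists>xs. xs \<noteq> [] \<and> set xs \<subseteq> Z \<and> hd xs = u \<and> last xs = v \<and> successively nb xs)"

lemma nb_sym: "nb u v \<longleftrightarrow> nb v u"
  by (auto simp: nb_def)

lemma nb_refl [simp]: "nb u u"
  by (simp add: nb_def)

lemma lconnI: "xs \<noteq> [] \<Longrightarrow> successively nb xs \<Longrightarrow> set xs \<subseteq> Z \<Longrightarrow> lconn Z (hd xs) (last xs)"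
  unfolding lconn_def by blast

lemma lconn_mono: "lconn Z u v \<Longrightarrow> Z \<subseteq> Z' \<Longrightarrow> lconn Z' u v"
  unfolding lconn_def by blast

lemma lconn_single: "lconn {u} u u"
  unfolding lconn_def by (rule exI[of _ "[u]"]) auto

lemma lconn_in: assumes "lconn Z u v" shows "u \<in> Z" "v \<in> Z"
  using assms unfolding lconn_def by (metis hd_in_set last_in_set subsetD)+

lemma lconn_sym: assumes "lconn Z u v" shows "lconn Z v u"
proof -
  from assms obtain xs where xs: "xs \<noteq> []" "set xs \<subseteq> Z" "hd xs = u" "last xs = v" "successively nb xs"
    unfolding lconn_def by blast
  then have "successively nb (rev xs)" by (simp add: nb_sym)
  then show ?thesis unfolding lconn_def using xs
    by (intro exI[of _ "rev xs"]) (auto simp: hd_rev last_rev)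
qed

lemma lconn_join:
  assumes "lconn Z u v" "nb v v'" "lconn Z' v' w"
  shows "lconn (Z \<union> Z') u w"
proof -
  from assms(1) obtain xs where xs: "xs \<noteq> []" "set xs \<subseteq> Z" "hd xs = u" "last xs = v" "successively nb xs"
    unfolding lconn_def by blast
  from assms(3) obtain ys where ys: "ys \<noteq> []" "set ys \<subseteq> Z'" "hd ys = v'" "last ys = w" "successively nb ys"
    unfolding lconn_def by blast
  show ?thesis unfolding lconn_def using xs ys assms(2)
    by (intro exI[of _ "xs @ ys"]) (auto simp: successively_append_iff)
qed

lemma lconn_trans: "lconn Z u v \<Longrightarrow> lconn Z v w \<Longrightarrow> lconn Z u w"
  using lconn_join[of Z u v v Z w] by simp

lemma lconn_upto:
  assumes "\<And>i. nb (f i) (f (Suc i))"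
  shows "lconn (f ` {..n}) (f 0) (f n)"
proof (induction n)
  case 0
  then show ?case using lconn_single[of "f 0"] by simp
next
  case (Suc n)
  from lconn_join[OF Suc assms lconn_single] show ?case
    by (simp add: atMost_Suc insert_is_Un[symmetric] Un_commute)
qed

lemma lconn_row: assumes "x1 \<le> x2" shows "lconn ({x1..x2} \<times> {y}) (x1, y) (x2, y)"
proof -
  have "lconn ((\<lambda>i. (x1 + int i, y)) ` {..nat (x2 - x1)}) (x1 + int 0, y) (x1 + int (nat (x2 - x1)), y)"
    by (rule lconn_upto) (simp add: nb_def)
  then show ?thesis using assms by (auto elim!: lconn_mono)
qed

lemma lconn_col: assumes "y1 \<le> y2" shows "lconn ({x} \<times> {y1..y2}) (x, y1) (x, y2)"
proof -
  have "lconn ((\<lambda>i. (x, y1 + int i)) ` {..nat (y2 - y1)}) (x, y1 + int 0) (x, y1 + int (nat (y2 - y1)))"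
    by (rule lconn_upto) (simp add: nb_def)
  then show ?thesis using assms by (auto elim!: lconn_mono)
qed

lemma lconn_induct:
  assumes "lconn Z u v" "P u" "\<And>a b. a \<in> Z \<Longrightarrow> b \<in> Z \<Longrightarrow> nb a b \<Longrightarrow> P a \<Longrightarrow> P b"
  shows "P v"
proof -
  from assms(1) obtain xs where xs: "xs \<noteq> []" "set xs \<subseteq> Z" "hd xs = u" "last xs = v" "successively nb xs"
    unfolding lconn_def by blast
  have "xs \<noteq> [] \<Longrightarrow> set xs \<subseteq> Z \<Longrightarrow> successively nb xs \<Longrightarrow> P (hd xs) \<Longrightarrow> P (last xs)"
  proof (induction xs rule: induct_list012)
    case (3 x y zs)
    then show ?case using assms(3)[of x y] by auto
  qed auto
  with xs assms(2) show ?thesis by auto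
qed

text \<open>
  The step from u to v crosses the ray that leaves the point at height one half above z to the right.
\<close>
definition crosses :: "site \<Rightarrow> site \<Rightarrow> site \<Rightarrow> bool" where
  "crosses z u v \<longleftrightarrow> fst u = fst v \<and> fst z < fst u \<and>
    (snd u = snd z \<and> snd v = snd z + 1 \<or> snd v = snd z \<and> snd u = snd z + 1)"

text \<open>
  Whether the list crosses the ray of z an odd number of times.
\<close>
fun parity :: "site \<Rightarrow> site list \<Rightarrow> bool" where
  "parity z (u # v # xs) = (crosses z u v \<noteq> parity z (v # xs))"
| "parity z _ = False"

lemma nb_cases:
  assumes "nb u v"
  obtains "v = u" | "v = (fst u + 1, snd u)" | "u = (fst v + 1, snd v)"
    | "v = (fst u, snd u + 1)" | "u = (fst v, snd v + 1)"
proof -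
  have "fst v = fst u \<and> snd v = snd u \<or> fst v = fst u + 1 \<and> snd v = snd u \<or> fst u = fst v + 1 \<and> snd v = snd u
    \<or> fst v = fst u \<and> snd v = snd u + 1 \<or> fst v = fst u \<and> snd u = snd v + 1"
    using assms unfolding nb_def by (smt (verit))
  then show ?thesis using that by (metis prod.collapse)
qed

text \<open>
  To the right of z, the ray is met whenever the path changes between the heights up to \<open>snd z\<close> and those above.
\<close>
lemma parity_left:
  assumes "successively nb xs" "xs \<noteq> []" "\<forall>u\<in>set xs. fst z < fst u"
  shows "parity z xs \<longleftrightarrow> (snd (hd xs) \<le> snd z) \<noteq> (snd (last xs) \<le> snd z)"
  using assms
proof (induction xs rule: induct_list012)
  case (3 u v xs)
  have "crosses z u v \<longleftrightarrow> (snd u \<le> snd z) \<noteq> (snd v \<le> snd z)"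
    using 3 unfolding crosses_def nb_def by auto
  then show ?case using 3 by auto
qed auto

lemma parity_right:
  assumes "\<forall>u\<in>set xs. fst u \<le> fst z"
  shows "\<not> parity z xs"
  using assms
proof (induction xs rule: induct_list012)
  case (3 u v xs)
  then show ?case by (auto simp: crosses_def)
qed auto

lemma parity_horiz:
  assumes "(x + 1, y) \<notin> set xs"
  shows "parity (x, y) xs = parity (x + 1, y) xs"
  using assms
proof (induction xs rule: induct_list012)
  case (3 u v xs)
  have "crosses (x, y) u v = crosses (x + 1, y) u v"
    using 3 by (cases u; cases v) (auto simp: crosses_def)
  then show ?case using 3 by auto
qed auto

text \<open>
  The two parities together count the entries to and the exits from the half row of sites to the right of (x, y + 1). A horizontal entry or exit would use the excluded site (x, y + 1).
\<close>
lemma parity_vert: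
  assumes "successively nb xs" "xs \<noteq> []" "(x, y + 1) \<notin> set xs"
  shows "parity (x, y) xs \<noteq> parity (x, y + 1) xs \<longleftrightarrow>
    (snd (hd xs) = y + 1 \<and> x < fst (hd xs)) \<noteq> (snd (last xs) = y + 1 \<and> x < fst (last xs))"
  using assms
proof (induction xs rule: induct_list012)
  case (3 u v xs)
  have "nb u v" "u \<noteq> (x, y + 1)" "v \<noteq> (x, y + 1)" using 3 by auto
  then have step: "crosses (x, y) u v \<noteq> crosses (x, y + 1) u v \<longleftrightarrow>
      (snd u = y + 1 \<and> x < fst u) \<noteq> (snd v = y + 1 \<and> x < fst v)"
    by (elim nb_cases; cases u; cases v) (auto simp: crosses_def)
  have IH: "parity (x, y) (v # xs) \<noteq> parity (x, y + 1) (v # xs) \<longleftrightarrow> (snd v = y + 1 \<and> x < fst v) \<noteq>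
      (snd (last (v # xs)) = y + 1 \<and> x < fst (last (v # xs)))"
    using 3 by simp
  have l: "last (u # v # xs) = last (v # xs)" by simp
  show ?case unfolding parity.simps(1) list.sel(1) l using step IH by argo
qed auto

lemma parity_move_up_prob:
  assumes "successively nb xs" "xs \<noteq> []" "(x, y + 1) \<notin> set xs"
    and "snd (hd xs) < y + 1" "y + 1 < snd (last xs)"
  shows "parity (x, y) xs = parity (x, y + 1) xs"
  using parity_vert[OF assms(1-3)] assms(4,5) by simp

lemma parity_move:
  assumes xs: "successively nb xs" "xs \<noteq> []"
    and "nb z z'" and z: "z \<notin> set xs" "z' \<notin> set xs"
    and y: "snd (hd xs) < snd z" "snd z < snd (last xs)" "snd (hd xs) < snd z'" "snd z' < snd (last xs)"
  shows "parity z xs = parity z' xs"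
  using assms(3)
proof (cases rule: nb_cases)
  case 2
  then show ?thesis using parity_horiz[of "fst z" "snd z" xs] z(2) by simp
next
  case 3
  then show ?thesis using parity_horiz[of "fst z'" "snd z'" xs] z(1) by simp
next
  case 4
  then show ?thesis using parity_move_up_prob[OF xs, of "fst z" "snd z"] z y by simp
next
  case 5
  then show ?thesis using parity_move_up_prob[OF xs, of "fst z'" "snd z'"] z y by simp
qed simp

text \<open>
  The parity of the second path with respect to the ray of z is odd when z is the left end of the first path and even when it is the right end. It does not change while z moves along the first path and stays off the second one.
\<close>
lemma crossing_strict:
  assumes 1: "lconn Z1 u1 v1" "\<forall>z\<in>Z1. c \<le> snd z \<and> snd z \<le> d" "fst u1 < a" "b < fst v1"
    and 2: "lconn Z2 u2 v2" "\<forall>z\<in>Z2. a \<le> fst z \<and> fst z \<le> b" "snd u2 < c" "d < snd v2"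
  shows "Z1 \<inter> Z2 \<noteq> {}"
proof
  assume disj: "Z1 \<inter> Z2 = {}"
  from 2(1) obtain xs where xs: "xs \<noteq> []" "set xs \<subseteq> Z2" "hd xs = u2" "last xs = v2" "successively nb xs"
    unfolding lconn_def by blast
  have "parity u1 xs"
    using parity_left[OF xs(5,1), of u1] xs 2 1 lconn_in[OF 1(1)] by force
  have "parity v1 xs"
  proof (rule lconn_induct[where P = "\<lambda>z. parity z xs", OF 1(1) \<open>parity u1 xs\<close>])
    fix y z assume yz: "y \<in> Z1" "z \<in> Z1" "nb y z" "parity y xs"
    then have "y \<notin> set xs" "z \<notin> set xs" "c \<le> snd y" "snd y \<le> d" "c \<le> snd z" "snd z \<le> d"
      using 1(2) xs(2) disj by auto
    then show "parity z xs"
      using parity_move[OF xs(5,1) yz(3)] 2(3,4) xs(3,4) yz(4) by auto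
  qed
  moreover have "\<not> parity v1 xs"
  proof (intro parity_right ballI)
    fix u assume "u \<in> set xs"
    then have "fst u \<le> b" using xs(2) 2(2) by auto
    then show "fst u \<le> fst v1" using 1(4) by simp
  qed
  ultimately show False by blast
qed

text \<open>
  Prolonging both paths by one site at each end reduces weak inequalities to strict ones; the added sites lie outside the region of the other path.
\<close>
lemma crossing:
  assumes 1: "lconn Z1 u1 v1" "\<forall>z\<in>Z1. c \<le> snd z \<and> snd z \<le> d" "fst u1 \<le> a" "b \<le> fst v1"
    and 2: "lconn Z2 u2 v2" "\<forall>z\<in>Z2. a \<le> fst z \<and> fst z \<le> b" "snd u2 \<le> c" "d \<le> snd v2"
  shows "Z1 \<inter> Z2 \<noteq> {}"
proof -
  let ?u1 = "(fst u1 - 1, snd u1)" and ?v1 = "(fst v1 + 1, snd v1)"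
  let ?u2 = "(fst u2, snd u2 - 1)" and ?v2 = "(fst v2, snd v2 + 1)"
  have c1: "lconn (({?u1} \<union> Z1) \<union> {?v1}) ?u1 ?v1"
    by (rule lconn_join[OF lconn_join[OF lconn_single _ 1(1)] _ lconn_single]) (auto simp: nb_def)
  have c2: "lconn (({?u2} \<union> Z2) \<union> {?v2}) ?u2 ?v2"
    by (rule lconn_join[OF lconn_join[OF lconn_single _ 2(1)] _ lconn_single]) (auto simp: nb_def)
  have "(({?u1} \<union> Z1) \<union> {?v1}) \<inter> (({?u2} \<union> Z2) \<union> {?v2}) \<noteq> {}"
    by (rule crossing_strict[OF c1 _ _ _ c2, of c d a b]) (use 1 2 lconn_in[OF 1(1)] lconn_in[OF 2(1)] in auto)
  moreover have "?u1 \<notin> Z2" "?v1 \<notin> Z2" "?u2 \<notin> Z1" "?v2 \<notin> Z1"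
    "fst u1 - 1 < fst u2" "fst u1 - 1 < fst v2" "fst v1 + 1 > fst u2" "fst v1 + 1 > fst v2"
    using 1 2 lconn_in[OF 2(1)] by force+
  ultimately show ?thesis by (auto simp: prod_eq_iff)
qed

text \<open>
  A path from a point of the left wall to the top separates the part of the wall above that point from the part below and from the bottom. For the proof, G is prolonged to the right above the rectangle, and H along the column to the left of the wall.
\<close>
lemma crossing_wall:
  assumes g: "lconn G (0, y1) (xg, hi - 1)" "G \<subseteq> {0..<w} \<times> {lo..<hi}"
    and h: "lconn H u (0, y2)" "H \<subseteq> {0..<w} \<times> {lo..<hi}"
    and u: "snd u = lo \<or> fst u = 0 \<and> snd u < y1" and y: "y1 < y2"
  shows "G \<inter> H \<noteq> {}"
proof -
  let ?Z1 = "({(-1, y1)} \<union> G) \<union> {xg..w} \<times> {hi}"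
  have in_G: "0 \<le> xg" "xg < w" "y1 < hi" "lo \<le> y1" using lconn_in[OF g(1)] g(2) by auto
  have in_H: "lo \<le> snd u" "y2 < hi" using lconn_in[OF h(1)] h(2) by auto
  have c1: "lconn ?Z1 (-1, y1) (w, hi)"
    by (rule lconn_join[OF lconn_join[OF lconn_single _ g(1)] _ lconn_row]) (use in_G in \<open>auto simp: nb_def\<close>)
  have c2: "lconn (H \<union> {-1} \<times> {y2..hi}) u (-1, hi)"
    by (rule lconn_join[OF h(1) _ lconn_col]) (use in_H in \<open>auto simp: nb_def\<close>)
  show ?thesis
  proof (cases "snd u = lo")
    case True
    have "?Z1 \<inter> (H \<union> {-1} \<times> {y2..hi}) \<noteq> {}"
      by (rule crossing[OF c1 _ _ _ c2, of lo hi "-1" "w - 1"]) (use in_G in_H g(2) h(2) True in auto)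
    then show ?thesis using g(2) h(2) in_G in_H y by auto
  next
    case False
    have c3: "lconn ({-1} \<times> {lo..snd u} \<union> (H \<union> {-1} \<times> {y2..hi})) (-1, lo) (-1, hi)"
      by (rule lconn_join[OF lconn_col _ c2]) (use in_H u False in \<open>auto simp: nb_def\<close>)
    have "?Z1 \<inter> ({-1} \<times> {lo..snd u} \<union> (H \<union> {-1} \<times> {y2..hi})) \<noteq> {}"
      by (rule crossing[OF c1 _ _ _ c3, of lo hi "-1" "w - 1"]) (use in_G in_H g(2) h(2) in auto)
    then show ?thesis using g(2) h(2) in_G in_H y u False by auto
  qed
qed

lemma lconn_shift: assumes "lconn Z u v" shows "lconn ((\<lambda>z. (fst z + i, snd z + j)) ` Z) (fst u + i, snd u + j) (fst v + i, snd v + j)"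
proof -
  from assms obtain xs where xs: "xs \<noteq> []" "set xs \<subseteq> Z" "hd xs = u" "last xs = v" "successively nb xs"
    unfolding lconn_def by blast
  show ?thesis unfolding lconn_def using xs
    by (intro exI[of _ "map (\<lambda>z. (fst z + i, snd z + j)) xs"])
       (auto simp: hd_map last_map successively_map nb_def)
qed

text \<open>
  After a shift to the right by one, the outer end of the second arc is prolonged upwards in the new column 0. It then becomes a path from the wall to the top.
\<close>
lemma crossing_arcs:
  assumes g: "lconn G (0, s1) (0, e1)" "G \<subseteq> {0..<w} \<times> {lo..<hi}"
    and h: "lconn H (0, s2) (0, e2)" "H \<subseteq> {0..<w} \<times> {lo..<hi}"
    and y: "s1 < s2" "s2 < e1" "e1 < e2"
  shows "G \<inter> H \<noteq> {}"
proof -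
  let ?s = "\<lambda>z. (fst z + 1, snd z + 0) :: site"
  let ?H = "({(0, s2)} \<union> ?s ` H) \<union> {0} \<times> {e2..hi-1}"
  let ?G = "({(0, s1)} \<union> ?s ` G) \<union> {(0, e1)}"
  have i: "lo \<le> s1" "e2 < hi" "0 < w" using lconn_in[OF g(1)] lconn_in[OF h(1)] g(2) h(2) by auto
  have c1: "lconn ?H (0, s2) (0, hi - 1)"
    by (rule lconn_join[OF lconn_join[OF lconn_single _ lconn_shift[OF h(1)]] _ lconn_col]) (use i in \<open>auto simp: nb_def\<close>)
  have c2: "lconn ?G (0, s1) (0, e1)"
    by (rule lconn_join[OF lconn_join[OF lconn_single _ lconn_shift[OF g(1)]] _ lconn_single]) (auto simp: nb_def)
  have "?H \<inter> ?G \<noteq> {}"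
    by (rule crossing_wall[OF c1 _ c2, of "w + 1" lo]) (use g(2) h(2) y i in auto)
  then obtain z where z: "z \<in> ?H" "z \<in> ?G" by blast
  have pos: "\<And>z. z \<in> G \<Longrightarrow> 0 \<le> fst z" "\<And>z. z \<in> H \<Longrightarrow> 0 \<le> fst z" using g(2) h(2) by auto
  show ?thesis
  proof (cases "fst z = 0")
    case True
    then have "z \<notin> ?s ` G" "z \<notin> ?s ` H" using pos by force+
    then show ?thesis using z y by auto
  next
    case False
    then have "z \<in> ?s ` G" "z \<in> ?s ` H" using z by auto
    then show ?thesis by (auto simp: prod_eq_iff)
  qed
qed

text \<open>
  G is prolonged to the right below the box, and H upwards to the right of the box.
\<close>
lemma crossing_corners:
  assumes g: "lconn G (0, yg) (xg, 0)" "G \<subseteq> {0..<w} \<times> {0..<h}"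
    and h: "lconn H (w - 1, yh) (xh, 0)" "H \<subseteq> {0..<w} \<times> {0..<h}"
    and "xh < xg"
  shows "G \<inter> H \<noteq> {}"
proof -
  let ?Z1 = "G \<union> {xg..w} \<times> {-1}" and ?Z2 = "({(xh, -1)} \<union> H) \<union> {w} \<times> {yh..h-1}"
  have i: "0 \<le> xg" "xg < w" "0 \<le> yh" "yh < h" "0 \<le> xh" using lconn_in[OF g(1)] lconn_in[OF h(1)] g(2) h(2) by auto
  have c1: "lconn ?Z1 (0, yg) (w, -1)"
    by (rule lconn_join[OF g(1) _ lconn_row]) (use i in \<open>auto simp: nb_def\<close>)
  have c2: "lconn ?Z2 (xh, -1) (w, h - 1)"
    by (rule lconn_join[OF lconn_join[OF lconn_single _ lconn_sym[OF h(1)]] _ lconn_col]) (use i in \<open>auto simp: nb_def\<close>)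
  have "?Z1 \<inter> ?Z2 \<noteq> {}"
    by (rule crossing[OF c1 _ _ _ c2, of "-1" "h - 1" 0 w]) (use g(2) h(2) i assms(5) in auto)
  then show ?thesis using g(2) h(2) assms(5) i by auto
qed

section \<open>Paths, simple paths and the least open path\<close>

text \<open>
  A list is an open path for \<open>\<omega>\<close> if its edges belong to \<open>\<omega>\<close>.
\<close>
fun pedges :: "'v list \<Rightarrow> 'v set set" where
  "pedges (x # y # xs) = insert {x, y} (pedges (y # xs))"
| "pedges _ = {}"

lemma pedges_subset: "e \<in> pedges xs \<Longrightarrow> e \<subseteq> set xs"
  by (induction xs rule: induct_list012) auto

lemma pedges_nonempty: "e \<in> pedges xs \<Longrightarrow> e \<noteq> {}"
  by (induction xs rule: induct_list012) auto

lemma successively_pedges: "successively (\<lambda>x y. {x, y} \<in> \<omega>) xs \<longleftrightarrow> pedges xs \<subseteq> \<omega>"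
  by (induction xs rule: induct_list012) auto

lemma pedges_append: "pedges (xs @ a # ys) = pedges (xs @ [a]) \<union> pedges (a # ys)"
  by (induction xs rule: induct_list012) auto

lemma pedges_append2: "pedges (xs @ a # b # ys) = pedges (xs @ [a]) \<union> {{a, b}} \<union> pedges (b # ys)"
  by (subst pedges_append) simp

lemma pedges_snoc: "xs \<noteq> [] \<Longrightarrow> pedges (xs @ [z]) = insert {last xs, z} (pedges xs)"
  by (induction xs rule: induct_list012) auto

definition stp :: "'v set set \<Rightarrow> 'v set \<Rightarrow> 'v \<Rightarrow> 'v \<Rightarrow> bool" where
  "stp \<omega> V a b \<longleftrightarrow> a \<in> V \<and> b \<in> V \<and> {a, b} \<in> \<omega>"

definition conn :: "'v set set \<Rightarrow> 'v set \<Rightarrow> 'v set \<Rightarrow> 'v set \<Rightarrow> bool" where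
  "conn \<omega> V A B \<longleftrightarrow> (\<exists>xs. xs \<noteq> [] \<and> set xs \<subseteq> V \<and> pedges xs \<subseteq> \<omega> \<and> hd xs \<in> A \<and> last xs \<in> B)"

abbreviation reach :: "'v set set \<Rightarrow> 'v set \<Rightarrow> 'v \<Rightarrow> 'v \<Rightarrow> bool" where
  "reach \<omega> V \<equiv> (stp \<omega> V)\<^sup>*\<^sup>*"

lemma stp_sym: "stp \<omega> V a b = stp \<omega> V b a"
  by (auto simp: stp_def insert_commute)

lemma reach_sym: "reach \<omega> V a b \<Longrightarrow> reach \<omega> V b a"
  using symp_rtranclp[of "stp \<omega> V"] by (auto simp: symp_def stp_sym)

lemma reach_list:
  assumes "pedges xs \<subseteq> \<omega>" "set xs \<subseteq> V" "x \<in> set xs" "y \<in> set xs"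
  shows "reach \<omega> V x y"
proof -
  have hd: "reach \<omega> V (hd xs) y" if "y \<in> set xs" for y
    using assms(1,2) that
  proof (induction xs rule: induct_list012)
    case (3 a b zs)
    have "stp \<omega> V a b" using 3 by (auto simp: stp_def)
    then show ?case using 3 by (auto intro: converse_rtranclp_into_rtranclp)
  qed auto
  show ?thesis using reach_sym[OF hd[OF assms(3)]] hd[OF assms(4)] by simp
qed

lemma reach_in: "reach \<omega> V x y \<Longrightarrow> x \<in> V \<Longrightarrow> y \<in> V"
  by (induction rule: rtranclp_induct) (auto simp: stp_def)

lemma reach_path:
  assumes "reach \<omega> V x y" "x \<in> V"
  shows "\<exists>xs. xs \<noteq> [] \<and> set xs \<subseteq> V \<and> pedges xs \<subseteq> \<omega> \<and> hd xs = x \<and> last xs = y"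
  using assms(1)
proof (induction rule: rtranclp_induct)
  case base
  then show ?case using assms(2) by (intro exI[of _ "[x]"]) auto
next
  case (step y z)
  then obtain xs where xs: "xs \<noteq> []" "set xs \<subseteq> V" "pedges xs \<subseteq> \<omega>" "hd xs = x" "last xs = y" by auto
  then have "pedges (xs @ [z]) \<subseteq> \<omega>" using step(2) by (auto simp: stp_def pedges_snoc)
  then show ?case using xs step(2) by (intro exI[of _ "xs @ [z]"]) (auto simp: stp_def)
qed

lemma conn_iff_reach: "conn \<omega> V A B \<longleftrightarrow> (\<exists>a\<in>A \<inter> V. \<exists>b\<in>B. reach \<omega> V a b)"
proof
  assume "conn \<omega> V A B"
  then obtain xs where "xs \<noteq> []" "set xs \<subseteq> V" "pedges xs \<subseteq> \<omega>" "hd xs \<in> A" "last xs \<in> B"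
    unfolding conn_def by auto
  then show "\<exists>a\<in>A \<inter> V. \<exists>b\<in>B. reach \<omega> V a b"
    using reach_list[of xs \<omega> V "hd xs" "last xs"] by (intro bexI[of _ "hd xs"] bexI[of _ "last xs"]) (auto simp: subset_iff)
next
  assume "\<exists>a\<in>A \<inter> V. \<exists>b\<in>B. reach \<omega> V a b"
  then show "conn \<omega> V A B" using reach_path unfolding conn_def by fastforce
qed

lemma conn_sym: "conn \<omega> V A B \<Longrightarrow> conn \<omega> V B A"
  unfolding conn_iff_reach using reach_sym reach_in by fastforce

lemma conn_mono: "conn \<omega> V A B \<Longrightarrow> \<omega> \<subseteq> \<omega>' \<Longrightarrow> V \<subseteq> V' \<Longrightarrow> A \<subseteq> A' \<Longrightarrow> B \<subseteq> B' \<Longrightarrow> conn \<omega>' V' A' B'"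
  unfolding conn_def by blast

text \<open>
  Shortest connections from A to B have this form. None of these paths is a proper prefix of another one, so two of them always separate at some vertex.
\<close>
definition simple_paths :: "'v set \<Rightarrow> 'v set \<Rightarrow> 'v set \<Rightarrow> 'v set set \<Rightarrow> 'v list set" where
  "simple_paths V A B \<omega> = {xs. xs \<noteq> [] \<and> distinct xs \<and> set xs \<subseteq> V \<and> pedges xs \<subseteq> \<omega> \<and> hd xs \<in> A \<and> last xs \<in> B \<and>
      set (tl xs) \<inter> A = {} \<and> set (butlast xs) \<inter> B = {}}"

text \<open>
  A shortest connecting list has no repetition and meets A and B at its ends only, since otherwise it could be shortened.
\<close>
lemma conn_iff_simple_path: "conn \<omega> V A B \<longleftrightarrow> simple_paths V A B \<omega> \<noteq> {}"
proof
  let ?P = "\<lambda>xs. xs \<noteq> [] \<and> set xs \<subseteq> V \<and> pedges xs \<subseteq> \<omega> \<and> hd xs \<in> A \<and> last xs \<in> B"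
  assume "conn \<omega> V A B"
  then have "\<exists>xs. ?P xs" by (simp add: conn_def)
  then obtain xs where xs: "?P xs" and min: "\<And>ys. ?P ys \<Longrightarrow> length xs \<le> length ys"
    using ex_has_least_nat[of ?P _ length] by metis
  have "distinct xs"
  proof (rule ccontr)
    assume "\<not> distinct xs"
    then obtain us x vs ws where d: "xs = us @ [x] @ vs @ [x] @ ws" using not_distinct_decomp by blast
    have "pedges xs = pedges (us @ [x]) \<union> (pedges ((x # vs) @ [x]) \<union> pedges (x # ws))"
      using pedges_append[of us x "vs @ x # ws"] pedges_append[of "x # vs" x ws] d by simp
    then have "?P (us @ x # ws)"
      using xs pedges_append[of us x ws] unfolding d by (auto simp: hd_append)
    then show False using min[of "us @ x # ws"] d by simp
  qed
  moreover have "set (tl xs) \<inter> A = {}"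
  proof (rule ccontr)
    assume "set (tl xs) \<inter> A \<noteq> {}"
    then obtain a us vs where a: "a \<in> A" "tl xs = us @ a # vs" by (metis disjoint_iff split_list)
    then have d: "xs = (hd xs # us) @ a # vs" using xs by (metis append_Cons hd_Cons_tl)
    then have "?P (a # vs)" using xs pedges_append[of "hd xs # us" a vs] a by (metis (no_types, lifting)
      Un_subset_iff append_is_Nil_conv last_appendR list.distinct(1) list.sel(1) set_append)
    then show False using min[of "a # vs"] d by (metis add_is_0 le_add_same_cancel2 length_0_conv length_append list.distinct(1) le_add2 le_antisym add_diff_cancel_left' self_append_conv2 diff_add_inverse2)
  qed
  moreover have "set (butlast xs) \<inter> B = {}"
  proof (rule ccontr)
    assume "set (butlast xs) \<inter> B \<noteq> {}"
    then obtain a us vs where a: "a \<in> B" "butlast xs = us @ a # vs" by (metis disjoint_iff split_list)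
    then have d: "xs = us @ a # (vs @ [last xs])" using xs by (metis append_butlast_last_id append_Cons append_assoc)
    have "?P (us @ [a])"
    proof (intro conjI)
      show "hd (us @ [a]) \<in> A" using xs d by (metis hd_append list.sel(1))
      show "pedges (us @ [a]) \<subseteq> \<omega>" using xs d pedges_append[of us a "vs @ [last xs]"] by (metis Un_subset_iff)
      have "set xs = set us \<union> insert a (set vs \<union> {last xs})" using d by (metis set_append list.simps(15) list.set(1))
      then show "set (us @ [a]) \<subseteq> V" using xs by auto
    qed (use a in auto)
    then have "length xs \<le> length us + 1" using min[of "us @ [a]"] by simp
    moreover have "length xs = length us + length vs + 2" using arg_cong[OF d, of length] by simp
    ultimately show False by simp
  qed
  ultimately show "simple_paths V A B \<omega> \<noteq> {}" using xs unfolding simple_paths_def by blast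
next
  assume "simple_paths V A B \<omega> \<noteq> {}"
  then show "conn \<omega> V A B" unfolding simple_paths_def conn_def by blast
qed

lemma finite_simple_paths: "finite V \<Longrightarrow> finite (simple_paths V A B \<omega>)"
  by (rule finite_subset[OF _ finite_subset_distinct[of V]]) (auto simp: simple_paths_def)

text \<open>
  The family R of local preferences ranks, for every vertex a, the vertices that may follow a. The key of a path is the sequence of the ranks of its steps; lexicographic comparison of keys corresponds to exploring paths step by step, the preferred step first.
\<close>
fun wkey :: "('v \<Rightarrow> 'v \<Rightarrow> nat) \<Rightarrow> 'v \<Rightarrow> 'v list \<Rightarrow> nat list" where
  "wkey R a [] = []"
| "wkey R a (x # xs) = R a x # wkey R x xs"

fun key :: "('v \<Rightarrow> nat) \<Rightarrow> ('v \<Rightarrow> 'v \<Rightarrow> nat) \<Rightarrow> 'v list \<Rightarrow> nat list" where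
  "key h R [] = []"
| "key h R (x # xs) = h x # wkey R x xs"

lemma wkey_append: "wkey R a (xs @ ys) = wkey R a xs @ wkey R (last (a # xs)) ys"
  by (induction xs arbitrary: a) auto

lemma append_less_append: "(c @ x < c @ y) = (x < (y :: nat list))"
  by (induction c) auto

lemma key_less_hd: "h x \<noteq> h y \<Longrightarrow> key h R (x # r) < key h R (y # s) \<longleftrightarrow> h x < h y"
  by auto

lemma key_less_dev:
  assumes "R a x \<noteq> R a y"
  shows "key h R (c @ a # x # r) < key h R (c @ a # y # s) \<longleftrightarrow> R a x < R a y"
proof (cases c)
  case Nil
  then show ?thesis using assms by simp
next
  case (Cons b c')
  then show ?thesis using assms by (auto simp: wkey_append append_less_append)
qed

text \<open>
  Two paths separate either at their first vertex or after a common vertex a; in the second case only the preferences at a decide which key is smaller.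
\<close>
lemma list_deviation:
  assumes "xs \<noteq> []" "ys \<noteq> []" "\<not> prefix xs ys" "\<not> prefix ys xs"
  obtains x y r s where "x \<noteq> y" "xs = x # r" "ys = y # s"
  | c a x y r s where "x \<noteq> y" "xs = c @ a # x # r" "ys = c @ a # y # s"
proof -
  have "xs \<parallel> ys" using assms by (auto simp: parallel_def)
  from parallel_decomp[OF this] obtain c x r y s where d: "x \<noteq> y" "xs = c @ x # r" "ys = c @ y # s"
    by blast
  show ?thesis
  proof (cases c rule: rev_cases)
    case Nil
    then show ?thesis using that(1) d by auto
  next
    case (snoc c' a)
    then show ?thesis using that(2)[of x y c' a r s] d by auto
  qed
qed

lemma simple_paths_prefix:
  assumes "xs \<in> simple_paths V A B \<omega>" "ys \<in> simple_paths V A B \<omega>'" "prefix xs ys"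
  shows "xs = ys"
proof -
  obtain zs where zs: "ys = xs @ zs" using assms(3) by (auto simp: prefix_def)
  have "zs = []"
  proof (rule ccontr)
    assume "zs \<noteq> []"
    then have "set (butlast ys) = set xs \<union> set (butlast zs)" using zs by (simp add: butlast_append)
    moreover have "last xs \<in> set xs" "last xs \<in> B" using assms(1) by (auto simp: simple_paths_def)
    ultimately show False using assms(2) by (auto simp: simple_paths_def)
  qed
  then show ?thesis using zs by simp
qed

lemma simple_paths_deviation:
  assumes "xs \<in> simple_paths V A B \<omega>" "ys \<in> simple_paths V A B \<omega>'" "xs \<noteq> ys"
  obtains x y r s where "x \<noteq> y" "xs = x # r" "ys = y # s"
  | c a x y r s where "x \<noteq> y" "xs = c @ a # x # r" "ys = c @ a # y # s"
proof -
  have *: "xs \<noteq> []" "ys \<noteq> []" "\<not> prefix xs ys" "\<not> prefix ys xs"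
    using assms simple_paths_prefix[OF assms(1,2)] simple_paths_prefix[OF assms(2,1)] unfolding simple_paths_def by blast+
  show ?thesis by (rule list_deviation[OF *]) (use that in blast)+
qed

lemma key_inj:
  assumes "xs \<in> simple_paths V A B \<omega>" "ys \<in> simple_paths V A B \<omega>'" "key h R xs = key h R ys"
    "inj_on h V" "\<And>v. v \<in> V \<Longrightarrow> inj_on (R v) V"
  shows "xs = ys"
proof (rule ccontr)
  assume "xs \<noteq> ys"
  have V: "set xs \<subseteq> V" "set ys \<subseteq> V" using assms by (auto simp: simple_paths_def)
  from assms(1,2) \<open>xs \<noteq> ys\<close> show False
  proof (rule simple_paths_deviation)
    fix x y r s assume "x \<noteq> y" "xs = x # r" "ys = y # s"
    then show False using assms(3,4) V by (auto simp: inj_on_def)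
  next
    fix c a x y r s assume d: "x \<noteq> y" "xs = c @ a # x # r" "ys = c @ a # y # s"
    then have "R a x \<noteq> R a y" using assms(5)[of a] V by (auto simp: inj_on_def)
    then have "key h R xs < key h R ys \<or> key h R ys < key h R xs" using d key_less_dev[of R a] by fastforce
    then show False using assms(3) by simp
  qed
qed

text \<open>
  The selection rule. It is only meaningful if A and B are connected.
\<close>
definition least_path :: "('v \<Rightarrow> nat) \<Rightarrow> ('v \<Rightarrow> 'v \<Rightarrow> nat) \<Rightarrow> 'v set \<Rightarrow> 'v set \<Rightarrow> 'v set \<Rightarrow> 'v set set \<Rightarrow> 'v list" where
  "least_path h R V A B \<omega> = arg_min_on (key h R) (simple_paths V A B \<omega>)"

lemma least_path_in:
  assumes "finite V" "conn \<omega> V A B"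
  shows "least_path h R V A B \<omega> \<in> simple_paths V A B \<omega>"
  using arg_min_if_finite(1)[OF finite_simple_paths[OF assms(1)]] assms(2) unfolding conn_iff_simple_path least_path_def by blast

lemma least_path_min:
  assumes "finite V" "xs \<in> simple_paths V A B \<omega>"
  shows "key h R (least_path h R V A B \<omega>) \<le> key h R xs"
  unfolding least_path_def using assms arg_min_if_finite(2)[OF finite_simple_paths[OF assms(1)], of A B \<omega> "key h R"]
  by (metis empty_iff not_le_imp_less)

lemma least_path_eqI:
  assumes "finite V" "xs \<in> simple_paths V A B \<omega>" "inj_on h V" "\<And>v. v \<in> V \<Longrightarrow> inj_on (R v) V"
    "\<And>ys. ys \<in> simple_paths V A B \<omega> \<Longrightarrow> \<not> key h R ys < key h R xs"
  shows "least_path h R V A B \<omega> = xs"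
proof (rule key_inj[OF _ assms(2) _ assms(3,4)])
  show *: "least_path h R V A B \<omega> \<in> simple_paths V A B \<omega>" using assms(1,2) conn_iff_simple_path by (intro least_path_in) blast+
  show "key h R (least_path h R V A B \<omega>) = key h R xs"
    using least_path_min[OF assms(1,2), of h R] assms(5)[OF *] by simp
qed

section \<open>Surgery along a least path\<close>

lemma split_unique:
  assumes "xs = a @ w # b" "xs = a' @ w # b'" "distinct xs"
  shows "a = a'" "b = b'"
proof -
  have "a = a' \<and> b = b'" using assms
  proof (induction xs arbitrary: a a')
    case (Cons x xs)
    show ?case
    proof (cases a)
      case Nil
      then show ?thesis using Cons.prems by (cases a') auto
    next
      case (Cons y a2)
      note a = this
      show ?thesis
      proof (cases a')
        case Nil
        then show ?thesis using Cons.prems a by auto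
      next
        case (Cons y' a2')
        then show ?thesis using Cons.IH[of a2 a2'] Cons.prems a by simp
      qed
    qed
  qed simp
  then show "a = a'" "b = b'" by auto
qed

text \<open>
  Exchanging the initial piece of one simple path for that of another one which hits the rest of it for the first time at t.
\<close>
lemma simple_paths_subpath:
  assumes "\<tau> \<in> simple_paths V A B \<omega>" "\<tau> = p @ t # q" "\<gamma> \<in> simple_paths V A B \<omega>'" "\<gamma> = g @ t # r"
    and "pedges (p @ [t]) \<subseteq> \<omega>'" "set p \<inter> set (t # r) = {}" "q = [] \<longrightarrow> r = []"
  shows "p @ t # r \<in> simple_paths V A B \<omega>'"
proof -
  have t: "distinct \<tau>" "set \<tau> \<subseteq> V" "hd \<tau> \<in> A" "set (tl \<tau>) \<inter> A = {}" "set (butlast \<tau>) \<inter> B = {}"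
    and g: "distinct \<gamma>" "set \<gamma> \<subseteq> V" "pedges \<gamma> \<subseteq> \<omega>'" "last \<gamma> \<in> B" "set (tl \<gamma>) \<inter> A = {}" "set (butlast \<gamma>) \<inter> B = {}"
    using assms(1,3) unfolding simple_paths_def by auto
  have rA: "set r \<inter> A = {}" using g(5) assms(4) by (cases g) auto
  have ptA: "set (tl (p @ [t])) \<inter> A = {}" using t(4) assms(2) by (cases p) auto
  have "set (tl (p @ t # r)) \<inter> A = {}" using ptA rA by (cases p) auto
  moreover have "set (butlast (p @ t # r)) \<inter> B = {}"
    using t(5) g(6) assms(2,4,7) by (cases "r = []"; cases "q = []") (auto simp: butlast_append)
  moreover have "distinct (p @ t # r)" using t(1) g(1) assms(2,4,6) by auto
  moreover have "hd (p @ t # r) \<in> A" using t(3) assms(2) by (cases p) auto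
  moreover have "last (p @ t # r) \<in> B" using g(4) assms(4) by (cases r) auto
  moreover have "pedges (p @ t # r) \<subseteq> \<omega>'"
    using g(3) assms(4,5) pedges_append[of g t r] pedges_append[of p t r] by auto
  moreover have "set (p @ t # r) \<subseteq> V" using t(2) g(2) assms(2,4) by auto
  ultimately show ?thesis unfolding simple_paths_def by blast
qed

text \<open>
  The new configuration may create new paths, but all of them run through w and then take the step to u. Such a path can only be smaller by having separated before w, because at w the step of \<open>\<gamma>\<close> is preferred to u. But then the piece before w, which is open in the old configuration, already leads to the tail of \<open>\<gamma>\<close>, and following the tail gives a smaller path in the old configuration.
\<close>
lemma least_path_surgery:
  assumes fin: "finite V" "inj_on h V" "\<And>v. v \<in> V \<Longrightarrow> inj_on (R v) V"
    and g: "\<gamma> \<in> simple_paths V A B \<omega>" "\<gamma> \<in> simple_paths V A B \<omega>'" "least_path h R V A B \<omega> = \<gamma>"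
    and w: "w \<in> set \<gamma>" "u \<notin> set \<gamma>"
    and N: "\<And>\<tau>. \<tau> \<in> simple_paths V A B \<omega>' \<Longrightarrow> \<tau> \<notin> simple_paths V A B \<omega> \<Longrightarrow> \<exists>\<alpha> \<beta>. \<tau> = \<alpha> @ w # u # \<beta> \<and> pedges (\<alpha> @ [w]) \<subseteq> \<omega>"
    and right: "\<And>g1 b g2. \<gamma> = g1 @ w # b # g2 \<Longrightarrow> R w b < R w u"
  shows "least_path h R V A B \<omega>' = \<gamma>"
proof (rule least_path_eqI[OF fin(1) g(2) fin(2,3)], assumption)
  fix \<tau> assume t: "\<tau> \<in> simple_paths V A B \<omega>'"
  have gmin: "\<not> key h R \<sigma> < key h R \<gamma>" if "\<sigma> \<in> simple_paths V A B \<omega>" for \<sigma>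
    using least_path_min[OF fin(1) that, of h R] g(3) by auto
  show "\<not> key h R \<tau> < key h R \<gamma>"
  proof
    assume less: "key h R \<tau> < key h R \<gamma>"
    then have "\<tau> \<notin> simple_paths V A B \<omega>" "\<tau> \<noteq> \<gamma>" using gmin by auto
    then obtain \<alpha> \<beta> where ab: "\<tau> = \<alpha> @ w # u # \<beta>" "pedges (\<alpha> @ [w]) \<subseteq> \<omega>" using N t by blast
    obtain g1 g2 where gg: "\<gamma> = g1 @ w # g2" using split_list[OF w(1)] by blast
    have dt: "distinct \<tau>" "set \<tau> \<subseteq> V" "set (butlast \<tau>) \<inter> B = {}" using t unfolding simple_paths_def by auto
    have dg: "distinct \<gamma>" "set \<gamma> \<subseteq> V" "last \<gamma> \<in> B" using g(1) unfolding simple_paths_def by auto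
    have "w \<notin> B" using dt(3) ab(1) by (auto simp: butlast_append)
    then obtain b g3 where g2: "g2 = b # g3" using dg(3) gg by (cases g2) auto
    have Rwb: "R w b < R w u" using right gg g2 by blast
    \<comment> \<open>if the paths separate before w, the old path can be improved within the old configuration\<close>
    have deviate: False if c: "\<tau> = c @ x # r" "\<gamma> = c @ y # s" "w \<notin> set c"
      and lt: "\<And>r' s'. key h R (c @ x # r') < key h R (c @ y # s')" for c x y r s
    proof -
      have "w \<in> set \<tau>" using ab(1) by simp
      then have "w \<in> set (x # r)" using c(1,3) by auto
      from split_list[OF this] obtain r1 r2 where r: "x # r = r1 @ w # r2" by blast
      have r12: "\<alpha> = c @ r1" "r2 = u # \<beta>"
        using split_unique[OF ab(1) _ dt(1), of "c @ r1" r2] c(1) r by auto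
      have "w \<in> set (y # s)" using c(2,3) w(1) by auto
      from split_list[OF this] obtain s1 s2 where s: "y # s = s1 @ w # s2" by blast
      have s12: "g1 = c @ s1" "g2 = s2"
        using split_unique[OF gg _ dg(1), of "c @ s1" s2] c(2) s by auto
      have "\<exists>t\<in>set (r1 @ [w]). t \<in> set (w # g2)" by auto
      then obtain p t q where ptq: "r1 @ [w] = p @ t # q" "t \<in> set (w # g2)" "\<forall>v\<in>set p. v \<notin> set (w # g2)"
        using split_list_first_prop[of "r1 @ [w]" "\<lambda>t. t \<in> set (w # g2)"] by blast
      obtain h1 h2 where h12: "w # g2 = h1 @ t # h2" using split_list[OF ptq(2)] by blast
      have "\<tau> = c @ (r1 @ [w]) @ u # \<beta>" using ab(1) r12 by simp
      then have tau: "\<tau> = (c @ p) @ t # (q @ u # \<beta>)" unfolding ptq(1) by simp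
      have gam: "\<gamma> = (g1 @ h1) @ t # h2" using gg h12 by simp
      have "set c \<inter> set (w # g2) = {}" using dg(1) gg s12 by auto
      moreover have "set (t # h2) \<subseteq> set (w # g2)" using h12 by auto
      ultimately have disj: "set (c @ p) \<inter> set (t # h2) = {}" using ptq(3) by fastforce
      have "pedges ((c @ p) @ t # q) \<subseteq> \<omega>" using ab(2) r12 ptq(1) by simp
      then have "pedges ((c @ p) @ [t]) \<subseteq> \<omega>" using pedges_append[of "c @ p" t q] by auto
      then have "(c @ p) @ t # h2 \<in> simple_paths V A B \<omega>"
        by (intro simple_paths_subpath[OF t tau g(1) gam _ disj]) auto
      moreover have "\<exists>r'. p @ t # h2 = x # r'"
      proof (cases p)
        case Nil
        then show ?thesis using ptq(1) r by (cases r1) auto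
      next
        case (Cons v p')
        then show ?thesis using ptq(1) r by (cases r1) auto
      qed
      ultimately show False using gmin lt c(2) by (metis append.assoc)
    qed
    from t g(1) \<open>\<tau> \<noteq> \<gamma>\<close> show False
    proof (rule simple_paths_deviation)
      fix x y r s assume d: "x \<noteq> y" "\<tau> = x # r" "\<gamma> = y # s"
      have hxy: "h x < h y" using less d key_less_hd[of h x y R r s] fin(2) dt(2) dg(2) by (auto simp: inj_on_def)
      show False by (rule deviate[of "[]" x r y s]) (use d hxy in auto)
    next
      fix c a x y r s assume d: "x \<noteq> y" "\<tau> = c @ a # x # r" "\<gamma> = c @ a # y # s"
      have Rxy: "R a x < R a y"
        using less d key_less_dev[of R a x y h c r s] fin(3)[of a] dt(2) dg(2) by (auto simp: inj_on_def)
      have "a \<noteq> w"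
      proof
        assume "a = w"
        then have "x # r = u # \<beta>" "y # s = g2"
          using d split_unique(2)[OF _ ab(1) dt(1), of c "x # r"] split_unique(2)[OF _ gg dg(1), of c "y # s"]
          by auto
        then show False using Rxy Rwb g2 \<open>a = w\<close> by auto
      qed
      have "w \<notin> set (c @ [a])"
      proof
        assume w': "w \<in> set (c @ [a])"
        then obtain c1 c2 where c12: "c @ [a] = c1 @ w # c2" using split_list[OF w'] by blast
        then have "c2 \<noteq> []" using \<open>a \<noteq> w\<close> by auto
        then obtain v c3 where v: "c2 = v # c3" by (cases c2) auto
        have "\<tau> = c1 @ w # (v # c3 @ x # r)" "\<gamma> = c1 @ w # (v # c3 @ y # s)"
          using d(2,3) arg_cong[OF c12, of "\<lambda>l. l @ x # r"] arg_cong[OF c12, of "\<lambda>l. l @ y # s"] v by simp_all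
        then have "v = u" "v \<in> set \<gamma>"
          using split_unique(2)[OF _ ab(1) dt(1), of c1 "v # c3 @ x # r"] by auto
        then show False using w(2) by simp
      qed
      then show False
        by (intro deviate[of "c @ [a]" x r y s]) (use d Rxy key_less_dev[of R a x y h c] in auto)
    qed
  qed
qed


definition swap_ranks :: "'v \<Rightarrow> 'v \<Rightarrow> 'v \<Rightarrow> ('v \<Rightarrow> 'v \<Rightarrow> nat) \<Rightarrow> ('v \<Rightarrow> 'v \<Rightarrow> nat)" where
  "swap_ranks w b u R = R(w := R w \<circ> Transposition.transpose b u)"

lemma swap_ranks_swap_ranks: "swap_ranks w b u (swap_ranks w b u R) = R"
  by (auto simp: swap_ranks_def fun_eq_iff)

text \<open>
  Exchanging the ranks of b and u at w makes the step of \<open>\<gamma>\<close> to b more attractive, so \<open>\<gamma>\<close> stays minimal: the only competitor that gains leaves w through u, and it loses against b.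
\<close>
lemma least_path_swap:
  assumes fin: "finite V" "inj_on h V" "\<And>v. v \<in> V \<Longrightarrow> inj_on (R v) V" "\<And>v. v \<in> V \<Longrightarrow> inj_on (swap_ranks w b u R v) V"
    and g: "\<gamma> \<in> simple_paths V A B \<omega>" "least_path h R V A B \<omega> = \<gamma>"
    and gw: "\<gamma> = g1 @ w # b # g2" and wrong: "R w u < R w b"
  shows "least_path h (swap_ranks w b u R) V A B \<omega> = \<gamma>"
proof (rule least_path_eqI[OF fin(1) g(1) fin(2,4)], assumption)
  let ?R = "swap_ranks w b u R"
  fix \<tau> assume t: "\<tau> \<in> simple_paths V A B \<omega>"
  have gmin: "\<not> key h R \<tau> < key h R \<gamma>"
    using least_path_min[OF fin(1) t, of h R] g(2) by auto
  show "\<not> key h ?R \<tau> < key h ?R \<gamma>"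
  proof
    assume less: "key h ?R \<tau> < key h ?R \<gamma>"
    then have "\<tau> \<noteq> \<gamma>" by auto
    have dg: "distinct \<gamma>" "set \<gamma> \<subseteq> V" "set \<tau> \<subseteq> V" using g(1) t unfolding simple_paths_def by auto
    from t g(1) \<open>\<tau> \<noteq> \<gamma>\<close> show False
    proof (rule simple_paths_deviation)
      fix x y r s assume d: "x \<noteq> y" "\<tau> = x # r" "\<gamma> = y # s"
      then have "h x \<noteq> h y" using fin(2) dg by (auto simp: inj_on_def)
      then show False using less gmin d(2,3) by (simp add: key_less_hd)
    next
      fix c a x y r s assume d: "x \<noteq> y" "\<tau> = c @ a # x # r" "\<gamma> = c @ a # y # s"
      have n: "R a x \<noteq> R a y" "?R a x \<noteq> ?R a y"
        using d fin(3)[of a] fin(4)[of a] dg(2,3) by (auto simp: inj_on_def)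
      have l: "?R a x < ?R a y" "\<not> R a x < R a y"
        using less gmin n d(2,3) by (auto simp: key_less_dev)
      show False
      proof (cases "a = w")
        case True
        then have "y = b" using split_unique(2)[OF _ gw dg(1), of c "y # s"] d(3) by auto
        then show False using l wrong d(1) True by (auto simp: swap_ranks_def Transposition.transpose_def split: if_splits)
      next
        case False
        then show False using l by (auto simp: swap_ranks_def)
      qed
    qed
  qed
qed

text \<open>
  The path \<open>\<gamma>\<close> can be reached from C at its vertex t without visiting other vertices of \<open>\<gamma>\<close>. After the surgery this vertex is unique and tells where the surgery took place.
\<close>
definition touch :: "'v set \<Rightarrow> 'v set \<Rightarrow> 'v list \<Rightarrow> 'v set set \<Rightarrow> 'v \<Rightarrow> bool" where
  "touch V C \<gamma> \<omega> t \<longleftrightarrow> t \<in> set \<gamma> \<and>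
     (t \<in> C \<or> (\<exists>c\<in>C \<inter> (V - set \<gamma>). \<exists>s. reach \<omega> (V - set \<gamma>) c s \<and> {s, t} \<in> \<omega>))"

text \<open>
  A path from C is followed until it enters, at a vertex y, a fibre that \<open>\<gamma>\<close> visits. All edges touching this fibre are closed except those of \<open>\<gamma>\<close> and of the arriving path, and a path inside the fibre from y to the first vertex w of \<open>\<gamma>\<close> is opened; u is the vertex before w.
  
  Since C and A are not connected before the surgery, the arriving path and \<open>\<gamma>\<close> belong to different clusters. Hence the opened path is the only link between them, so that \<open>\<gamma>\<close> is touched at w only. A new path from A to B that uses an opened edge must enter the opened path from its end at w. It cannot start on it, because A is a union of fibres.
\<close>
lemma surgery:
  fixes \<pi> :: "'v \<Rightarrow> 's"
  assumes w: "\<omega> \<subseteq> E" and E: "\<And>e. e \<in> E \<Longrightarrow> e \<subseteq> V"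
    and fib: "\<And>x y. x \<in> V \<Longrightarrow> y \<in> V \<Longrightarrow> \<pi> x = \<pi> y \<Longrightarrow> conn E {v \<in> V. \<pi> v = \<pi> x} {x} {y}"
    and g: "\<gamma> \<in> simple_paths V1 A B \<omega>" "V1 \<subseteq> V"
    and sat: "\<And>x y. x \<in> A \<inter> V \<Longrightarrow> y \<in> V \<Longrightarrow> \<pi> x = \<pi> y \<Longrightarrow> y \<in> A"
    and nc: "\<not> conn \<omega> V A C" and C: "conn \<omega> V C {v. \<pi> v \<in> \<pi> ` set \<gamma>}"
  shows "\<exists>w u \<omega>'. w \<in> set \<gamma> \<and> u \<in> V \<and> u \<notin> set \<gamma> \<and> \<omega>' \<subseteq> E \<and>
     \<omega>' - {e \<in> E. \<exists>x\<in>e. \<pi> x = \<pi> w} = \<omega> - {e \<in> E. \<exists>x\<in>e. \<pi> x = \<pi> w} \<and>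
     \<gamma> \<in> simple_paths V1 A B \<omega>' \<and> conn \<omega>' V A C \<and> (\<forall>t. touch V C \<gamma> \<omega>' t \<longleftrightarrow> t = w) \<and>
     (\<forall>\<tau>. \<tau> \<in> simple_paths V1 A B \<omega>' \<longrightarrow> \<tau> \<notin> simple_paths V1 A B \<omega> \<longrightarrow>
        (\<exists>\<alpha> \<beta>. \<tau> = \<alpha> @ w # u # \<beta> \<and> pedges (\<alpha> @ [w]) \<subseteq> \<omega>))"
proof -
  have g': "\<gamma> \<noteq> []" "set \<gamma> \<subseteq> V" "pedges \<gamma> \<subseteq> \<omega>" "hd \<gamma> \<in> A" using g by (auto simp: simple_paths_def)
  \<comment> \<open>simple paths stop at their target, so only y lies in a fibre of \<open>\<gamma>\<close>\<close>
  obtain hs where hs: "hs \<in> simple_paths V C {v. \<pi> v \<in> \<pi> ` set \<gamma>} \<omega>" using C conn_iff_simple_path by blast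
  define y where "y = last hs"
  have h: "hs \<noteq> []" "set hs \<subseteq> V" "pedges hs \<subseteq> \<omega>" "hd hs \<in> C" "\<pi> y \<in> \<pi> ` set \<gamma>" using hs by (auto simp: simple_paths_def y_def)
  then have yV: "y \<in> V" "y \<in> set hs" using y_def by auto
  obtain g0 where g0: "g0 \<in> set \<gamma>" "\<pi> g0 = \<pi> y" using h(5) by auto
  define z where "z = \<pi> y"
  define F where "F = {v \<in> V. \<pi> v = z}"
  have "conn E F {y} (set \<gamma>)"
    using fib[of y g0] g0 yV(1) g'(2) by (auto simp: F_def z_def intro: conn_mono)
  then obtain bs where bs: "bs \<in> simple_paths F {y} (set \<gamma>) E" using conn_iff_simple_path by blast
  \<comment> \<open>what is connected to C in the old configuration\<close>
  define Q where "Q = {v. \<exists>c\<in>C \<inter> V. reach \<omega> V c v}"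
  have Q_step: "b \<in> Q" if "a \<in> Q" "{a, b} \<in> \<omega>" for a b
  proof -
    have "stp \<omega> V a b" using that(2) w E[of "{a, b}"] by (auto simp: stp_def)
    then show ?thesis using that(1) unfolding Q_def by (blast intro: rtranclp.rtrancl_into_rtrancl)
  qed
  have Q_hs: "set hs \<subseteq> Q"
  proof
    fix s assume "s \<in> set hs"
    then have "reach \<omega> V (hd hs) s" using h(1) by (intro reach_list[OF h(3,2)]) auto
    moreover have "hd hs \<in> C \<inter> V" using h(1,2,4) by auto
    ultimately show "s \<in> Q" unfolding Q_def by blast
  qed
  have Q_path: False if H: "pedges xs \<subseteq> \<omega>" "set xs \<subseteq> V" "a \<in> set xs" "a \<in> A" "q \<in> set xs" "q \<in> Q" for xs a q
  proof -
    obtain c where "c \<in> C" "c \<in> V" "reach \<omega> V c q" using H(6) by (auto simp: Q_def)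
    moreover have "reach \<omega> V a q" using reach_list[OF H(1,2,3,5)] .
    ultimately have "reach \<omega> V a c" using reach_sym[of \<omega> V c q] by (meson rtranclp_trans)
    then show False using nc \<open>c \<in> C\<close> H(2,3,4) unfolding conn_iff_reach by blast
  qed
  have Q_g: "set \<gamma> \<inter> Q = {}" using Q_path[OF g'(3,2) _ g'(4)] g'(1) by auto
  have b: "bs \<noteq> []" "set bs \<subseteq> F" "pedges bs \<subseteq> E" "hd bs = y" "last bs \<in> set \<gamma>" "set (butlast bs) \<inter> set \<gamma> = {}"
    using bs by (auto simp: simple_paths_def)
  define v where "v = last bs"
  define n where "n = butlast bs"
  have bsn: "bs = n @ [v]" using b(1) by (simp add: n_def v_def)
  have vg: "v \<in> set \<gamma>" using b v_def by simp
  have "y \<notin> set \<gamma>" using Q_g Q_hs yV by auto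
  then have "n \<noteq> []" using bsn b(4) vg by (cases n) auto
  define u where "u = last n"
  define n' where "n' = butlast n"
  have nu: "n = n' @ [u]" using \<open>n \<noteq> []\<close> by (simp add: u_def n'_def)
  have pb: "pedges bs = pedges n \<union> {{u, v}}" unfolding bsn nu by (simp add: pedges_append[of n' u "[v]"])
  have n_hd: "y \<in> set n" using b(4) bsn \<open>n \<noteq> []\<close> by (cases n) auto
  have ng: "set n \<inter> set \<gamma> = {}" using b(6) n_def by simp
  have nF: "set n \<subseteq> F" "v \<in> F" using b(2) bsn by auto
  then have zv: "\<pi> v = z" by (simp add: F_def)
  have un: "u \<in> set n" using nu by simp
  have pb_N: "e \<inter> set n \<noteq> {}" if "e \<in> pedges bs" for e
    using that pedges_subset[of e n] pedges_nonempty[of e n] un unfolding pb by auto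
  define Ez where "Ez = {e \<in> E. \<exists>x\<in>e. \<pi> x = z}"
  have F_Ez: "e \<in> Ez" if "e \<in> E" "x \<in> e" "x \<in> F" for e x using that by (auto simp: Ez_def F_def)
  have pbEz: "pedges bs \<subseteq> Ez"
  proof
    fix e assume e: "e \<in> pedges bs"
    then obtain x where "x \<in> e" "x \<in> set n" using pb_N by blast
    then show "e \<in> Ez" using F_Ez[of e x] e b(3) nF by auto
  qed
  define \<omega>' where "\<omega>' = (\<omega> - Ez) \<union> pedges \<gamma> \<union> pedges hs \<union> pedges bs"
  have w'E: "\<omega>' \<subseteq> E" using w b(3) g'(3) h(3) by (auto simp: \<omega>'_def)
  have w'Ez: "\<omega>' - Ez = \<omega> - Ez" using g'(3) h(3) pbEz by (auto simp: \<omega>'_def)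
  have w'cases: "e \<in> pedges bs \<or> e \<in> \<omega> \<and> (e \<in> pedges \<gamma> \<or> e \<in> pedges hs \<or> e \<notin> Ez)" if "e \<in> \<omega>'" for e
    using that g'(3) h(3) by (auto simp: \<omega>'_def)
  have nA: "set n \<inter> A = {}"
  proof (rule ccontr)
    assume "set n \<inter> A \<noteq> {}"
    then obtain x where "x \<in> A" "x \<in> F" using nF by auto
    then have "y \<in> A" using sat[of x y] yV(1) by (auto simp: F_def z_def)
    then show False using Q_path[OF h(3,2) yV(2) _ yV(2)] Q_hs yV(2) by auto
  qed
  have conn: "conn \<omega>' V A C"
  proof -
    have *: "reach \<omega>' V (hd \<gamma>) v" using g' vg by (intro reach_list[of \<gamma>]) (auto simp: \<omega>'_def)
    have "reach \<omega>' V v y" using b nF bsn n_hd by (intro reach_list[of bs]) (auto simp: \<omega>'_def F_def)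
    moreover have "reach \<omega>' V y (hd hs)" using h yV by (intro reach_list[of hs]) (auto simp: \<omega>'_def)
    ultimately have "reach \<omega>' V (hd \<gamma>) (hd hs)" using * by (meson rtranclp_trans)
    then show ?thesis unfolding conn_iff_reach using g' h(4) by (intro bexI[of _ "hd \<gamma>"] bexI[of _ "hd hs"]) auto
  qed
  have noC: "t \<notin> C" if "t \<in> set \<gamma>" for t
  proof
    assume "t \<in> C"
    then have "t \<in> Q" using that g'(2) by (auto simp: Q_def)
    then show False using Q_g that by auto
  qed
  have reach: "s \<in> Q \<union> set n" if "reach \<omega>' (V - set \<gamma>) c s" "c \<in> C" "c \<in> V" for c s
    using that(1)
  proof (induction rule: rtranclp_induct)
    case base
    then show ?case using that by (auto simp: Q_def)
  next
    case (step a d)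
    then have ad: "{a, d} \<in> \<omega>'" "a \<notin> set \<gamma>" "d \<notin> set \<gamma>" by (auto simp: stp_def)
    from w'cases[OF ad(1)] consider "{a, d} \<in> pedges bs" | "{a, d} \<in> \<omega>" "{a, d} \<in> pedges \<gamma>"
      | "{a, d} \<in> \<omega>" "{a, d} \<in> pedges hs" | "{a, d} \<in> \<omega>" "{a, d} \<notin> Ez" by blast
    then show ?case
    proof cases
      case 1
      then show ?thesis using pedges_subset[OF 1] bsn ad vg by auto
    next
      case 2
      then show ?thesis using pedges_subset[OF 2(2)] ad by auto
    next
      case 3
      then show ?thesis using pedges_subset[OF 3(2)] Q_hs by auto
    next
      case 4
      then have "a \<notin> set n" using F_Ez[of "{a, d}" a] w nF by auto
      then show ?thesis using step(3) Q_step[OF _ 4(1)] by auto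
    qed
  qed
  have touch_iff: "touch V C \<gamma> \<omega>' t \<longleftrightarrow> t = v" for t
  proof
    assume "touch V C \<gamma> \<omega>' t"
    then obtain c s where t: "t \<in> set \<gamma>" "c \<in> C" "c \<in> V" "c \<notin> set \<gamma>" "reach \<omega>' (V - set \<gamma>) c s" "{s, t} \<in> \<omega>'"
      using noC unfolding touch_def by blast
    have s: "s \<in> Q \<union> set n" "s \<notin> set \<gamma>" using reach[OF t(5,2,3)] reach_in[OF t(5)] t(3,4) by auto
    from w'cases[OF t(6)] consider "{s, t} \<in> pedges bs" | "{s, t} \<in> \<omega>" "{s, t} \<in> pedges \<gamma>"
      | "{s, t} \<in> \<omega>" "{s, t} \<in> pedges hs" | "{s, t} \<in> \<omega>" "{s, t} \<notin> Ez" by blast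
    then show "t = v"
    proof cases
      case 1
      then show ?thesis using pedges_subset[OF 1] bsn ng t(1) by auto
    next
      case 2
      then show ?thesis using pedges_subset[OF 2(2)] s by auto
    next
      case 3
      then show ?thesis using pedges_subset[OF 3(2)] Q_hs Q_g t(1) by auto
    next
      case 4
      then have "s \<notin> set n" using F_Ez[of "{s, t}" s] w nF by auto
      then show ?thesis using Q_step[OF _ 4(1)] s Q_g t(1) by auto
    qed
  next
    assume "t = v"
    have hg: "set hs \<inter> set \<gamma> = {}" using Q_hs Q_g by auto
    have "reach \<omega>' (V - set \<gamma>) (hd hs) y"
      using h hg yV by (intro reach_list[of hs]) (auto simp: \<omega>'_def)
    moreover have "reach \<omega>' (V - set \<gamma>) y u"
      using ng nF un n_hd by (intro reach_list[of n]) (auto simp: \<omega>'_def pb F_def)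
    ultimately have "reach \<omega>' (V - set \<gamma>) (hd hs) u" by (meson rtranclp_trans)
    moreover have "{u, v} \<in> \<omega>'" by (simp add: \<omega>'_def pb)
    moreover have "hd hs \<in> C \<inter> (V - set \<gamma>)" using h hg by (cases hs) auto
    ultimately show "touch V C \<gamma> \<omega>' t" unfolding touch_def \<open>t = v\<close> using vg by blast
  qed
  have new: "\<exists>\<alpha> \<beta>. \<tau> = \<alpha> @ v # u # \<beta> \<and> pedges (\<alpha> @ [v]) \<subseteq> \<omega>"
    if t: "\<tau> \<in> simple_paths V1 A B \<omega>'" "\<tau> \<notin> simple_paths V1 A B \<omega>" for \<tau>
  proof -
    have t': "\<tau> \<noteq> []" "set \<tau> \<subseteq> V" "pedges \<tau> \<subseteq> \<omega>'" "hd \<tau> \<in> A" "\<not> pedges \<tau> \<subseteq> \<omega>" using t g(2) by (auto simp: simple_paths_def)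
    then obtain e where e: "e \<in> pedges \<tau>" "e \<in> pedges bs" using w'cases by blast
    then have "\<exists>x\<in>set \<tau>. x \<in> set n" using pb_N[OF e(2)] pedges_subset[OF e(1)] by blast
    then obtain \<alpha>' x \<beta> where x: "\<tau> = \<alpha>' @ x # \<beta>" "x \<in> set n" "\<forall>v\<in>set \<alpha>'. v \<notin> set n"
      using split_list_first_prop[of \<tau> "\<lambda>x. x \<in> set n"] by blast
    have "\<alpha>' \<noteq> []" using x nA t'(4) by (cases \<alpha>') auto
    then obtain \<alpha> a where a: "\<alpha>' = \<alpha> @ [a]" by (cases \<alpha>' rule: rev_cases) auto
    have tau: "\<tau> = \<alpha> @ a # x # \<beta>" using x(1) a by simp
    have pt: "pedges \<tau> = pedges (\<alpha> @ [a]) \<union> {{a, x}} \<union> pedges (x # \<beta>)"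
      unfolding tau by (rule pedges_append2)
    have po: "pedges (\<alpha> @ [a]) \<subseteq> \<omega>"
    proof
      fix e assume e: "e \<in> pedges (\<alpha> @ [a])"
      then have "e \<inter> set n = {}" using pedges_subset[OF e] x(3) a by auto
      then have "e \<notin> pedges bs" using pb_N by auto
      then show "e \<in> \<omega>" using w'cases[of e] e pt t'(3) by auto
    qed
    have an: "a \<notin> set n" using x a by auto
    have "{a, x} \<in> \<omega>'" using pt t'(3) by auto
    from w'cases[OF this] consider "{a, x} \<in> pedges bs" | "{a, x} \<in> \<omega>" "{a, x} \<in> pedges \<gamma>"
      | "{a, x} \<in> \<omega>" "{a, x} \<in> pedges hs" | "{a, x} \<in> \<omega>" "{a, x} \<notin> Ez" by blast
    then show ?thesis
    proof cases
      case 1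
      then have "{a, x} = {u, v}" using an pedges_subset[of "{a, x}" n] unfolding pb by auto
      then have "a = v" "x = u" using an un by (auto simp: doubleton_eq_iff)
      then show ?thesis using tau po by auto
    next
      case 2
      then show ?thesis using pedges_subset[OF 2(2)] ng x(2) by auto
    next
      case 3
      have "hd \<tau> \<in> set (\<alpha> @ [a])" using tau by (cases \<alpha>) auto
      then have False
        using Q_path[OF po, of "hd \<tau>" a] t'(2,4) pedges_subset[OF 3(2)] Q_hs tau by auto
      then show ?thesis ..
    next
      case 4
      then show ?thesis using F_Ez[of "{a, x}" x] w nF x(2) by auto
    qed
  qed
  have uV: "u \<in> V" "u \<notin> set \<gamma>" using un nF ng by (auto simp: F_def)
  have goc: "\<gamma> \<in> simple_paths V1 A B \<omega>'" using g(1) by (auto simp: simple_paths_def \<omega>'_def)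
  show ?thesis
    using vg uV w'E w'Ez goc conn touch_iff new
    by (intro exI[of _ v] exI[of _ u] exI[of _ \<omega>']) (auto simp: Ez_def zv)
qed

section \<open>The gluing inequality on a fibred graph\<close>

text \<open>
  The preferences at each vertex are an injective ranking of all vertices by the numbers below \<open>card V\<close>; there are finitely many families, and they are averaged.
\<close>
definition orders :: "'v set \<Rightarrow> ('v \<Rightarrow> 'v \<Rightarrow> nat) set" where
  "orders V = (\<Pi>\<^sub>E v\<in>V. {r \<in> V \<rightarrow>\<^sub>E {..<card V}. inj_on r V})"

lemma finite_orders: "finite V \<Longrightarrow> finite (orders V)"
  unfolding orders_def by (intro finite_PiE) (auto intro: finite_subset[OF _ finite_PiE[of V "\<lambda>_. {..<card V}"]])

lemma orders_nonempty: assumes "finite V" shows "orders V \<noteq> {}"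
proof -
  obtain f where f: "bij_betw f V {..<card V}"
    using assms by (metis atLeast0LessThan ex_bij_betw_finite_nat)
  then have "restrict f V \<in> {r \<in> V \<rightarrow>\<^sub>E {..<card V}. inj_on r V}"
    by (auto simp: bij_betw_def inj_on_def)
  then show ?thesis unfolding orders_def by (subst PiE_eq_empty_iff) blast
qed

lemma orders_inj: "R \<in> orders V \<Longrightarrow> v \<in> V \<Longrightarrow> inj_on (R v) V"
  unfolding orders_def by auto

lemma orders_swap_ranks:
  assumes "R \<in> orders V" "w \<in> V" "b \<in> V" "u \<in> V"
  shows "swap_ranks w b u R \<in> orders V"
proof -
  have R: "R w \<in> V \<rightarrow>\<^sub>E {..<card V}" "inj_on (R w) V" using assms(1,2) by (auto simp: orders_def)
  have t: "Transposition.transpose b u ` V = V" using assms(3,4) by (simp add: transpose_image_eq)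
  have "inj_on (R w \<circ> Transposition.transpose b u) V"
    using R(2) t by (intro comp_inj_on) (auto intro: inj_on_subset[OF inj_transpose])
  moreover have "R w \<circ> Transposition.transpose b u \<in> V \<rightarrow>\<^sub>E {..<card V}"
  proof (intro PiE_I)
    fix x assume "x \<in> V"
    then have "Transposition.transpose b u x \<in> V" using t by blast
    then show "(R w \<circ> Transposition.transpose b u) x \<in> {..<card V}" using R(1) by auto
  next
    fix x assume "x \<notin> V"
    then have "Transposition.transpose b u x = x" using assms(3,4) by (metis transpose_apply_other)
    then show "(R w \<circ> Transposition.transpose b u) x = undefined" using R(1) \<open>x \<notin> V\<close> by auto
  qed
  ultimately show ?thesis using assms(1,2)
    unfolding orders_def swap_ranks_def by (auto simp: PiE_iff extensional_def)
qed

text \<open>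
  A finite graph with a projection \<open>\<pi>\<close>: the properties of the slab over the plane on which the gluing of paths rests. The number m bounds the edges whose states a surgery may change.
\<close>
locale fibred_graph =
  fixes V :: "'v set" and E :: "'v set set" and \<pi> :: "'v \<Rightarrow> 's" and m :: nat and p :: real
  assumes finV: "finite V" and EV: "\<And>e. e \<in> E \<Longrightarrow> e \<subseteq> V"
    and fib: "\<And>x y. x \<in> V \<Longrightarrow> y \<in> V \<Longrightarrow> \<pi> x = \<pi> y \<Longrightarrow> conn E {v \<in> V. \<pi> v = \<pi> x} {x} {y}"
    and deg: "\<And>x. x \<in> V \<Longrightarrow> card {e \<in> E. \<exists>y\<in>e. \<pi> y = \<pi> x} \<le> m"
    and p: "0 < p" "p < 1"
begin

lemma finE: "finite E"
  using finV EV by (auto intro: finite_subset[of E "Pow V"])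

definition gluing_const :: real where "gluing_const = 1 + 2 * (1 / min p (1 - p)) ^ m"

text \<open>
  Summed over all families of preferences R, the event on the left says that A and B are connected in V1 and that C is connected to a fibre visited by the selected path. If A and C are not connected, the surgery applies. Call R good if at w the next step of the selected path is preferred to u. For good R the selected path survives, the place of the surgery can be recovered, and finite energy applies. The bad families are at most as many as the good ones, because exchanging two ranks at w is injective and leads from bad to good.
\<close>
lemma gluing:
  assumes V1: "V1 \<subseteq> V" and sat: "\<And>x y. x \<in> A \<inter> V \<Longrightarrow> y \<in> V \<Longrightarrow> \<pi> x = \<pi> y \<Longrightarrow> y \<in> A" and h: "inj_on h V"
  shows "(\<Sum>R\<in>orders V. bprob p E (\<lambda>\<omega>. conn \<omega> V1 A B \<and> conn \<omega> V C {v. \<pi> v \<in> \<pi> ` set (least_path h R V1 A B \<omega>)}))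
    \<le> card (orders V) * gluing_const * bprob p E (\<lambda>\<omega>. conn \<omega> V A C)"
proof -
  let ?least_path = "\<lambda>R. least_path h R V1 A B"
  let ?F = "\<lambda>\<omega>. conn \<omega> V A C"
  define cond where "cond \<omega> \<gamma> \<longleftrightarrow> \<omega> \<subseteq> E \<and> \<gamma> \<in> simple_paths V1 A B \<omega> \<and> \<not> ?F \<omega> \<and> conn \<omega> V C {v. \<pi> v \<in> \<pi> ` set \<gamma>}" for \<omega> \<gamma>
  define S where "S \<omega> \<gamma> w u \<omega>' \<longleftrightarrow> w \<in> set \<gamma> \<and> u \<in> V \<and> u \<notin> set \<gamma> \<and> \<omega>' \<subseteq> E \<and>
     \<omega>' - {e \<in> E. \<exists>x\<in>e. \<pi> x = \<pi> w} = \<omega> - {e \<in> E. \<exists>x\<in>e. \<pi> x = \<pi> w} \<and>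
     \<gamma> \<in> simple_paths V1 A B \<omega>' \<and> conn \<omega>' V A C \<and> (\<forall>t. touch V C \<gamma> \<omega>' t \<longleftrightarrow> t = w) \<and>
     (\<forall>\<tau>. \<tau> \<in> simple_paths V1 A B \<omega>' \<longrightarrow> \<tau> \<notin> simple_paths V1 A B \<omega> \<longrightarrow>
        (\<exists>\<alpha> \<beta>. \<tau> = \<alpha> @ w # u # \<beta> \<and> pedges (\<alpha> @ [w]) \<subseteq> \<omega>))" for \<omega> \<gamma> w u \<omega>'
  have "\<exists>w u \<omega>'. S \<omega> \<gamma> w u \<omega>'" if "cond \<omega> \<gamma>" for \<omega> \<gamma>
    unfolding S_def using that unfolding cond_def
    by (elim conjE) (rule surgery[OF _ EV fib _ V1 sat], assumption+)
  then have bexp: "\<exists>t. S \<omega> \<gamma> (fst t) (fst (snd t)) (snd (snd t))" if "cond \<omega> \<gamma>" for \<omega> \<gamma>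
    using that by (metis fst_conv snd_conv)
  define f where "f \<omega> \<gamma> = (SOME t. S \<omega> \<gamma> (fst t) (fst (snd t)) (snd (snd t)))" for \<omega> \<gamma>
  have f: "S \<omega> \<gamma> (fst (f \<omega> \<gamma>)) (fst (snd (f \<omega> \<gamma>))) (snd (snd (f \<omega> \<gamma>)))" if "cond \<omega> \<gamma>" for \<omega> \<gamma>
    unfolding f_def by (rule someI_ex[OF bexp[OF that]])
  define w where "w \<omega> \<gamma> = fst (f \<omega> \<gamma>)" for \<omega> \<gamma>
  define u where "u \<omega> \<gamma> = fst (snd (f \<omega> \<gamma>))" for \<omega> \<gamma>
  define \<omega>' where "\<omega>' \<omega> \<gamma> = snd (snd (f \<omega> \<gamma>))" for \<omega> \<gamma>
  have S: "S \<omega> \<gamma> (w \<omega> \<gamma>) (u \<omega> \<gamma>) (\<omega>' \<omega> \<gamma>)" if "cond \<omega> \<gamma>" for \<omega> \<gamma>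
    using f[OF that] by (simp add: w_def u_def \<omega>'_def)
  define T where "T R \<omega> \<longleftrightarrow> conn \<omega> V1 A B \<and> cond \<omega> (?least_path R \<omega>)" for R \<omega>
  define good where "good R \<omega> \<longleftrightarrow> (\<forall>g1 b g2. ?least_path R \<omega> = g1 @ w \<omega> (?least_path R \<omega>) # b # g2 \<longrightarrow>
      R (w \<omega> (?least_path R \<omega>)) b < R (w \<omega> (?least_path R \<omega>)) (u \<omega> (?least_path R \<omega>)))" for R \<omega>
  have fin1: "finite V1" "inj_on h V1" using V1 finV h finite_subset inj_on_subset by auto
  have R1: "inj_on (R v) V1" if "R \<in> orders V" "v \<in> V1" for R v
    using orders_inj[OF that(1)] that(2) V1 inj_on_subset by blast
  have nonneg: "0 \<le> p" "p \<le> 1" using p by auto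
  \<comment> \<open>exchanging the ranks of u and of the next vertex at w maps bad families injectively to good ones\<close>
  have half: "card {R \<in> orders V. T R \<omega> \<and> \<not> good R \<omega>} \<le> card {R \<in> orders V. T R \<omega> \<and> good R \<omega>}" for \<omega>
  proof -
    define nxt where "nxt \<gamma> = (SOME b. \<exists>g1 g2. \<gamma> = g1 @ w \<omega> \<gamma> # b # g2)" for \<gamma>
    define \<phi> where "\<phi> R = swap_ranks (w \<omega> (?least_path R \<omega>)) (nxt (?least_path R \<omega>)) (u \<omega> (?least_path R \<omega>)) R" for R
    have main: "\<phi> R \<in> orders V \<and> T (\<phi> R) \<omega> \<and> good (\<phi> R) \<omega> \<and> ?least_path (\<phi> R) \<omega> = ?least_path R \<omega>"
      if R: "R \<in> orders V" "T R \<omega>" "\<not> good R \<omega>" for R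
    proof -
      define \<gamma> where "\<gamma> = ?least_path R \<omega>"
      define a where "a = w \<omega> \<gamma>"
      define v where "v = u \<omega> \<gamma>"
      have c: "cond \<omega> \<gamma>" "conn \<omega> V1 A B" using R(2) by (auto simp: T_def \<gamma>_def)
      have SS: "S \<omega> \<gamma> a v (\<omega>' \<omega> \<gamma>)" using S[OF c(1)] by (simp add: a_def v_def)
      have goc: "\<gamma> \<in> simple_paths V1 A B \<omega>" using c(1) by (simp add: cond_def)
      then have dg: "distinct \<gamma>" "set \<gamma> \<subseteq> V1" by (auto simp: simple_paths_def)
      from R(3) obtain g1 b g2 where g: "\<gamma> = g1 @ a # b # g2" "\<not> R a b < R a v"
        unfolding good_def \<gamma>_def[symmetric] a_def[symmetric] v_def[symmetric] by blast
      have "\<exists>g1 g2. \<gamma> = g1 @ a # nxt \<gamma> # g2"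
        unfolding nxt_def a_def[symmetric] by (rule someI[of _ b]) (use g in blast)
      then have nb: "nxt \<gamma> = b" using split_unique(2)[OF g(1) _ dg(1)] by blast
      have phi: "\<phi> R = swap_ranks a b v R" by (simp add: \<phi>_def \<gamma>_def[symmetric] a_def[symmetric] v_def[symmetric] nb)
      have inV: "a \<in> V" "b \<in> V" "v \<in> V" "v \<notin> set \<gamma>" using g dg V1 SS by (auto simp: S_def)
      have ord: "\<phi> R \<in> orders V" unfolding phi using orders_swap_ranks[OF R(1)] inV by blast
      have neq: "R a b \<noteq> R a v" using orders_inj[OF R(1) inV(1)] inV g by (auto simp: inj_on_def)
      have least_path: "?least_path (\<phi> R) \<omega> = \<gamma>" unfolding phi
        by (rule least_path_swap[OF fin1 R1[OF R(1)] R1[OF ord[unfolded phi]] goc \<gamma>_def[symmetric] g(1)])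
          (use neq g(2) in auto)
      have "good (\<phi> R) \<omega>" unfolding good_def least_path a_def[symmetric] v_def[symmetric]
      proof (intro allI impI)
        fix g1' b' g2' assume "\<gamma> = g1' @ a # b' # g2'"
        then have "b' = b" using split_unique(2)[OF g(1) _ dg(1)] by blast
        then show "\<phi> R a b' < \<phi> R a v" using neq g(2) unfolding phi swap_ranks_def by simp
      qed
      then show ?thesis using ord least_path c by (auto simp: T_def \<gamma>_def)
    qed
    have inj: "inj_on \<phi> {R \<in> orders V. T R \<omega> \<and> \<not> good R \<omega>}"
    proof (rule inj_onI)
      fix R R' assume R: "R \<in> {R \<in> orders V. T R \<omega> \<and> \<not> good R \<omega>}"
        and R': "R' \<in> {R \<in> orders V. T R \<omega> \<and> \<not> good R \<omega>}" and eq: "\<phi> R = \<phi> R'"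
      have "?least_path R \<omega> = ?least_path R' \<omega>" using main[of R] main[of R'] R R' eq by auto
      then have "\<phi> R' = swap_ranks (w \<omega> (?least_path R \<omega>)) (nxt (?least_path R \<omega>)) (u \<omega> (?least_path R \<omega>)) R'" by (simp add: \<phi>_def)
      then show "R = R'" using eq swap_ranks_swap_ranks unfolding \<phi>_def by metis
    qed
    show ?thesis
      by (rule card_inj_on_le[OF inj]) (use main finite_orders[OF finV] in auto)
  qed
  \<comment> \<open>for good families the fibre of the surgery is recovered as the one at which the selected path is touched\<close>
  have energy: "bprob p E (\<lambda>\<omega>. T R \<omega> \<and> good R \<omega>) \<le> (1 / min p (1 - p)) ^ m * bprob p E ?F"
    if R: "R \<in> orders V" for R
  proof -
    let ?z = "\<lambda>\<omega>. \<pi> (w \<omega> (?least_path R \<omega>))"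
    let ?rec = "\<lambda>\<omega>. \<pi> (THE t. touch V C (?least_path R \<omega>) \<omega> t)"
    have one: "bprob p E (\<lambda>\<omega>. (T R \<omega> \<and> good R \<omega>) \<and> ?z \<omega> = z) \<le>
        (1 / min p (1 - p)) ^ m * bprob p E (\<lambda>\<omega>. ?F \<omega> \<and> ?rec \<omega> = z)" if z: "z \<in> \<pi> ` V" for z
    proof -
      let ?D = "{e \<in> E. \<exists>x\<in>e. \<pi> x = z}"
      have "card ?D \<le> m" using deg z by auto
      then have "min p (1 - p) ^ m \<le> min p (1 - p) ^ card ?D"
        using p by (intro power_decreasing) auto
      then have "min p (1 - p) ^ m * bprob p E (\<lambda>\<omega>. (T R \<omega> \<and> good R \<omega>) \<and> ?z \<omega> = z) \<le>
          min p (1 - p) ^ card ?D * bprob p E (\<lambda>\<omega>. (T R \<omega> \<and> good R \<omega>) \<and> ?z \<omega> = z)"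
        by (intro mult_right_mono bprob_nonneg nonneg)
      also have "\<dots> \<le> bprob p E (\<lambda>\<omega>. ?F \<omega> \<and> ?rec \<omega> = z)"
      proof (rule finite_energy[OF finE nonneg])
        fix \<omega> assume w: "\<omega> \<subseteq> E" "(T R \<omega> \<and> good R \<omega>) \<and> ?z \<omega> = z"
        define \<gamma> where "\<gamma> = ?least_path R \<omega>"
        have c: "cond \<omega> \<gamma>" using w(2) by (auto simp: T_def \<gamma>_def)
        have SS: "S \<omega> \<gamma> (w \<omega> \<gamma>) (u \<omega> \<gamma>) (\<omega>' \<omega> \<gamma>)" using S[OF c] .
        have least_path: "?least_path R (\<omega>' \<omega> \<gamma>) = \<gamma>"
          by (rule least_path_surgery[OF fin1 R1[OF R] _ _ \<gamma>_def[symmetric], of "\<omega>' \<omega> \<gamma>" "w \<omega> \<gamma>" "u \<omega> \<gamma>"])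
            (use SS c w(2) in \<open>auto simp: S_def cond_def good_def \<gamma>_def[symmetric]\<close>)
        have "(THE t. touch V C \<gamma> (\<omega>' \<omega> \<gamma>) t) = w \<omega> \<gamma>" using SS by (simp add: S_def)
        then show "\<exists>\<omega>'\<subseteq>E. \<omega>' - ?D = \<omega> - ?D \<and> ?F \<omega>' \<and> ?rec \<omega>' = z"
          using SS least_path w(2) unfolding S_def \<gamma>_def by (intro exI[of _ "\<omega>' \<omega> (?least_path R \<omega>)"]) auto
      qed auto
      finally show ?thesis using p by (simp add: field_simps power_one_over)
    qed
    have "bprob p E (\<lambda>\<omega>. T R \<omega> \<and> good R \<omega>) = (\<Sum>z\<in>\<pi> ` V. bprob p E (\<lambda>\<omega>. (T R \<omega> \<and> good R \<omega>) \<and> ?z \<omega> = z))"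
    proof (rule bprob_rec_sum[symmetric])
      fix \<omega> assume "T R \<omega> \<and> good R \<omega>"
      then have c: "cond \<omega> (?least_path R \<omega>)" by (auto simp: T_def)
      have "w \<omega> (?least_path R \<omega>) \<in> set (?least_path R \<omega>)" using S[OF c] unfolding S_def by blast
      moreover have "set (?least_path R \<omega>) \<subseteq> V1" using c unfolding cond_def simple_paths_def by blast
      ultimately show "?z \<omega> \<in> \<pi> ` V" using V1 by blast
    qed (use finV in auto)
    also have "\<dots> \<le> (\<Sum>z\<in>\<pi> ` V. (1 / min p (1 - p)) ^ m * bprob p E (\<lambda>\<omega>. ?F \<omega> \<and> ?rec \<omega> = z))"
      by (intro sum_mono one)
    also have "\<dots> \<le> (1 / min p (1 - p)) ^ m * bprob p E ?F"
      unfolding sum_distrib_left[symmetric] using p finV by (intro mult_left_mono bprob_rec_sum_le) auto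
    finally show ?thesis .
  qed
  have twice: "(\<Sum>R\<in>orders V. bprob p E (T R)) \<le> 2 * (\<Sum>R\<in>orders V. bprob p E (\<lambda>\<omega>. T R \<omega> \<and> good R \<omega>))"
    unfolding bprob_def bexp_sum[symmetric] bexp_cmult[symmetric]
  proof (intro bexp_mono nonneg)
    fix \<omega>
    have s: "(\<Sum>R\<in>orders V. of_bool (P R)) = real (card {R \<in> orders V. P R})" for P
      using finite_orders[OF finV] by (simp add: of_bool_def sum.If_cases Int_def)
    have un: "{R \<in> orders V. T R \<omega>} = {R \<in> orders V. T R \<omega> \<and> good R \<omega>} \<union> {R \<in> orders V. T R \<omega> \<and> \<not> good R \<omega>}"
      by blast
    have "card {R \<in> orders V. T R \<omega>} \<le> card {R \<in> orders V. T R \<omega> \<and> good R \<omega>} + card {R \<in> orders V. T R \<omega> \<and> \<not> good R \<omega>}"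
      by (subst un) (rule card_Un_le)
    then have "card {R \<in> orders V. T R \<omega>} \<le> 2 * card {R \<in> orders V. T R \<omega> \<and> good R \<omega>}"
      using half[of \<omega>] by simp
    then show "(\<Sum>R\<in>orders V. of_bool (T R \<omega>)) \<le> 2 * (\<Sum>R\<in>orders V. of_bool (T R \<omega> \<and> good R \<omega>) :: real)"
      unfolding s[of "\<lambda>R. T R \<omega>"] s[of "\<lambda>R. T R \<omega> \<and> good R \<omega>"] by linarith
  qed
  have "(\<Sum>R\<in>orders V. bprob p E (\<lambda>\<omega>. conn \<omega> V1 A B \<and> conn \<omega> V C {v. \<pi> v \<in> \<pi> ` set (?least_path R \<omega>)})) \<le>
      (\<Sum>R\<in>orders V. bprob p E ?F + bprob p E (T R))"
  proof (intro sum_mono)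
    fix R
    have "bprob p E (\<lambda>\<omega>. conn \<omega> V1 A B \<and> conn \<omega> V C {v. \<pi> v \<in> \<pi> ` set (?least_path R \<omega>)}) \<le> bprob p E (\<lambda>\<omega>. ?F \<omega> \<or> T R \<omega>)"
      by (intro bprob_mono nonneg) (auto simp: T_def cond_def intro: least_path_in[OF fin1(1)])
    also have "\<dots> \<le> bprob p E ?F + bprob p E (T R)" by (intro bprob_disj_le nonneg)
    finally show "bprob p E (\<lambda>\<omega>. conn \<omega> V1 A B \<and> conn \<omega> V C {v. \<pi> v \<in> \<pi> ` set (?least_path R \<omega>)}) \<le> bprob p E ?F + bprob p E (T R)" .
  qed
  also have "\<dots> = card (orders V) * bprob p E ?F + (\<Sum>R\<in>orders V. bprob p E (T R))" by (simp add: sum.distrib)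
  also have "\<dots> \<le> card (orders V) * bprob p E ?F + 2 * (\<Sum>R\<in>orders V. (1 / min p (1 - p)) ^ m * bprob p E ?F)"
  proof -
    have "(\<Sum>R\<in>orders V. bprob p E (\<lambda>\<omega>. T R \<omega> \<and> good R \<omega>)) \<le> (\<Sum>R\<in>orders V. (1 / min p (1 - p)) ^ m * bprob p E ?F)"
      by (rule sum_mono) (rule energy)
    then show ?thesis using twice by linarith
  qed
  also have "\<dots> = card (orders V) * gluing_const * bprob p E ?F" by (simp add: gluing_const_def algebra_simps)
  finally show ?thesis .
qed

end

section \<open>The slab as a fibred graph over the plane\<close>

definition \<pi> :: "vertex \<Rightarrow> site" where "\<pi> x = (x 0, x 1)"

text \<open>
  The edges with both ends above Z. Probabilities of events inside a larger region agree by \<open>conn_prob_eq\<close>.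
\<close>
definition edges_on :: "nat \<Rightarrow> nat \<Rightarrow> site set \<Rightarrow> edge set" where
  "edges_on d k Z = {e \<in> slab_edges d k. e \<subseteq> slab_over d k Z}"

definition conn_prob :: "nat \<Rightarrow> nat \<Rightarrow> real \<Rightarrow> site set \<Rightarrow> site set \<Rightarrow> site set \<Rightarrow> real" where
  "conn_prob d k p Z A B = bprob p (edges_on d k Z) (\<lambda>\<omega>. conn \<omega> (slab_over d k Z) (slab_over d k A) (slab_over d k B))"

lemma slab_over_mono: "Z \<subseteq> Z' \<Longrightarrow> slab_over d k Z \<subseteq> slab_over d k Z'"
  by (auto simp: slab_over_def)

lemma slab_over_pi: "slab_over d k Z = {x \<in> slab d k. \<pi> x \<in> Z}"
  by (simp add: slab_over_def \<pi>_def)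

lemma slab_coord: "x \<in> slab d k \<Longrightarrow> i < d \<Longrightarrow> 2 \<le> i \<Longrightarrow> 0 \<le> x i \<and> x i < int k"
  using PiE_mem[of x "{..<d}" "\<lambda>i. if i < 2 then UNIV else {0..<int k}" i] by (simp add: slab_def)

lemma slab_upd:
  assumes "x \<in> slab d k" "i < d" "2 \<le> i \<Longrightarrow> 0 \<le> a \<and> a < int k"
  shows "x(i := a) \<in> slab d k"
proof -
  have "x(i := a) \<in> (\<Pi>\<^sub>E j\<in>insert i {..<d}. if j < 2 then UNIV else {0..<int k})"
    by (rule PiE_fun_upd) (use assms in \<open>auto simp: slab_def\<close>)
  then show ?thesis using assms(2) by (simp add: slab_def insert_absorb)
qed

lemma slab_over_PiE:
  "slab_over d k Z \<subseteq> (\<Pi>\<^sub>E i\<in>{..<d}. if i = 0 then fst ` Z else if i = 1 then snd ` Z else {0..<int k})"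
proof
  fix x assume x: "x \<in> slab_over d k Z"
  then have xs: "x \<in> slab d k" and z: "(x 0, x 1) \<in> Z" by (auto simp: slab_over_def)
  show "x \<in> (\<Pi>\<^sub>E i\<in>{..<d}. if i = 0 then fst ` Z else if i = 1 then snd ` Z else {0..<int k})"
  proof (rule PiE_I)
    fix i assume "i \<in> {..<d}"
    then consider "i = 0" | "i = 1" | "2 \<le> i" "i < d" by fastforce
    then show "x i \<in> (if i = 0 then fst ` Z else if i = 1 then snd ` Z else {0..<int k})"
    proof cases
      case 1
      then show ?thesis using imageI[OF z, of fst] by simp
    next
      case 2
      then show ?thesis using imageI[OF z, of snd] by simp
    next
      case 3
      then show ?thesis using slab_coord[OF xs, of i] by simp
    qed
  next
    fix i assume "i \<notin> {..<d}"
    then show "x i = undefined" using xs unfolding slab_def by (rule PiE_arb[rotated])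
  qed
qed

lemma finite_slab_over:
  assumes "finite Z" shows "finite (slab_over d k Z)"
proof (rule finite_subset)
  let ?B = "\<lambda>i. if i = 0 then fst ` Z else if i = 1 then snd ` Z else {0..<int k}"
  show "slab_over d k Z \<subseteq> (\<Pi>\<^sub>E i\<in>{..<d}. ?B i)" by (rule slab_over_PiE)
  show "finite (\<Pi>\<^sub>E i\<in>{..<d}. ?B i)" using assms by (intro finite_PiE) auto
qed

lemma finite_edges_on: "finite Z \<Longrightarrow> finite (edges_on d k Z)"
  by (rule finite_subset[of _ "Pow (slab_over d k Z)"]) (auto simp: edges_on_def finite_slab_over)

lemma sum_split2:
  fixes f :: "nat \<Rightarrow> int"
  assumes "d \<ge> 2" shows "(\<Sum>i<d. f i) = f 0 + f 1 + (\<Sum>i\<in>{2..<d}. f i)"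
proof -
  have "{..<d} = insert 0 (insert 1 {2..<d})" using assms by auto
  then show ?thesis by simp
qed

lemma slab_edges_iff:
  "{x, y} \<in> slab_edges d k \<longleftrightarrow> x \<in> slab d k \<and> y \<in> slab d k \<and> (\<Sum>i<d. \<bar>x i - y i\<bar>) = 1"
  unfolding slab_edges_def by (auto simp: doubleton_eq_iff abs_minus_commute)

lemma slab_edge_nb:
  assumes "d \<ge> 2" "{x, y} \<in> slab_edges d k" shows "nb (\<pi> x) (\<pi> y)"
proof -
  have "\<bar>x 0 - y 0\<bar> + \<bar>x 1 - y 1\<bar> + (\<Sum>i\<in>{2..<d}. \<bar>x i - y i\<bar>) = 1"
    using assms sum_split2[of d "\<lambda>i. \<bar>x i - y i\<bar>"] by (simp add: slab_edges_iff)
  moreover have "(\<Sum>i\<in>{2..<d}. \<bar>x i - y i\<bar>) \<ge> 0" by (intro sum_nonneg) auto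
  ultimately show ?thesis unfolding nb_def \<pi>_def fst_conv snd_conv by linarith
qed

text \<open>
  Two points at distance one differ in exactly one coordinate.
\<close>
lemma slab_edge_cases:
  assumes "{x, y} \<in> slab_edges d k"
  obtains i where "i < d" "y = x(i := x i + 1) \<or> y = x(i := x i - 1)"
proof -
  have x: "x \<in> slab d k" "y \<in> slab d k" "(\<Sum>i<d. \<bar>x i - y i\<bar>) = 1" using assms by (auto simp: slab_edges_iff)
  have "\<exists>i<d. x i \<noteq> y i"
  proof (rule ccontr)
    assume "\<not> ?thesis"
    then have "(\<Sum>i<d. \<bar>x i - y i\<bar>) = 0" by (intro sum.neutral) auto
    then show False using x by simp
  qed
  then obtain i where i: "i < d" "x i \<noteq> y i" by blast
  have s: "(\<Sum>j<d. \<bar>x j - y j\<bar>) = \<bar>x i - y i\<bar> + (\<Sum>j\<in>{..<d} - {i}. \<bar>x j - y j\<bar>)"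
    using i by (intro sum.remove) auto
  have nn: "(\<Sum>j\<in>{..<d} - {i}. \<bar>x j - y j\<bar>) \<ge> 0" by (intro sum_nonneg) auto
  have one: "\<bar>x i - y i\<bar> = 1" "(\<Sum>j\<in>{..<d} - {i}. \<bar>x j - y j\<bar>) = 0"
  proof -
    have "1 \<le> \<bar>x i - y i\<bar>" using i(2) by (simp add: int_one_le_iff_zero_less)
    then show "\<bar>x i - y i\<bar> = 1" "(\<Sum>j\<in>{..<d} - {i}. \<bar>x j - y j\<bar>) = 0" using s nn x(3) by linarith+
  qed
  then have "\<forall>j\<in>{..<d} - {i}. \<bar>x j - y j\<bar> = 0" by (subst (asm) sum_nonneg_eq_0_iff) auto
  then have eq: "x j = y j" if "j \<noteq> i" for j
    using that x(1,2) by (cases "j < d") (auto simp: slab_def PiE_def extensional_def)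
  have "y = x(i := y i)" using eq by (auto simp: fun_eq_iff)
  moreover have "y i = x i + 1 \<or> y i = x i - 1" using one(1) by linarith
  ultimately have "y = x(i := x i + 1) \<or> y = x(i := x i - 1)" by metis
  then show ?thesis using that i(1) by blast
qed

lemma card_fibre_le:
  assumes "d \<ge> 2" shows "finite (slab_over d k {z})" "card (slab_over d k {z}) \<le> k ^ (d - 2)"
proof -
  let ?B = "\<lambda>i. if i = 0 then {fst z} else if i = 1 then {snd z} else {0..<int k}"
  have sub: "slab_over d k {z} \<subseteq> (\<Pi>\<^sub>E i\<in>{..<d}. ?B i)" using slab_over_PiE[of d k "{z}"] by (simp only: image_insert image_empty)
  have "{..<d} = insert 0 (insert 1 {2..<d})" using assms by auto
  then have "card (\<Pi>\<^sub>E i\<in>{..<d}. ?B i) = k ^ (d - 2)" by (simp add: card_PiE)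
  then show "card (slab_over d k {z}) \<le> k ^ (d - 2)" using card_mono[OF _ sub] finite_PiE[of "{..<d}" ?B] by auto
  show "finite (slab_over d k {z})" by (rule finite_slab_over) simp
qed

lemma card_fibre_edges_le:
  assumes "d \<ge> 2"
  shows "card {e \<in> edges_on d k Z. \<exists>y\<in>e. \<pi> y = z} \<le> 2 * d * k ^ (d - 2)"
proof -
  let ?f = "\<lambda>(v :: vertex, i, s). {v, v(i := v i + s)} :: edge"
  let ?D = "slab_over d k {z} \<times> {..<d} \<times> {1, -1 :: int}"
  have "{e \<in> edges_on d k Z. \<exists>y\<in>e. \<pi> y = z} \<subseteq> ?f ` ?D"
  proof
    fix e assume "e \<in> {e \<in> edges_on d k Z. \<exists>y\<in>e. \<pi> y = z}"
    then obtain v where e: "e \<in> slab_edges d k" "v \<in> e" "\<pi> v = z" by (auto simp: edges_on_def)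
    then obtain y where y: "e = {v, y}" by (auto simp: slab_edges_def)
    then have v: "v \<in> slab_over d k {z}" using e by (auto simp: slab_edges_iff slab_over_pi)
    obtain i where "i < d" "y = v(i := v i + 1) \<or> y = v(i := v i - 1)" using e(1) y slab_edge_cases by blast
    then show "e \<in> ?f ` ?D" using v y by (auto intro: image_eqI[of _ _ "(v, i, 1)"] image_eqI[of _ _ "(v, i, -1)"])
  qed
  moreover have "finite ?D" using card_fibre_le(1)[OF assms, of k z] by simp
  ultimately have "card {e \<in> edges_on d k Z. \<exists>y\<in>e. \<pi> y = z} \<le> card ?D"
    by (meson card_image_le card_mono finite_imageI order_trans)
  also have "\<dots> = card (slab_over d k {z}) * (d * 2)" by (simp add: card_cartesian_product)
  also have "\<dots> \<le> k ^ (d - 2) * (d * 2)" using card_fibre_le(2)[OF assms, of k z] by (rule mult_right_mono) simp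
  finally show ?thesis by (simp add: mult_ac)
qed

text \<open>
  The coordinates from 2 on are adjusted one unit at a time, which decreases the distance to y.
\<close>
lemma fibre_connected:
  assumes "x \<in> slab_over d k Z" "y \<in> slab_over d k Z" "\<pi> x = \<pi> y"
  shows "reach (edges_on d k Z) {v \<in> slab_over d k Z. \<pi> v = \<pi> y} x y"
  using assms(1,3)
proof (induction "nat (\<Sum>i<d. \<bar>x i - y i\<bar>)" arbitrary: x rule: less_induct)
  case less
  show ?case
  proof (cases "x = y")
    case False
    have xs: "x \<in> slab d k" "y \<in> slab d k" using less.prems assms(2) by (auto simp: slab_over_def)
    have "\<exists>i<d. x i \<noteq> y i"
    proof (rule ccontr)
      assume "\<not> ?thesis"
      then have "x = y" using xs by (intro PiE_ext[of x "{..<d}" _ y]) (auto simp: slab_def)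
      then show False using False by simp
    qed
    then obtain i where i: "i < d" "x i \<noteq> y i" by blast
    have "x 0 = y 0" "x 1 = y 1" using less.prems(2) by (simp_all add: \<pi>_def)
    then have i2: "i \<noteq> 0" "i \<noteq> 1" using i(2) by metis+
    define s where "s = (if x i < y i then 1 else - 1 :: int)"
    define x' where "x' = x(i := x i + s)"
    have bnd: "0 \<le> x i" "x i < k" "0 \<le> y i" "y i < k" using slab_coord[OF xs(1) i(1)] slab_coord[OF xs(2) i(1)] i2 by auto
    have x'i: "0 \<le> x i + s" "x i + s < k" using bnd i(2) by (auto simp: s_def)
    have x'slab: "x' \<in> slab d k"
      unfolding x'_def using x'i by (intro slab_upd[OF xs(1) i(1)]) auto
    have x'V: "x' \<in> slab_over d k Z" "\<pi> x' = \<pi> y"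
      using less.prems x'slab i2 by (auto simp: slab_over_def \<pi>_def x'_def)
    have sm: "(\<Sum>j<d. f j) = f i + (\<Sum>j\<in>{..<d} - {i}. f j)" for f :: "nat \<Rightarrow> int"
      using i by (intro sum.remove) auto
    have "(\<Sum>j<d. \<bar>x j - x' j\<bar>) = 1" by (subst sm) (simp add: x'_def s_def)
    then have edge: "{x, x'} \<in> edges_on d k Z" using xs(1) x'slab x'V(1) less.prems(1) by (auto simp: edges_on_def slab_edges_iff)
    have "(\<Sum>j\<in>{..<d} - {i}. \<bar>x' j - y j\<bar>) = (\<Sum>j\<in>{..<d} - {i}. \<bar>x j - y j\<bar>)"
      by (intro sum.cong) (auto simp: x'_def)
    moreover have "\<bar>x' i - y i\<bar> < \<bar>x i - y i\<bar>" using i(2) by (simp add: x'_def s_def)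
    moreover have "0 \<le> (\<Sum>j\<in>{..<d} - {i}. \<bar>x j - y j\<bar>)" by (intro sum_nonneg) auto
    ultimately have "nat (\<Sum>j<d. \<bar>x' j - y j\<bar>) < nat (\<Sum>j<d. \<bar>x j - y j\<bar>)"
      unfolding sm[of "\<lambda>j. \<bar>x j - y j\<bar>"] sm[of "\<lambda>j. \<bar>x' j - y j\<bar>"] by linarith
    then have "reach (edges_on d k Z) {v \<in> slab_over d k Z. \<pi> v = \<pi> y} x' y" using less.hyps x'V by blast
    moreover have "stp (edges_on d k Z) {v \<in> slab_over d k Z. \<pi> v = \<pi> y} x x'"
      using edge x'V less.prems by (auto simp: stp_def)
    ultimately show ?thesis by (metis (no_types) converse_rtranclp_into_rtranclp)
  qed simp
qed

lemma conn_restrict: "conn \<omega> V A B \<longleftrightarrow> conn (\<omega> \<inter> {e. e \<subseteq> V}) V A B"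
proof -
  have "pedges xs \<subseteq> \<omega> \<inter> {e. e \<subseteq> V} \<longleftrightarrow> pedges xs \<subseteq> \<omega>" if "set xs \<subseteq> V" for xs
    using subset_trans[OF pedges_subset that] by auto
  then show ?thesis unfolding conn_def by (intro ex_cong1) auto
qed

lemma bprob_conn_marginal:
  assumes "finite E" "E' \<subseteq> E" "\<And>e. e \<in> E \<Longrightarrow> e \<subseteq> V \<Longrightarrow> e \<in> E'"
  shows "bprob p E (\<lambda>\<omega>. conn \<omega> V A B) = bprob p E' (\<lambda>\<omega>. conn \<omega> V A B)"
  unfolding bprob_def
proof (rule bexp_marginal[OF assms(1,2)])
  fix \<omega> assume "\<omega> \<subseteq> E"
  then have "\<omega> \<inter> {e. e \<subseteq> V} = \<omega> \<inter> E' \<inter> {e. e \<subseteq> V}"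
    using assms(3) by (intro set_eqI) (simp, blast)
  then show "of_bool (conn \<omega> V A B) = of_bool (conn (\<omega> \<inter> E') V A B)"
    using conn_restrict[of \<omega> V A B] conn_restrict[of "\<omega> \<inter> E'" V A B] by simp
qed

lemma edges_on_mono: "Z \<subseteq> Z' \<Longrightarrow> edges_on d k Z \<subseteq> edges_on d k Z'"
  using slab_over_mono[of Z Z' d k] by (auto simp: edges_on_def)

lemma conn_prob_eq:
  assumes "finite S" "Z \<subseteq> S"
  shows "conn_prob d k p Z A B = bprob p (edges_on d k S) (\<lambda>\<omega>. conn \<omega> (slab_over d k Z) (slab_over d k A) (slab_over d k B))"
proof -
  have "bprob p (edges_on d k S) (\<lambda>\<omega>. conn \<omega> (slab_over d k Z) (slab_over d k A) (slab_over d k B)) =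
      bprob p (edges_on d k Z) (\<lambda>\<omega>. conn \<omega> (slab_over d k Z) (slab_over d k A) (slab_over d k B))"
  proof (rule bprob_conn_marginal)
    show "finite (edges_on d k S)" by (rule finite_edges_on[OF assms(1)])
    show "edges_on d k Z \<subseteq> edges_on d k S" by (rule edges_on_mono[OF assms(2)])
    show "\<And>e. e \<in> edges_on d k S \<Longrightarrow> e \<subseteq> slab_over d k Z \<Longrightarrow> e \<in> edges_on d k Z" by (simp add: edges_on_def)
  qed
  then show ?thesis by (simp only: conn_prob_def)
qed

lemma conn_prob_sym: "conn_prob d k p Z A B = conn_prob d k p Z B A"
  unfolding conn_prob_def by (intro bprob_cong iffI) (erule conn_sym)+

text \<open>
  A map of the plane acts on the two unbounded coordinates of the slab.
\<close>
definition lift_map :: "(site \<Rightarrow> site) \<Rightarrow> vertex \<Rightarrow> vertex" where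
  "lift_map \<phi> x = x(0 := fst (\<phi> (\<pi> x)), 1 := snd (\<phi> (\<pi> x)))"

lemma pi_lift_map [simp]: "\<pi> (lift_map \<phi> x) = \<phi> (\<pi> x)"
  by (simp add: \<pi>_def lift_map_def)

lemma slab_upd01:
  assumes "x \<in> slab d k" "d \<ge> 2" shows "x(0 := a, 1 := b) \<in> slab d k"
proof -
  have "x(0 := a) \<in> slab d k" by (rule slab_upd) (use assms in auto)
  then show ?thesis by (rule slab_upd) (use assms in auto)
qed

lemma lift_map_slab: "d \<ge> 2 \<Longrightarrow> x \<in> slab d k \<Longrightarrow> lift_map \<phi> x \<in> slab d k"
  unfolding lift_map_def by (rule slab_upd01)

text \<open>
  With respect to the distance in which edges have length one: translations, reflections in the axes, and the exchange of the axes.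
\<close>
definition isometry :: "(site \<Rightarrow> site) \<Rightarrow> bool" where
  "isometry \<phi> \<longleftrightarrow> (\<forall>u v. \<bar>fst (\<phi> u) - fst (\<phi> v)\<bar> + \<bar>snd (\<phi> u) - snd (\<phi> v)\<bar> = \<bar>fst u - fst v\<bar> + \<bar>snd u - snd v\<bar>)"

lemma lift_map_dist:
  assumes "isometry \<phi>" "d \<ge> 2"
  shows "(\<Sum>i<d. \<bar>lift_map \<phi> x i - lift_map \<phi> y i\<bar>) = (\<Sum>i<d. \<bar>x i - y i\<bar>)"
proof -
  have "(\<Sum>i\<in>{2..<d}. \<bar>lift_map \<phi> x i - lift_map \<phi> y i\<bar>) = (\<Sum>i\<in>{2..<d}. \<bar>x i - y i\<bar>)"
  proof (rule sum.cong)
    fix i assume "i \<in> {2..<d}"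
    then have "i \<noteq> 0" "i \<noteq> 1" by auto
    then show "\<bar>lift_map \<phi> x i - lift_map \<phi> y i\<bar> = \<bar>x i - y i\<bar>" by (simp add: lift_map_def)
  qed simp
  moreover have "\<bar>lift_map \<phi> x 0 - lift_map \<phi> y 0\<bar> + \<bar>lift_map \<phi> x 1 - lift_map \<phi> y 1\<bar> = \<bar>x 0 - y 0\<bar> + \<bar>x 1 - y 1\<bar>"
    using assms(1)[unfolded isometry_def, rule_format, of "\<pi> x" "\<pi> y"] by (simp add: lift_map_def \<pi>_def)
  ultimately show ?thesis using assms(2) by (simp add: sum_split2)
qed

lemma lift_map_inj: 
  assumes "isometry \<phi>" "d \<ge> 2" shows "inj_on (lift_map \<phi>) (slab d k)"
proof (rule inj_onI)
  fix x y assume xy: "x \<in> slab d k" "y \<in> slab d k" "lift_map \<phi> x = lift_map \<phi> y"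
  then have "(\<Sum>i<d. \<bar>x i - y i\<bar>) = 0" using lift_map_dist[OF assms, of x y] by simp
  then have "\<forall>i\<in>{..<d}. \<bar>x i - y i\<bar> = 0" by (subst (asm) sum_nonneg_eq_0_iff) auto
  then show "x = y" using xy by (intro PiE_ext[of x "{..<d}" _ y]) (auto simp: slab_def)
qed

lemma lift_map_over:
  assumes "isometry \<phi>" "d \<ge> 2"
  shows "slab_over d k (\<phi> ` Z) = lift_map \<phi> ` slab_over d k Z"
proof
  show "lift_map \<phi> ` slab_over d k Z \<subseteq> slab_over d k (\<phi> ` Z)"
    using lift_map_slab[OF assms(2)] by (auto simp: slab_over_pi)
  show "slab_over d k (\<phi> ` Z) \<subseteq> lift_map \<phi> ` slab_over d k Z"
  proof
    fix y assume "y \<in> slab_over d k (\<phi> ` Z)"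
    then obtain z where z: "z \<in> Z" "\<pi> y = \<phi> z" "y \<in> slab d k" by (auto simp: slab_over_pi)
    define x where "x = y(0 := fst z, 1 := snd z)"
    have "x \<in> slab d k" using z(3) assms(2) unfolding x_def by (rule slab_upd01)
    moreover have "\<pi> x = z" by (simp add: x_def \<pi>_def)
    moreover have "lift_map \<phi> x = y" using z(2) by (auto simp: fun_eq_iff lift_map_def x_def \<pi>_def prod_eq_iff)
    ultimately show "y \<in> lift_map \<phi> ` slab_over d k Z" using z(1) by (auto simp: slab_over_pi intro!: image_eqI[of _ _ x])
  qed
qed

lemma lift_map_edges_on:
  assumes "isometry \<phi>" "d \<ge> 2"
  shows "edges_on d k (\<phi> ` Z) = (`) (lift_map \<phi>) ` edges_on d k Z"
proof
  show "(`) (lift_map \<phi>) ` edges_on d k Z \<subseteq> edges_on d k (\<phi> ` Z)"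
  proof
    fix e assume "e \<in> (`) (lift_map \<phi>) ` edges_on d k Z"
    then obtain e' where e': "e' \<in> edges_on d k Z" "e = lift_map \<phi> ` e'" by auto
    then obtain x y where "e' = {x, y}" by (auto simp: edges_on_def slab_edges_def)
    then show "e \<in> edges_on d k (\<phi> ` Z)" using e' lift_map_slab[OF assms(2)] lift_map_dist[OF assms]
      unfolding edges_on_def lift_map_over[OF assms] by (auto simp: slab_edges_iff)
  qed
  show "edges_on d k (\<phi> ` Z) \<subseteq> (`) (lift_map \<phi>) ` edges_on d k Z"
  proof
    fix e assume e: "e \<in> edges_on d k (\<phi> ` Z)"
    then obtain a b where ab: "e = {a, b}" by (auto simp: edges_on_def slab_edges_def)
    then obtain x y where xy: "a = lift_map \<phi> x" "b = lift_map \<phi> y" "x \<in> slab_over d k Z" "y \<in> slab_over d k Z"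
      using e unfolding edges_on_def lift_map_over[OF assms] by auto
    then have "{x, y} \<in> edges_on d k Z" using e ab lift_map_dist[OF assms] by (auto simp: edges_on_def slab_edges_iff slab_over_def)
    then show "e \<in> (`) (lift_map \<phi>) ` edges_on d k Z" using ab xy by (intro image_eqI[of _ _ "{x, y}"]) auto
  qed
qed

lemma conn_image: 
  assumes "conn \<omega> V A B" shows "conn ((`) f ` \<omega>) (f ` V) (f ` A) (f ` B)"
proof -
  have pe: "pedges (map f xs) = (`) f ` pedges xs" for xs
    by (induction xs rule: induct_list012) auto
  from assms obtain xs where "xs \<noteq> []" "set xs \<subseteq> V" "pedges xs \<subseteq> \<omega>" "hd xs \<in> A" "last xs \<in> B"
    unfolding conn_def by auto
  then show ?thesis unfolding conn_def
    by (intro exI[of _ "map f xs"]) (auto simp: pe hd_map last_map)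
qed

lemma conn_image_iff:
  assumes "inj_on f W" "V \<subseteq> W" "A \<subseteq> W" "B \<subseteq> W" "\<Union> \<omega> \<subseteq> W"
  shows "conn ((`) f ` \<omega>) (f ` V) (f ` A) (f ` B) \<longleftrightarrow> conn \<omega> V A B"
proof
  let ?g = "inv_into W f"
  have gf: "?g ` f ` X = X" if "X \<subseteq> W" for X
    using that assms(1) by (simp add: image_inv_into_cancel inv_into_image_cancel)
  have "(`) ?g ` (`) f ` \<omega> = (\<lambda>e. ?g ` f ` e) ` \<omega>" by (simp add: image_image)
  also have "\<dots> = (\<lambda>e. e) ` \<omega>" by (intro image_cong refl gf) (use assms(5) in auto)
  finally have w: "(`) ?g ` (`) f ` \<omega> = \<omega>" by simp
  assume "conn ((`) f ` \<omega>) (f ` V) (f ` A) (f ` B)"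
  from conn_image[OF this, of ?g] show "conn \<omega> V A B" unfolding w gf[OF assms(2)] gf[OF assms(3)] gf[OF assms(4)] .
qed (rule conn_image)

lemma conn_prob_isometry:
  assumes "isometry \<phi>" "d \<ge> 2" "finite Z"
  shows "conn_prob d k p (\<phi> ` Z) (\<phi> ` A) (\<phi> ` B) = conn_prob d k p Z A B"
proof -
  have sub: "slab_over d k X \<subseteq> slab d k" for X by (auto simp: slab_over_def)
  have "inj_on ((`) (lift_map \<phi>)) (edges_on d k Z)"
    using lift_map_inj[OF assms(1,2), of k] sub[of Z] by (intro inj_on_image) (auto simp: edges_on_def intro: inj_on_subset)
  then have "conn_prob d k p (\<phi> ` Z) (\<phi> ` A) (\<phi> ` B) = bprob p (edges_on d k Z) (\<lambda>\<omega>. conn ((`) (lift_map \<phi>) ` \<omega>) (lift_map \<phi> ` slab_over d k Z) (lift_map \<phi> ` slab_over d k A) (lift_map \<phi> ` slab_over d k B))"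
    unfolding conn_prob_def bprob_def lift_map_over[OF assms(1,2)] lift_map_edges_on[OF assms(1,2)]
    by (subst bexp_image) (use finite_edges_on[OF assms(3)] in auto)
  also have "\<dots> = conn_prob d k p Z A B" unfolding conn_prob_def
    by (intro bprob_cong conn_image_iff[OF lift_map_inj[OF assms(1,2)]] sub) (use sub in \<open>auto simp: edges_on_def\<close>)
  finally show ?thesis .
qed

lemma pi_path:
  assumes "d \<ge> 2" "pedges xs \<subseteq> slab_edges d k"
  shows "successively nb (map \<pi> xs)"
  using assms(2)
proof (induction xs rule: induct_list012)
  case (3 x y zs)
  then show ?case using slab_edge_nb[OF assms(1), of x y k] by simp
qed auto

text \<open>
  Every path of sites from A to B in S1 hits every path of sites from C to D in S2.
\<close>
definition meets :: "site set \<Rightarrow> site set \<Rightarrow> site set \<Rightarrow> site set \<Rightarrow> site set \<Rightarrow> site set \<Rightarrow> bool" where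
  "meets S1 A B S2 C D \<longleftrightarrow> (\<forall>Z1 Z2 a b c d. Z1 \<subseteq> S1 \<longrightarrow> Z2 \<subseteq> S2 \<longrightarrow> a \<in> A \<longrightarrow> b \<in> B \<longrightarrow> c \<in> C \<longrightarrow> d \<in> D \<longrightarrow>
      lconn Z1 a b \<longrightarrow> lconn Z2 c d \<longrightarrow> Z1 \<inter> Z2 \<noteq> {})"

lemma pi_lconn:
  assumes "d \<ge> 2" "pedges xs \<subseteq> slab_edges d k" "xs \<noteq> []"
  shows "lconn (\<pi> ` set xs) (\<pi> (hd xs)) (\<pi> (last xs))"
  using lconnI[of "map \<pi> xs"] pi_path[OF assms(1,2)] assms(3) by (simp add: hd_map last_map)

text \<open>
  Whether the two sets are connected depends on the finitely many edges above Z only.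
\<close>
lemma cross_measure:
  assumes "finite Z" "0 \<le> p" "p \<le> 1"
  shows "\<P>(\<omega> in percolation d k p. open_connected d k \<omega> (slab_over d k Z) (slab_over d k A) (slab_over d k B)) = conn_prob d k p Z A B"
  unfolding percolation_def conn_prob_def
proof (rule measure_PiM_bernoulli)
  fix \<omega> :: "edge \<Rightarrow> bool"
  have "open_path d k \<omega> xs \<and> set xs \<subseteq> slab_over d k Z \<longleftrightarrow>
    xs \<noteq> [] \<and> set xs \<subseteq> slab_over d k Z \<and> pedges xs \<subseteq> {e \<in> edges_on d k Z. \<omega> e}" for xs
  proof -
    have "successively (\<lambda>x y. {x, y} \<in> slab_edges d k \<and> \<omega> {x, y}) xs \<longleftrightarrow> pedges xs \<subseteq> {e \<in> slab_edges d k. \<omega> e}"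
      using successively_pedges[of "{e \<in> slab_edges d k. \<omega> e}" xs] by simp
    then show ?thesis unfolding open_path_def edges_on_def using pedges_subset[of _ xs]
      by (auto simp: slab_over_def) blast+
  qed
  then show "open_connected d k \<omega> (slab_over d k Z) (slab_over d k A) (slab_over d k B) =
     conn {e \<in> edges_on d k Z. \<omega> e} (slab_over d k Z) (slab_over d k A) (slab_over d k B)"
    unfolding open_connected_def conn_def by blast
qed (use assms finite_edges_on in \<open>auto simp: edges_on_def\<close>)

locale slab_percolation =
  fixes d k :: nat and p :: real
  assumes d: "d \<ge> 2" and p: "0 < p" "p < 1"
begin

abbreviation ov where "ov \<equiv> slab_over d k"
abbreviation cpr where "cpr \<equiv> conn_prob d k p"
abbreviation m where "m \<equiv> 2 * d * k ^ (d - 2)"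

definition Kc :: real where "Kc = 1 + 2 * (1 / min p (1 - p)) ^ (2 * d * k ^ (d - 2))"

lemma fibred: "finite S \<Longrightarrow> fibred_graph (ov S) (edges_on d k S) \<pi> (2 * d * k ^ (d - 2)) p"
proof (unfold_locales, goal_cases)
  case (3 x y)
  then show ?case using fibre_connected[of x d k S y] by (auto simp: conn_iff_reach)
qed (use p finite_slab_over card_fibre_edges_le[OF d] in \<open>auto simp: edges_on_def\<close>)

lemma nonneg: "0 \<le> p" "p \<le> 1"
  using p by auto

lemma gluing_slab:
  assumes "finite S" "S1 \<subseteq> S" "inj_on h (ov S)"
  shows "(\<Sum>R\<in>orders (ov S). bprob p (edges_on d k S) (\<lambda>\<omega>. conn \<omega> (ov S1) (ov A) (ov B) \<and>
       conn \<omega> (ov S) (ov C) {v. \<pi> v \<in> \<pi> ` set (least_path h R (ov S1) (ov A) (ov B) \<omega>)}))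
    \<le> card (orders (ov S)) * Kc * cpr S A C"
proof -
  interpret fibred_graph "ov S" "edges_on d k S" \<pi> "2 * d * k ^ (d - 2)" p using fibred[OF assms(1)] .
  show ?thesis
    using gluing[of "ov S1" "ov A" h "ov B" "ov C"] slab_over_mono[OF assms(2)] assms(3)
    unfolding conn_prob_def Kc_def gluing_const_def by (auto simp: slab_over_pi)
qed

text \<open>
  By Harris' inequality both connections occur simultaneously with at least the product of the probabilities. Then, whichever path from A to B is selected, the path from C to D visits one of its fibres, and \<open>gluing_slab\<close> applies to each family of preferences.
\<close>
lemma gluing_meet:
  assumes "finite S" "S1 \<subseteq> S" "S2 \<subseteq> S" and meet: "meets S1 A B S2 C D"
  shows "cpr S1 A B * cpr S2 C D \<le> Kc * cpr S A C"
proof -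
  obtain h :: "vertex \<Rightarrow> nat" where h: "inj_on h (ov S)"
    using finite_imp_inj_to_nat_seg[OF finite_slab_over[OF assms(1)]] by blast
  let ?E = "edges_on d k S"
  have fin: "finite (ov S)" "finite (ov S1)" "finite ?E"
    using finite_slab_over[OF assms(1)] finite_slab_over[OF finite_subset[OF assms(2,1)]] finite_edges_on[OF assms(1)]
    by auto
  let ?n = "real (card (orders (ov S)))"
  have n: "?n > 0" using finite_orders[OF fin(1)] orders_nonempty[OF fin(1)] by (simp add: card_gt_0_iff)
  define T where "T R \<omega> \<longleftrightarrow> conn \<omega> (ov S1) (ov A) (ov B) \<and>
       conn \<omega> (ov S) (ov C) {v. \<pi> v \<in> \<pi> ` set (least_path h R (ov S1) (ov A) (ov B) \<omega>)}" for R \<omega>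
  have prod: "cpr S1 A B * cpr S2 C D \<le> bprob p ?E (\<lambda>\<omega>. conn \<omega> (ov S1) (ov A) (ov B) \<and> conn \<omega> (ov S2) (ov C) (ov D))"
    unfolding conn_prob_eq[OF assms(1,2)] conn_prob_eq[OF assms(1,3)]
    by (rule harris_bprob[OF fin(3) nonneg]) (erule (1) conn_mono; simp)+
  have incl: "bprob p ?E (\<lambda>\<omega>. conn \<omega> (ov S1) (ov A) (ov B) \<and> conn \<omega> (ov S2) (ov C) (ov D)) \<le> bprob p ?E (T R)" for R
    unfolding T_def
  proof (intro bprob_mono nonneg, elim conjE, intro conjI)
    fix \<omega> assume w: "\<omega> \<subseteq> ?E" "conn \<omega> (ov S1) (ov A) (ov B)" "conn \<omega> (ov S2) (ov C) (ov D)"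
    define \<gamma> where "\<gamma> = least_path h R (ov S1) (ov A) (ov B) \<omega>"
    have g: "\<gamma> \<in> simple_paths (ov S1) (ov A) (ov B) \<omega>" unfolding \<gamma>_def by (rule least_path_in[OF fin(2) w(2)])
    then have g': "\<gamma> \<noteq> []" "set \<gamma> \<subseteq> ov S1" "pedges \<gamma> \<subseteq> slab_edges d k" "hd \<gamma> \<in> ov A" "last \<gamma> \<in> ov B"
      using w(1) by (auto simp: simple_paths_def edges_on_def)
    from w(3) obtain xs where xs: "xs \<noteq> []" "set xs \<subseteq> ov S2" "pedges xs \<subseteq> \<omega>" "hd xs \<in> ov C" "last xs \<in> ov D"
      unfolding conn_def by blast
    then have xe: "pedges xs \<subseteq> slab_edges d k" using w(1) by (auto simp: edges_on_def)
    have "\<pi> ` set \<gamma> \<inter> \<pi> ` set xs \<noteq> {}"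
      by (rule meet[unfolded meets_def, rule_format, OF _ _ _ _ _ _ pi_lconn[OF d g'(3,1)] pi_lconn[OF d xe xs(1)]])
        (use g' xs in \<open>auto simp: slab_over_pi\<close>)
    then obtain z where z: "z \<in> \<pi> ` set \<gamma>" "z \<in> \<pi> ` set xs" by blast
    from z(2) obtain v where "v \<in> set xs" "z = \<pi> v" by (rule imageE)
    with z(1) have v: "v \<in> set xs" "\<pi> v \<in> \<pi> ` set \<gamma>" by simp_all
    have "reach \<omega> (ov S) (hd xs) v"
      using xs v slab_over_mono[OF assms(3), of d k] by (intro reach_list[OF xs(3)]) auto
    moreover have "hd xs \<in> ov C \<inter> ov S" "v \<in> {v. \<pi> v \<in> \<pi> ` set \<gamma>}"
      using v xs(4) subsetD[OF slab_over_mono[OF assms(3)] subsetD[OF xs(2) hd_in_set[OF xs(1)]]] by blast+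
    ultimately show "conn \<omega> (ov S) (ov C) {v. \<pi> v \<in> \<pi> ` set \<gamma>}"
      unfolding conn_iff_reach by blast
  qed
  have le: "cpr S1 A B * cpr S2 C D \<le> bprob p ?E (T R)" for R
    by (rule order_trans[OF prod incl])
  have "?n * (cpr S1 A B * cpr S2 C D) = (\<Sum>R\<in>orders (ov S). cpr S1 A B * cpr S2 C D)" by simp
  also have "\<dots> \<le> (\<Sum>R\<in>orders (ov S). bprob p ?E (T R))" by (rule sum_mono) (rule le)
  also have "\<dots> \<le> ?n * Kc * cpr S A C" unfolding T_def by (rule gluing_slab[OF assms(1,2) h])
  finally have "?n * (cpr S1 A B * cpr S2 C D) \<le> ?n * (Kc * cpr S A C)" by (simp only: mult.assoc)
  then show ?thesis using n by simp
qed

end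

section \<open>Reflecting the least path\<close>

lemma lconn_isometry:
  assumes "lconn Z u v" "isometry \<phi>" shows "lconn (\<phi> ` Z) (\<phi> u) (\<phi> v)"
proof -
  from assms(1) obtain xs where xs: "xs \<noteq> []" "set xs \<subseteq> Z" "hd xs = u" "last xs = v" "successively nb xs"
    unfolding lconn_def by blast
  have "nb (\<phi> a) (\<phi> b) = nb a b" for a b
    unfolding nb_def using assms(2)[unfolded isometry_def, rule_format, of a b] by simp
  then have "successively nb (map \<phi> xs)" using xs(5) by (simp add: successively_map)
  then show ?thesis unfolding lconn_def using xs
    by (intro exI[of _ "map \<phi> xs"]) (auto simp: hd_map last_map)
qed

text \<open>
  Projections of paths connect any two of their points.
\<close>
lemma pi_lconn_any:
  assumes "d \<ge> 2" "pedges xs \<subseteq> slab_edges d k" "u \<in> set xs" "v \<in> set xs"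
  shows "lconn (\<pi> ` set xs) (\<pi> u) (\<pi> v)"
proof -
  have hd: "lconn (\<pi> ` set xs) (\<pi> (hd xs)) (\<pi> u)" if u: "u \<in> set xs" for u
  proof -
    obtain ys zs where xs: "xs = ys @ u # zs" using split_list[OF u] by blast
    have "pedges (ys @ [u]) \<subseteq> slab_edges d k" using assms(2) pedges_append[of ys u zs] xs by auto
    from pi_lconn[OF assms(1) this] have "lconn (\<pi> ` set (ys @ [u])) (\<pi> (hd (ys @ [u]))) (\<pi> u)" by simp
    moreover have "hd (ys @ [u]) = hd xs" using xs by (cases ys) auto
    ultimately show ?thesis using xs by (auto elim!: lconn_mono)
  qed
  show ?thesis using lconn_trans[OF lconn_sym[OF hd[OF assms(3)]] hd[OF assms(4)]] .
qed

text \<open>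
  Given that the edges of E1 are open, a decreasing event and an increasing event that does not look at E1 are negatively correlated, and the second one has its unconditional probability.
\<close>
lemma harris_given_open:
  assumes "finite E" "0 \<le> p" "p \<le> 1" "E1 \<subseteq> E"
    and dec: "\<And>\<alpha> \<beta>. \<alpha> \<subseteq> \<beta> \<Longrightarrow> \<beta> \<subseteq> E \<Longrightarrow> Y \<beta> \<Longrightarrow> Y \<alpha>"
    and inc: "\<And>\<alpha> \<beta>. \<alpha> \<subseteq> \<beta> \<Longrightarrow> \<beta> \<subseteq> E \<Longrightarrow> U \<alpha> \<Longrightarrow> U \<beta>"
    and loc: "\<And>\<omega>. \<omega> \<subseteq> E \<Longrightarrow> U \<omega> = U (\<omega> - E1)"
  shows "bprob p E (\<lambda>\<omega>. (E1 \<subseteq> \<omega> \<and> Y \<omega>) \<and> U \<omega>) \<le> bprob p E (\<lambda>\<omega>. E1 \<subseteq> \<omega> \<and> Y \<omega>) * bprob p E U"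
proof -
  define Y' where "Y' \<omega> = Y (\<omega> \<union> E1)" for \<omega>
  have sp: "bprob p E (\<lambda>\<omega>. E1 \<subseteq> \<omega> \<and> W \<omega>) = bprob p E (\<lambda>\<omega>. E1 \<subseteq> \<omega>) * bprob p E W"
    if W: "\<And>\<omega>. \<omega> \<subseteq> E \<Longrightarrow> W \<omega> = W (\<omega> \<inter> (E - E1))" for W
    unfolding bprob_def of_bool_conj
  proof (rule bexp_indep[of E E1 "E - E1"])
    fix \<omega> assume w: "\<omega> \<subseteq> E"
    show "of_bool (E1 \<subseteq> \<omega>) = of_bool (E1 \<subseteq> \<omega> \<inter> E1)" by (simp add: le_iff_inf inf_commute)
    show "of_bool (W \<omega>) = of_bool (W (\<omega> \<inter> (E - E1)))" using W[OF w] by simp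
  qed (use assms in auto)
  have Y'loc: "Y' \<omega> = Y' (\<omega> \<inter> (E - E1))" if "\<omega> \<subseteq> E" for \<omega>
  proof -
    have "\<omega> \<union> E1 = \<omega> \<inter> (E - E1) \<union> E1" using that by auto
    then show ?thesis by (simp add: Y'_def)
  qed
  have Uloc: "U \<omega> = U (\<omega> \<inter> (E - E1))" if "\<omega> \<subseteq> E" for \<omega>
  proof -
    have "\<omega> - E1 = \<omega> \<inter> (E - E1)" using that by auto
    then show ?thesis using loc[OF that] by simp
  qed
  have YY: "(E1 \<subseteq> \<omega> \<and> Y \<omega>) = (E1 \<subseteq> \<omega> \<and> Y' \<omega>)" for \<omega>
    by (auto simp: Y'_def Un_absorb2)
  have "bprob p E (\<lambda>\<omega>. (E1 \<subseteq> \<omega> \<and> Y \<omega>) \<and> U \<omega>) = bprob p E (\<lambda>\<omega>. E1 \<subseteq> \<omega> \<and> (U \<omega> \<and> Y' \<omega>))"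
    unfolding YY by (intro bprob_cong) auto
  also have "\<dots> = bprob p E (\<lambda>\<omega>. E1 \<subseteq> \<omega>) * bprob p E (\<lambda>\<omega>. U \<omega> \<and> Y' \<omega>)"
    by (rule sp) (simp add: Y'loc[symmetric] Uloc[symmetric])
  also have "\<dots> \<le> bprob p E (\<lambda>\<omega>. E1 \<subseteq> \<omega>) * (bprob p E U * bprob p E Y')"
  proof (rule mult_left_mono)
    show "bprob p E (\<lambda>\<omega>. U \<omega> \<and> Y' \<omega>) \<le> bprob p E U * bprob p E Y'"
    proof (rule harris_bprob_decreasing[OF assms(1-3)])
      fix \<alpha> \<beta> assume ab: "\<alpha> \<subseteq> \<beta>" "\<beta> \<subseteq> E"
      show "U \<alpha> \<Longrightarrow> U \<beta>" by (rule inc[OF ab])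
      have "\<alpha> \<union> E1 \<subseteq> \<beta> \<union> E1" "\<beta> \<union> E1 \<subseteq> E" using ab assms(4) by blast+
      then show "Y' \<beta> \<Longrightarrow> Y' \<alpha>" unfolding Y'_def by (rule dec)
    qed
    show "0 \<le> bprob p E (\<lambda>\<omega>. E1 \<subseteq> \<omega>)" by (rule bprob_nonneg[OF assms(2,3)])
  qed
  also have "\<dots> = bprob p E (\<lambda>\<omega>. E1 \<subseteq> \<omega> \<and> Y' \<omega>) * bprob p E U" using sp[where W = Y', OF Y'loc] by simp
  also have "\<dots> = bprob p E (\<lambda>\<omega>. E1 \<subseteq> \<omega> \<and> Y \<omega>) * bprob p E U" by (simp only: YY)
  finally show ?thesis .
qed

text \<open>
  The reflection in the line at height -1/2.
\<close>
definition flip :: "site \<Rightarrow> site" where "flip z = (fst z, - 1 - snd z)"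

lemma isometry_flip: "isometry flip"
  by (simp add: isometry_def flip_def abs_minus_commute)

lemma flip_flip [simp]: "flip (flip z) = z"
  by (simp add: flip_def)

lemma flip_image: "flip ` X = {z. flip z \<in> X}"
proof
  show "{z. flip z \<in> X} \<subseteq> flip ` X"
  proof
    fix z assume "z \<in> {z. flip z \<in> X}"
    then show "z \<in> flip ` X" by (intro image_eqI[of z flip "flip z"]) simp_all
  qed
qed auto

context slab_percolation
begin

text \<open>
  Select a path \<open>\<kappa>\<close> from A to the bottom row of the upper half and join it to its mirror image. The union separates D, which lies on the wall between its two ends, from the top row. So a path from D to the top meets \<open>\<kappa>\<close> or the mirror image. If D is connected to a fibre of \<open>\<kappa>\<close>, gluing connects D and A. Otherwise C is connected to the mirror image by a path avoiding \<open>\<kappa>\<close>.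
  
  Given \<open>\<kappa>\<close>, the latter event is at most as likely as without conditioning: that \<open>\<kappa>\<close> is selected means that \<open>\<kappa>\<close> is open, which is independent of a connection avoiding it, and that no smaller path is open, which is a decreasing event. The unconditional probability equals that of the mirrored event. When both occur, the two connections must cross in the plane, which by gluing bounds the square of the probability by \<open>Kc\<close> times that of a top-bottom crossing of the whole rectangle.
\<close>
lemma reflection:
  fixes w N a1 a2 d1 d2 :: int
  defines "R \<equiv> {0..<w} \<times> {-N..<N}" and "Su \<equiv> {0..<w} \<times> {0..<N}"
    and "A \<equiv> {0} \<times> {a1..<a2}" and "D \<equiv> {0} \<times> {d1..<d2}"
    and "B \<equiv> {0..<w} \<times> {0}" and "C \<equiv> {0..<w} \<times> {N - 1}" and "C' \<equiv> {0..<w} \<times> {-N}"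
  assumes h: "0 \<le> d1" "d2 \<le> a1"
  shows "cpr Su A B * cpr R C D \<le> Kc * cpr R A D + cpr Su A B * sqrt (Kc * cpr R C C')"
proof -
  have finR: "finite R" "finite Su" and SuR: "Su \<subseteq> R" by (auto simp: R_def Su_def)
  obtain hh :: "vertex \<Rightarrow> nat" where hh: "inj_on hh (ov R)"
    using finite_imp_inj_to_nat_seg[OF finite_slab_over[OF finR(1)]] by blast
  let ?E = "edges_on d k R"
  let ?V1 = "ov Su" and ?A = "ov A" and ?B = "ov B"
  have fin: "finite (ov R)" "finite ?V1" "finite ?E"
    using finite_slab_over[OF finR(1)] finite_slab_over[OF finR(2)] finite_edges_on[OF finR(1)] by auto
  let ?s = "sqrt (Kc * cpr R C C')"
  have s0: "?s \<ge> 0" using nonneg by (simp add: Kc_def conn_prob_def bprob_nonneg)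
  have rR: "flip ` R = R" unfolding flip_image by (auto simp: R_def flip_def)
  have rC: "flip ` C = C'" unfolding flip_image by (auto simp: C_def C'_def flip_def)
  have sel_path: "set \<kappa> \<subseteq> ?V1" "\<pi> ` set \<kappa> \<subseteq> Su" "pedges \<kappa> \<subseteq> slab_edges d k" "\<kappa> \<noteq> []"
      "\<exists>a. a1 \<le> a \<and> a < a2 \<and> \<pi> (hd \<kappa>) = (0, a)" "\<exists>x. 0 \<le> x \<and> x < w \<and> \<pi> (last \<kappa>) = (x, 0)"
    if "\<kappa> \<in> simple_paths ?V1 ?A ?B ?E" for \<kappa>
    using that by (auto simp: simple_paths_def slab_over_pi edges_on_def A_def B_def)
  \<comment> \<open>the top is connected to the mirror image of \<open>\<kappa>\<close> by a path that avoids \<open>\<kappa>\<close>\<close>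
  define U where "U \<kappa> \<omega> \<longleftrightarrow> conn \<omega> (ov (R - \<pi> ` set \<kappa>)) (ov C) (ov (flip ` \<pi> ` set \<kappa>))" for \<kappa> \<omega>
  have U: "bprob p ?E (U \<kappa>) \<le> ?s" if k: "\<kappa> \<in> simple_paths ?V1 ?A ?B ?E" for \<kappa>
  proof -
    let ?k = "\<pi> ` set \<kappa>"
    let ?k' = "flip ` ?k"
    note sp = sel_path[OF k]
    obtain a where a: "a1 \<le> a" "\<pi> (hd \<kappa>) = (0, a)" using sp(5) by blast
    have kR: "?k \<subseteq> R" using sp(2) SuR by blast
    have k'R: "?k' \<subseteq> R" using image_mono[OF kR, of flip] rR by simp
    have disj: "?k \<inter> ?k' = {}"
    proof (rule ccontr)
      assume "?k \<inter> ?k' \<noteq> {}"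
      then obtain z where z: "z \<in> ?k" "flip z \<in> ?k" unfolding flip_image by blast
      then have "z \<in> Su" "flip z \<in> Su" using sp(2) by blast+
      then show False by (auto simp: Su_def flip_def)
    qed
    have "(0, a) \<in> ?k" using sp(4) unfolding a(2)[symmetric] by simp
    then have "(0, a) \<in> Su" using sp(2) by blast
    then have a0: "0 \<le> a" by (simp add: Su_def)
    have "cpr (R - ?k) C ?k' * cpr (R - ?k') C' ?k \<le> Kc * cpr R C C'"
    proof (rule gluing_meet[OF finR(1)])
      show "meets (R - ?k) C ?k' (R - ?k') C' ?k" unfolding meets_def
      proof (intro allI impI)
        fix Z1 Z2 c z c' z'
        assume Z: "Z1 \<subseteq> R - ?k" "Z2 \<subseteq> R - ?k'" "c \<in> C" "z \<in> ?k'" "c' \<in> C'" "z' \<in> ?k" "lconn Z1 c z" "lconn Z2 c' z'"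
        from Z(3,5) obtain xc xc' where xc: "c = (xc, N - 1)" "c' = (xc', -N)" by (auto simp: C_def C'_def)
        obtain v v' where v: "v \<in> set \<kappa>" "v' \<in> set \<kappa>" "z = flip (\<pi> v)" "z' = \<pi> v'" using Z(4,6) by blast
        have "lconn ?k (\<pi> (hd \<kappa>)) (\<pi> v)" using sp v by (intro pi_lconn_any[OF d sp(3)]) auto
        from lconn_isometry[OF this isometry_flip] have "lconn ?k' (0, - 1 - a) z"
          using a(2) v(3) by (simp add: flip_def)
        from lconn_join[OF this nb_refl lconn_sym[OF Z(7)]] xc
        have g: "lconn (?k' \<union> Z1) (0, - 1 - a) (xc, N - 1)" by simp
        have "lconn ?k z' (0, a)" unfolding v(4) a(2)[symmetric] using sp v by (intro pi_lconn_any[OF d sp(3)]) auto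
        from lconn_join[OF Z(8) nb_refl this] xc
        have hp: "lconn (Z2 \<union> ?k) (xc', -N) (0, a)" by simp
        have "(?k' \<union> Z1) \<inter> (Z2 \<union> ?k) \<noteq> {}"
        proof (rule crossing_wall[OF g _ hp])
          show "?k' \<union> Z1 \<subseteq> {0..<w} \<times> {-N..<N}" using k'R Z(1) unfolding R_def[symmetric] by blast
          show "Z2 \<union> ?k \<subseteq> {0..<w} \<times> {-N..<N}" using kR Z(2) unfolding R_def[symmetric] by blast
          show "- 1 - a < a" using a0 by simp
        qed simp
        then show "Z1 \<inter> Z2 \<noteq> {}" using disj Z(1,2) by blast
      qed
    qed auto
    moreover have "cpr (R - ?k') C' ?k = cpr (R - ?k) C ?k'"
    proof -
      have "inj flip" by (rule inj_on_inverseI[of _ flip]) simp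
      then have "flip ` (R - ?k) = R - ?k'" using rR by (simp add: image_set_diff)
      moreover have "flip ` ?k' = ?k" by (simp add: image_image)
      moreover have "finite (R - ?k)" using finR by simp
      ultimately show ?thesis using conn_prob_isometry[OF isometry_flip d, of "R - ?k" k p C ?k'] rC by simp
    qed
    ultimately have "(cpr (R - ?k) C ?k')\<^sup>2 \<le> Kc * cpr R C C'" by (simp add: power2_eq_square)
    then have "cpr (R - ?k) C ?k' \<le> ?s" by (rule real_le_rsqrt)
    then show ?thesis unfolding U_def using conn_prob_eq[OF finR(1), of "R - ?k" d k p C ?k'] by simp
  qed
  have T2: "bprob p ?E (\<lambda>\<omega>. conn \<omega> ?V1 ?A ?B \<and> U (least_path hh r ?V1 ?A ?B \<omega>) \<omega>) \<le> cpr Su A B * ?s"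
    if r: "r \<in> orders (ov R)" for r
  proof -
    let ?I = "simple_paths ?V1 ?A ?B ?E"
    let ?least_path = "least_path hh r ?V1 ?A ?B"
    have sub: "?V1 \<subseteq> ov R" by (rule slab_over_mono[OF SuR])
    have inj1: "inj_on hh ?V1" using hh sub inj_on_subset by blast
    have inj2: "inj_on (r v) ?V1" if "v \<in> ?V1" for v
      using orders_inj[OF r, of v] that sub inj_on_subset by blast
    have oc_mono: "simple_paths ?V1 ?A ?B \<omega> \<subseteq> ?I" if "\<omega> \<subseteq> ?E" for \<omega> using that by (auto simp: simple_paths_def)
    have finI: "finite ?I" by (rule finite_simple_paths[OF fin(2)])
    have one: "bprob p ?E (\<lambda>\<omega>. (conn \<omega> ?V1 ?A ?B \<and> U (?least_path \<omega>) \<omega>) \<and> ?least_path \<omega> = \<kappa>) \<le>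
        bprob p ?E (\<lambda>\<omega>. conn \<omega> ?V1 ?A ?B \<and> ?least_path \<omega> = \<kappa>) * ?s" if k: "\<kappa> \<in> ?I" for \<kappa>
    proof -
      define Y where "Y \<omega> \<longleftrightarrow> (\<forall>\<tau>\<in>simple_paths ?V1 ?A ?B \<omega>. \<not> key hh r \<tau> < key hh r \<kappa>)" for \<omega>
      have kin: "\<kappa> \<in> simple_paths ?V1 ?A ?B \<omega> \<longleftrightarrow> pedges \<kappa> \<subseteq> \<omega>" for \<omega> using k by (auto simp: simple_paths_def)
      have char: "(conn \<omega> ?V1 ?A ?B \<and> ?least_path \<omega> = \<kappa>) = (pedges \<kappa> \<subseteq> \<omega> \<and> Y \<omega>)" for \<omega>
      proof
        assume *: "conn \<omega> ?V1 ?A ?B \<and> ?least_path \<omega> = \<kappa>"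
        then have "\<kappa> \<in> simple_paths ?V1 ?A ?B \<omega>" using least_path_in[OF fin(2), of \<omega> ?A ?B hh r] by simp
        moreover have "Y \<omega>" unfolding Y_def using * least_path_min[OF fin(2), of _ ?A ?B \<omega> hh r] by (auto simp: not_less)
        ultimately show "pedges \<kappa> \<subseteq> \<omega> \<and> Y \<omega>" using kin by simp
      next
        assume *: "pedges \<kappa> \<subseteq> \<omega> \<and> Y \<omega>"
        then have "\<kappa> \<in> simple_paths ?V1 ?A ?B \<omega>" using kin by simp
        moreover from this have "conn \<omega> ?V1 ?A ?B" using conn_iff_simple_path by blast
        ultimately show "conn \<omega> ?V1 ?A ?B \<and> ?least_path \<omega> = \<kappa>"
          using * least_path_eqI[where R = r and h = hh, OF fin(2) _ inj1 inj2, of \<kappa> ?A ?B \<omega>] unfolding Y_def by blast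
      qed
      have "bprob p ?E (\<lambda>\<omega>. (conn \<omega> ?V1 ?A ?B \<and> U (?least_path \<omega>) \<omega>) \<and> ?least_path \<omega> = \<kappa>) =
         bprob p ?E (\<lambda>\<omega>. (pedges \<kappa> \<subseteq> \<omega> \<and> Y \<omega>) \<and> U \<kappa> \<omega>)"
        unfolding char[symmetric] by (intro bprob_cong) auto
      also have "\<dots> \<le> bprob p ?E (\<lambda>\<omega>. pedges \<kappa> \<subseteq> \<omega> \<and> Y \<omega>) * bprob p ?E (U \<kappa>)"
      proof (rule harris_given_open[OF fin(3) nonneg])
        show "pedges \<kappa> \<subseteq> ?E" using k by (auto simp: simple_paths_def)
        show "Y \<alpha>" if "\<alpha> \<subseteq> \<beta>" "Y \<beta>" for \<alpha> \<beta> using that unfolding Y_def simple_paths_def by blast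
        show "U \<kappa> \<beta>" if "\<alpha> \<subseteq> \<beta>" "U \<kappa> \<alpha>" for \<alpha> \<beta>
          unfolding U_def by (rule conn_mono[OF that(2)[unfolded U_def] that(1)]) simp_all
        fix \<omega>
        have "(\<omega> - pedges \<kappa>) \<inter> {e. e \<subseteq> ov (R - \<pi> ` set \<kappa>)} = \<omega> \<inter> {e. e \<subseteq> ov (R - \<pi> ` set \<kappa>)}"
        proof -
          have "\<not> e \<subseteq> ov (R - \<pi> ` set \<kappa>)" if e: "e \<in> pedges \<kappa>" for e
          proof -
            obtain v where "v \<in> e" "v \<in> set \<kappa>" using pedges_subset[OF e] pedges_nonempty[OF e] by blast
            then show ?thesis by (auto simp: slab_over_pi)
          qed
          then show ?thesis by auto
        qed
        then show "U \<kappa> \<omega> = U \<kappa> (\<omega> - pedges \<kappa>)" unfolding U_def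
          using conn_restrict[of \<omega> "ov (R - \<pi> ` set \<kappa>)"] conn_restrict[of "\<omega> - pedges \<kappa>" "ov (R - \<pi> ` set \<kappa>)"] by simp
      qed
      also have "\<dots> \<le> bprob p ?E (\<lambda>\<omega>. pedges \<kappa> \<subseteq> \<omega> \<and> Y \<omega>) * ?s"
        by (intro mult_left_mono U k bprob_nonneg nonneg)
      finally show ?thesis unfolding char .
    qed
    have "bprob p ?E (\<lambda>\<omega>. conn \<omega> ?V1 ?A ?B \<and> U (?least_path \<omega>) \<omega>) =
        (\<Sum>\<kappa>\<in>?I. bprob p ?E (\<lambda>\<omega>. (conn \<omega> ?V1 ?A ?B \<and> U (?least_path \<omega>) \<omega>) \<and> ?least_path \<omega> = \<kappa>))"
    proof (rule bprob_rec_sum[OF finI, symmetric])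
      fix \<omega> assume w: "\<omega> \<subseteq> ?E" "conn \<omega> ?V1 ?A ?B \<and> U (?least_path \<omega>) \<omega>"
      then show "?least_path \<omega> \<in> ?I" using least_path_in[OF fin(2), of \<omega> ?A ?B hh r] oc_mono[OF w(1)] by blast
    qed
    also have "\<dots> \<le> (\<Sum>\<kappa>\<in>?I. bprob p ?E (\<lambda>\<omega>. conn \<omega> ?V1 ?A ?B \<and> ?least_path \<omega> = \<kappa>) * ?s)"
      by (rule sum_mono) (rule one)
    also have "\<dots> \<le> bprob p ?E (\<lambda>\<omega>. conn \<omega> ?V1 ?A ?B) * ?s"
      unfolding sum_distrib_right[symmetric] by (intro mult_right_mono bprob_rec_sum_le nonneg finI s0)
    finally show ?thesis using conn_prob_eq[OF finR(1) SuR, of d k p A B] by simp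
  qed
  define T1 where "T1 r \<omega> \<longleftrightarrow> conn \<omega> ?V1 ?A ?B \<and>
       conn \<omega> (ov R) (ov D) {v. \<pi> v \<in> \<pi> ` set (least_path hh r ?V1 ?A ?B \<omega>)}" for r \<omega>
  have main: "cpr Su A B * cpr R C D \<le> bprob p ?E (T1 r) + cpr Su A B * ?s" if r: "r \<in> orders (ov R)" for r
  proof -
    let ?least_path = "least_path hh r ?V1 ?A ?B"
    have "cpr Su A B * cpr R C D \<le> bprob p ?E (\<lambda>\<omega>. conn \<omega> ?V1 ?A ?B \<and> conn \<omega> (ov R) (ov C) (ov D))"
      unfolding conn_prob_eq[OF finR(1) SuR] conn_prob_eq[OF finR(1) subset_refl]
      by (rule harris_bprob[OF fin(3) nonneg]) (erule (1) conn_mono; simp)+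
    also have "\<dots> \<le> bprob p ?E (\<lambda>\<omega>. T1 r \<omega> \<or> (conn \<omega> ?V1 ?A ?B \<and> U (?least_path \<omega>) \<omega>))"
    proof (rule bprob_mono[OF nonneg])
      fix \<omega> assume w: "\<omega> \<subseteq> ?E" and ev: "conn \<omega> ?V1 ?A ?B \<and> conn \<omega> (ov R) (ov C) (ov D)"
      define \<kappa> where "\<kappa> = ?least_path \<omega>"
      have "\<kappa> \<in> simple_paths ?V1 ?A ?B \<omega>" unfolding \<kappa>_def using least_path_in[OF fin(2)] ev by blast
      then have "\<kappa> \<in> simple_paths ?V1 ?A ?B ?E" using w by (auto simp: simple_paths_def)
      note sp = sel_path[OF this]
      let ?k = "\<pi> ` set \<kappa>"
      obtain a where a: "a1 \<le> a" "\<pi> (hd \<kappa>) = (0, a)" using sp(5) by blast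
      obtain x where x: "\<pi> (last \<kappa>) = (x, 0)" using sp(6) by blast
      from ev obtain xs where xs: "xs \<noteq> []" "set xs \<subseteq> ov R" "pedges xs \<subseteq> \<omega>" "hd xs \<in> ov C" "last xs \<in> ov D"
        unfolding conn_def by blast
      have xe: "pedges xs \<subseteq> slab_edges d k" using xs(3) w by (auto simp: edges_on_def)
      obtain xc where xc: "\<pi> (hd xs) = (xc, N - 1)" using xs(4) by (auto simp: C_def slab_over_pi)
      obtain y where y: "\<pi> (last xs) = (0, y)" "d1 \<le> y" "y < d2" using xs(5) by (auto simp: D_def slab_over_pi)
      have g: "lconn (\<pi> ` set xs) (0, y) (xc, N - 1)"
        using lconn_sym[OF pi_lconn[OF d xe xs(1)]] xc y by simp
      have k1: "lconn ?k (x, 0) (0, a)"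
        using lconn_sym[OF pi_lconn[OF d sp(3,4)]] a(2) x by simp
      have "lconn (flip ` ?k) (0, - 1 - a) (x, - 1)"
        using lconn_isometry[OF lconn_sym[OF k1] isometry_flip] by (simp add: flip_def)
      from lconn_join[OF this _ k1] have hp: "lconn (flip ` ?k \<union> ?k) (0, - 1 - a) (0, a)"
        by (simp add: nb_def)
      have "\<pi> ` set xs \<inter> (flip ` ?k \<union> ?k) \<noteq> {}"
      proof (rule crossing_wall[OF g _ hp])
        show "\<pi> ` set xs \<subseteq> {0..<w} \<times> {-N..<N}"
          using xs(2) unfolding R_def[symmetric] slab_over_pi by blast
        have "?k \<subseteq> R" using sp(2) SuR by blast
        then show "flip ` ?k \<union> ?k \<subseteq> {0..<w} \<times> {-N..<N}"
          using image_mono[of ?k R flip] rR unfolding R_def[symmetric] by simp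
        show "snd (0, - 1 - a) = -N \<or> fst (0 :: int, - 1 - a) = 0 \<and> snd (0 :: int, - 1 - a) < y" using a(1) y h by simp
        show "y < a" using a(1) y h by simp
      qed
      then consider "\<pi> ` set xs \<inter> ?k \<noteq> {}" | "\<pi> ` set xs \<inter> ?k = {}" "\<pi> ` set xs \<inter> flip ` ?k \<noteq> {}" by blast
      then show "T1 r \<omega> \<or> (conn \<omega> ?V1 ?A ?B \<and> U (?least_path \<omega>) \<omega>)"
      proof cases
        case 1
        then obtain z where z: "z \<in> \<pi> ` set xs" "z \<in> ?k" by blast
        from z(1) obtain v where v: "v \<in> set xs" "z = \<pi> v" by (rule imageE)
        have "reach \<omega> (ov R) (last xs) v" using xs v by (intro reach_list[OF xs(3,2)]) auto
        moreover have "last xs \<in> ov D \<inter> ov R" using xs(5) subsetD[OF xs(2) last_in_set[OF xs(1)]] by blast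
        moreover have "v \<in> {v. \<pi> v \<in> ?k}" using v z by simp
        ultimately have "conn \<omega> (ov R) (ov D) {v. \<pi> v \<in> ?k}" unfolding conn_iff_reach by blast
        then show ?thesis using ev by (simp add: T1_def \<kappa>_def)
      next
        case 2
        then obtain z where z: "z \<in> \<pi> ` set xs" "z \<in> flip ` ?k" by blast
        from z(1) obtain v where v: "v \<in> set xs" "z = \<pi> v" by (rule imageE)
        have xs': "set xs \<subseteq> ov (R - ?k)"
        proof
          fix s assume s: "s \<in> set xs"
          then have "\<pi> s \<notin> ?k" using 2(1) by blast
          then show "s \<in> ov (R - ?k)" using s xs(2) unfolding slab_over_pi by blast
        qed
        have "reach \<omega> (ov (R - ?k)) (hd xs) v" using xs v by (intro reach_list[OF xs(3) xs']) auto
        moreover have "hd xs \<in> ov C \<inter> ov (R - ?k)" using xs(4) subsetD[OF xs' hd_in_set[OF xs(1)]] by blast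
        moreover have "v \<in> ov (flip ` ?k)" using v z xs(2) unfolding slab_over_pi by blast
        ultimately have "U \<kappa> \<omega>" unfolding U_def conn_iff_reach by blast
        then show ?thesis using ev by (simp add: \<kappa>_def)
      qed
    qed
    also have "\<dots> \<le> bprob p ?E (T1 r) + bprob p ?E (\<lambda>\<omega>. conn \<omega> ?V1 ?A ?B \<and> U (?least_path \<omega>) \<omega>)"
      by (rule bprob_disj_le[OF nonneg])
    also have "\<dots> \<le> bprob p ?E (T1 r) + cpr Su A B * ?s" using T2[OF r] by simp
    finally show ?thesis .
  qed
  let ?n = "real (card (orders (ov R)))"
  have n: "?n > 0" using finite_orders[OF fin(1)] orders_nonempty[OF fin(1)] by (simp add: card_gt_0_iff)
  have "?n * (cpr Su A B * cpr R C D) = (\<Sum>r\<in>orders (ov R). cpr Su A B * cpr R C D)" by simp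
  also have "\<dots> \<le> (\<Sum>r\<in>orders (ov R). bprob p ?E (T1 r) + cpr Su A B * ?s)" by (rule sum_mono) (rule main)
  also have "\<dots> = (\<Sum>r\<in>orders (ov R). bprob p ?E (T1 r)) + ?n * (cpr Su A B * ?s)" by (simp add: sum.distrib)
  also have "(\<Sum>r\<in>orders (ov R). bprob p ?E (T1 r)) \<le> ?n * Kc * cpr R A D"
    unfolding T1_def by (rule gluing_slab[OF finR(1) SuR hh])
  finally have "?n * (cpr Su A B * cpr R C D) \<le> ?n * (Kc * cpr R A D + cpr Su A B * ?s)"
    by (simp add: algebra_simps)
  then show ?thesis using n by simp
qed

end

section \<open>From long crossings to wide crossings\<close>

text \<open>
  Discrete intermediate value theorem.
\<close>
lemma first_hit:
  fixes g :: "'a \<Rightarrow> int"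
  assumes "successively (\<lambda>u v. g v \<le> g u + 1) zs" "zs \<noteq> []" "g (hd zs) \<le> b" "\<exists>z\<in>set zs. b \<le> g z"
  shows "\<exists>us v ws. zs = us @ v # ws \<and> g v = b \<and> (\<forall>u\<in>set us. g u < b)"
proof -
  obtain us v ws where s: "zs = us @ v # ws" "b \<le> g v" "\<forall>u\<in>set us. \<not> b \<le> g u"
    using split_list_first_prop[OF assms(4)] by blast
  have "g v = b"
  proof (cases us rule: rev_cases)
    case Nil
    then show ?thesis using s assms(3) by simp
  next
    case (snoc us' u)
    then have "g v \<le> g u + 1" "\<not> b \<le> g u" using assms(1) s by (auto simp: successively_append_iff)
    then show ?thesis using s(2) by simp
  qed
  then show ?thesis using s by (intro exI[of _ us] exI[of _ v] exI[of _ ws]) auto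
qed

text \<open>
  The piece between the last visit to height a before the first visit to height b, and that first visit.
\<close>
lemma strip_crossing:
  fixes g :: "'a \<Rightarrow> int"
  assumes "successively (\<lambda>u v. \<bar>g u - g v\<bar> \<le> 1) zs" "zs \<noteq> []" "g (hd zs) \<le> a" "a \<le> b" "b \<le> g (last zs)"
  shows "\<exists>us vs ws. zs = us @ vs @ ws \<and> vs \<noteq> [] \<and> g (hd vs) = a \<and> g (last vs) = b \<and> (\<forall>v\<in>set vs. a \<le> g v \<and> g v \<le> b)"
proof -
  have "successively (\<lambda>u v. g v \<le> g u + 1) zs" by (rule successively_mono[OF assms(1)]) auto
  moreover have "\<exists>z\<in>set zs. b \<le> g z" using assms(2,5) by (intro bexI[of _ "last zs"]) auto
  ultimately obtain us v ws where s: "zs = us @ v # ws" "g v = b" "\<forall>u\<in>set us. g u < b"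
    using first_hit[of g zs b] assms(2,3,4) by auto
  have "\<exists>z\<in>set (us @ [v]). g z \<le> a"
    using s assms(2,3) by (intro bexI[of _ "hd zs"]) (cases us; auto)+
  then obtain p y q where q: "us @ [v] = p @ y # q" "g y \<le> a" "\<forall>z\<in>set q. \<not> g z \<le> a"
    using split_list_last_prop[of "us @ [v]" "\<lambda>z. g z \<le> a"] by blast
  have zs: "zs = p @ (y # q) @ ws" using s(1) arg_cong[OF q(1), of "\<lambda>l. l @ ws"] by simp
  have last: "last (y # q) = v" using arg_cong[OF q(1), of last] by simp
  have "g y = a"
  proof (cases q)
    case Nil
    then show ?thesis using last q(2) s(2) assms(4) by simp
  next
    case (Cons z q')
    then have "\<bar>g y - g z\<bar> \<le> 1" using assms(1) zs by (auto simp: successively_append_iff)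
    then show ?thesis using q(2,3) Cons by auto
  qed
  moreover have "g z \<le> b" if "z \<in> set (y # q)" for z
  proof -
    have "z \<in> set (us @ [v])" unfolding q(1) using that by auto
    then show ?thesis using s by auto
  qed
  ultimately show ?thesis using zs last s(2) q(3)
    by (intro exI[of _ p] exI[of _ "y # q"] exI[of _ ws]) (auto simp: not_le less_imp_le)
qed

lemma nb_coord: "nb u v \<Longrightarrow> \<bar>fst u - fst v\<bar> \<le> 1" "nb u v \<Longrightarrow> \<bar>snd u - snd v\<bar> \<le> 1"
  unfolding nb_def by linarith+

context slab_percolation
begin

lemma Kc_ge_1: "1 \<le> Kc"
  using p by (simp add: Kc_def)

lemma cpr_nonneg: "0 \<le> cpr Z A B"
  unfolding conn_prob_def by (intro bprob_nonneg nonneg)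

lemma cpr_le_1: "finite Z \<Longrightarrow> cpr Z A B \<le> 1"
  unfolding conn_prob_def by (intro bprob_le_1 nonneg finite_edges_on)

lemma cpr_iso:
  assumes "isometry \<phi>" "\<And>z. \<phi> (\<psi> z) = z" "\<And>z. \<psi> (\<phi> z) = z" "finite Z"
    and "\<And>z. z \<in> Z' \<longleftrightarrow> \<psi> z \<in> Z" "\<And>z. z \<in> A' \<longleftrightarrow> \<psi> z \<in> A" "\<And>z. z \<in> B' \<longleftrightarrow> \<psi> z \<in> B"
  shows "cpr Z' A' B' = cpr Z A B"
proof -
  have "\<phi> ` X = X'" if X: "\<And>z. z \<in> X' \<longleftrightarrow> \<psi> z \<in> X" for X X'
  proof
    show "\<phi> ` X \<subseteq> X'" by (rule image_subsetI) (simp only: X assms(3))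
    show "X' \<subseteq> \<phi> ` X"
    proof
      fix z assume "z \<in> X'"
      then have "\<psi> z \<in> X" using X by blast
      then have "\<phi> (\<psi> z) \<in> \<phi> ` X" by (rule imageI)
      then show "z \<in> \<phi> ` X" by (simp only: assms(2))
    qed
  qed
  then show ?thesis using conn_prob_isometry[OF assms(1) d assms(4), of k p A B] assms(5-7) by metis
qed

lemma cpr_shift:
  assumes "finite Z"
    and "\<And>x y. (x, y) \<in> Z' \<longleftrightarrow> (x - i, y - j) \<in> Z" "\<And>x y. (x, y) \<in> A' \<longleftrightarrow> (x - i, y - j) \<in> A" "\<And>x y. (x, y) \<in> B' \<longleftrightarrow> (x - i, y - j) \<in> B"
  shows "cpr Z' A' B' = cpr Z A B"
proof (rule cpr_iso[of "\<lambda>z. (fst z + i, snd z + j)" "\<lambda>z. (fst z - i, snd z - j)"])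
  show "isometry (\<lambda>z. (fst z + i, snd z + j))" by (simp add: isometry_def)
  show "z \<in> Z' \<longleftrightarrow> (fst z - i, snd z - j) \<in> Z" for z using assms(2)[of "fst z" "snd z"] by simp
  show "z \<in> A' \<longleftrightarrow> (fst z - i, snd z - j) \<in> A" for z using assms(3)[of "fst z" "snd z"] by simp
  show "z \<in> B' \<longleftrightarrow> (fst z - i, snd z - j) \<in> B" for z using assms(4)[of "fst z" "snd z"] by simp
qed (simp_all add: assms(1))

lemma cpr_swap:
  assumes "finite Z"
    and "\<And>x y. (x, y) \<in> Z' \<longleftrightarrow> (y - j, x - i) \<in> Z" "\<And>x y. (x, y) \<in> A' \<longleftrightarrow> (y - j, x - i) \<in> A" "\<And>x y. (x, y) \<in> B' \<longleftrightarrow> (y - j, x - i) \<in> B"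
  shows "cpr Z' A' B' = cpr Z A B"
proof (rule cpr_iso[of "\<lambda>z. (snd z + i, fst z + j)" "\<lambda>z. (snd z - j, fst z - i)"])
  show "isometry (\<lambda>z. (snd z + i, fst z + j))" by (simp add: isometry_def)
  show "z \<in> Z' \<longleftrightarrow> (snd z - j, fst z - i) \<in> Z" for z using assms(2)[of "fst z" "snd z"] by simp
  show "z \<in> A' \<longleftrightarrow> (snd z - j, fst z - i) \<in> A" for z using assms(3)[of "fst z" "snd z"] by simp
  show "z \<in> B' \<longleftrightarrow> (snd z - j, fst z - i) \<in> B" for z using assms(4)[of "fst z" "snd z"] by simp
qed (simp_all add: assms(1))

lemma cpr_mirror_x:
  assumes "finite Z"
    and "\<And>x y. (x, y) \<in> Z' \<longleftrightarrow> (i - x, y) \<in> Z" "\<And>x y. (x, y) \<in> A' \<longleftrightarrow> (i - x, y) \<in> A" "\<And>x y. (x, y) \<in> B' \<longleftrightarrow> (i - x, y) \<in> B"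
  shows "cpr Z' A' B' = cpr Z A B"
proof (rule cpr_iso[of "\<lambda>z. (i - fst z, snd z)" "\<lambda>z. (i - fst z, snd z)"])
  show "isometry (\<lambda>z. (i - fst z, snd z))" by (simp add: isometry_def abs_minus_commute)
  show "z \<in> Z' \<longleftrightarrow> (i - fst z, snd z) \<in> Z" for z using assms(2)[of "fst z" "snd z"] by simp
  show "z \<in> A' \<longleftrightarrow> (i - fst z, snd z) \<in> A" for z using assms(3)[of "fst z" "snd z"] by simp
  show "z \<in> B' \<longleftrightarrow> (i - fst z, snd z) \<in> B" for z using assms(4)[of "fst z" "snd z"] by simp
qed (simp_all add: assms(1))

lemma cpr_mirror_y:
  assumes "finite Z"
    and "\<And>x y. (x, y) \<in> Z' \<longleftrightarrow> (x, i - y) \<in> Z" "\<And>x y. (x, y) \<in> A' \<longleftrightarrow> (x, i - y) \<in> A" "\<And>x y. (x, y) \<in> B' \<longleftrightarrow> (x, i - y) \<in> B"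
  shows "cpr Z' A' B' = cpr Z A B"
proof (rule cpr_iso[of "\<lambda>z. (fst z, i - snd z)" "\<lambda>z. (fst z, i - snd z)"])
  show "isometry (\<lambda>z. (fst z, i - snd z))" by (simp add: isometry_def abs_minus_commute)
  show "z \<in> Z' \<longleftrightarrow> (fst z, i - snd z) \<in> Z" for z using assms(2)[of "fst z" "snd z"] by simp
  show "z \<in> A' \<longleftrightarrow> (fst z, i - snd z) \<in> A" for z using assms(3)[of "fst z" "snd z"] by simp
  show "z \<in> B' \<longleftrightarrow> (fst z, i - snd z) \<in> B" for z using assms(4)[of "fst z" "snd z"] by simp
qed (simp_all add: assms(1))

text \<open>
  Comparison of connection events by a statement about lists of sites alone: every path for the left side contains a piece for one of the events on the right.
\<close>
lemma cpr_subpaths: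
  assumes "finite Z" "finite I" "\<And>i. i \<in> I \<Longrightarrow> finite (F i)"
    and sub: "\<And>zs. zs \<noteq> [] \<Longrightarrow> successively nb zs \<Longrightarrow> set zs \<subseteq> Z \<Longrightarrow> hd zs \<in> A \<Longrightarrow> last zs \<in> B \<Longrightarrow>
      \<exists>i\<in>I. \<exists>us vs ws. zs = us @ vs @ ws \<and> vs \<noteq> [] \<and> set vs \<subseteq> F i \<and> hd vs \<in> G i \<and> last vs \<in> H i"
  shows "cpr Z A B \<le> (\<Sum>i\<in>I. cpr (F i) (G i) (H i))"
proof -
  let ?S = "Z \<union> (\<Union>i\<in>I. F i)"
  have fS: "finite ?S" using assms(1-3) by blast
  have "cpr Z A B = bprob p (edges_on d k ?S) (\<lambda>\<omega>. conn \<omega> (ov Z) (ov A) (ov B))" by (rule conn_prob_eq[OF fS]) blast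
  also have "\<dots> \<le> bprob p (edges_on d k ?S) (\<lambda>\<omega>. \<exists>i\<in>I. conn \<omega> (ov (F i)) (ov (G i)) (ov (H i)))"
  proof (rule bprob_mono[OF nonneg])
    fix \<omega> assume w: "\<omega> \<subseteq> edges_on d k ?S" "conn \<omega> (ov Z) (ov A) (ov B)"
    then obtain xs where xs: "xs \<noteq> []" "set xs \<subseteq> ov Z" "pedges xs \<subseteq> \<omega>" "hd xs \<in> ov A" "last xs \<in> ov B"
      unfolding conn_def by blast
    have xe: "pedges xs \<subseteq> slab_edges d k" using xs(3) w by (auto simp: edges_on_def)
    have "\<exists>i\<in>I. \<exists>us vs ws. map \<pi> xs = us @ vs @ ws \<and> vs \<noteq> [] \<and> set vs \<subseteq> F i \<and> hd vs \<in> G i \<and> last vs \<in> H i"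
    proof (rule sub)
      show "set (map \<pi> xs) \<subseteq> Z" using xs(2) by (auto simp: slab_over_pi)
      show "hd (map \<pi> xs) \<in> A" "last (map \<pi> xs) \<in> B" using xs by (auto simp: slab_over_pi hd_map last_map)
    qed (use xs(1) pi_path[OF d xe] in auto)
    then obtain i us vs ws where i: "i \<in> I" "map \<pi> xs = us @ vs @ ws" "vs \<noteq> []" "set vs \<subseteq> F i" "hd vs \<in> G i" "last vs \<in> H i"
      by blast
    obtain xs1 xs2 where x1: "xs = xs1 @ xs2" "map \<pi> xs2 = vs @ ws" using i(2) by (metis map_eq_append_conv)
    obtain ys xs3 where x2: "xs2 = ys @ xs3" "map \<pi> ys = vs" using x1(2) by (metis map_eq_append_conv)
    have ys: "ys \<noteq> []" using x2 i(3) by auto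
    have sl: "set ys \<subseteq> slab d k" using xs(2) x1 x2 by (auto simp: slab_over_def)
    have "successively (\<lambda>x y. {x, y} \<in> \<omega>) xs" using xs(3) by (simp add: successively_pedges)
    then have "successively (\<lambda>x y. {x, y} \<in> \<omega>) ys" unfolding x1(1) x2(1) by (simp add: successively_append_iff)
    then have "pedges ys \<subseteq> \<omega>" by (simp only: successively_pedges)
    moreover have "set ys \<subseteq> ov (F i)" using sl x2(2) i(4) by (auto simp: slab_over_pi)
    moreover have "hd ys \<in> ov (G i)"
      using sl i(5) ys hd_in_set[OF ys] unfolding x2(2)[symmetric] slab_over_pi by (auto simp: hd_map)
    moreover have "last ys \<in> ov (H i)"
      using sl i(6) ys last_in_set[OF ys] unfolding x2(2)[symmetric] slab_over_pi by (auto simp: last_map)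
    ultimately have "conn \<omega> (ov (F i)) (ov (G i)) (ov (H i))" unfolding conn_def using ys by blast
    then show "\<exists>i\<in>I. conn \<omega> (ov (F i)) (ov (G i)) (ov (H i))" using i(1) by blast
  qed
  also have "\<dots> \<le> (\<Sum>i\<in>I. bprob p (edges_on d k ?S) (\<lambda>\<omega>. conn \<omega> (ov (F i)) (ov (G i)) (ov (H i))))"
    by (rule bprob_Ex_le[OF nonneg assms(2)])
  also have "\<dots> = (\<Sum>i\<in>I. cpr (F i) (G i) (H i))"
  proof (rule sum.cong)
    fix i assume "i \<in> I"
    then show "bprob p (edges_on d k ?S) (\<lambda>\<omega>. conn \<omega> (ov (F i)) (ov (G i)) (ov (H i))) = cpr (F i) (G i) (H i)"
      by (intro conn_prob_eq[OF fS, symmetric]) blast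
  qed simp
  finally show ?thesis .
qed

lemma cpr_subpath:
  assumes "finite Z" "finite F"
    and "\<And>zs. zs \<noteq> [] \<Longrightarrow> successively nb zs \<Longrightarrow> set zs \<subseteq> Z \<Longrightarrow> hd zs \<in> A \<Longrightarrow> last zs \<in> B \<Longrightarrow>
      \<exists>us vs ws. zs = us @ vs @ ws \<and> vs \<noteq> [] \<and> set vs \<subseteq> F \<and> hd vs \<in> G \<and> last vs \<in> H"
  shows "cpr Z A B \<le> cpr F G H"
proof -
  have "cpr Z A B \<le> (\<Sum>i\<in>{()}. cpr F G H)"
  proof (rule cpr_subpaths[OF assms(1)])
    fix zs assume "zs \<noteq> []" "successively nb zs" "set zs \<subseteq> Z" "hd zs \<in> A" "last zs \<in> B"
    from assms(3)[OF this] show "\<exists>i\<in>{()}. \<exists>us vs ws. zs = us @ vs @ ws \<and> vs \<noteq> [] \<and> set vs \<subseteq> F \<and> hd vs \<in> G \<and> last vs \<in> H"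
      by blast
  qed (simp_all add: assms(2))
  then show ?thesis by simp
qed

lemma cpr_mono:
  assumes "finite Z'" "Z \<subseteq> Z'" "A \<subseteq> A'" "B \<subseteq> B'"
  shows "cpr Z A B \<le> cpr Z' A' B'"
proof (rule cpr_subpath[OF finite_subset[OF assms(2,1)] assms(1)])
  fix zs assume "zs \<noteq> []" "set zs \<subseteq> Z" "hd zs \<in> A" "last zs \<in> B"
  then show "\<exists>us vs ws. zs = us @ vs @ ws \<and> vs \<noteq> [] \<and> set vs \<subseteq> Z' \<and> hd vs \<in> A' \<and> last vs \<in> B'"
    using assms by (intro exI[of _ "[]"] exI[of _ zs]) auto
qed

definition lr :: "int \<Rightarrow> int \<Rightarrow> real" where
  "lr w h = cpr ({0..<w} \<times> {0..<h}) ({0} \<times> {0..<h}) ({w - 1} \<times> {0..<h})"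

lemma lr_mono: "h \<le> h' \<Longrightarrow> lr w h \<le> lr w h'"
  unfolding lr_def by (rule cpr_mono) auto

lemma lr_vertical:
  "cpr ({x..<x + h} \<times> {y..<y + w}) ({x..<x + h} \<times> {y}) ({x..<x + h} \<times> {y + w - 1}) = lr w h"
  unfolding lr_def by (rule cpr_swap[where i = x and j = y]) auto

text \<open>
  Let q be the probability on the left. In the square of side 43n a horizontal crossing and a vertical crossing of its right part, starting in the right half of the bottom, give a path from the left side to the right half of the bottom, at the price of one gluing. The mirror image in the vertical axis of the box of width 44n is a path from the right side to the left half of the bottom. The two paths meet, and another gluing produces the wide crossing.
\<close>
lemma lr_square:
  fixes n :: int
  assumes n: "n \<ge> 1"
  shows "lr (43 * n) (41 * n) ^ 4 \<le> 4 * Kc ^ 3 * lr (44 * n) (43 * n)"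
proof -
  define q where "q = lr (43 * n) (41 * n)"
  have q0: "0 \<le> q" by (simp add: q_def lr_def cpr_nonneg)
  define S where "S = {0..<43 * n} \<times> {0..<43 * n}"
  define S2 where "S2 = {n..<43 * n} \<times> {0..<43 * n}"
  define L where "L = {0 :: int} \<times> {0..<43 * n}"
  define top where "top = {n..<43 * n} \<times> {43 * n - 1}"
  define br where "br = {22 * n..<43 * n} \<times> {0 :: int}"
  define bl where "bl = {n..<22 * n} \<times> {0 :: int}"
  have fin: "finite S" "finite S2" by (auto simp: S_def S2_def)
  have H: "q \<le> cpr S L ({43 * n - 1} \<times> {0..<43 * n})"
    unfolding q_def using lr_mono[of "41 * n" "43 * n" "43 * n"] n by (simp add: lr_def S_def L_def)
  have "q \<le> lr (43 * n) (42 * n)" unfolding q_def using n by (intro lr_mono) auto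
  also have "\<dots> = cpr S2 ({n..<43 * n} \<times> {0}) top"
    using lr_vertical[of n "42 * n" 0 "43 * n"] by (simp add: S2_def top_def)
  also have "\<dots> \<le> (\<Sum>b\<in>{False, True}. cpr S2 (if b then br else bl) top)"
  proof (rule cpr_subpaths[of S2 "{False, True}" "\<lambda>_. S2"])
    fix zs assume zs: "zs \<noteq> []" "set zs \<subseteq> S2" "hd zs \<in> {n..<43 * n} \<times> {0}" "last zs \<in> top"
    have "hd zs \<in> bl \<or> hd zs \<in> br" using zs(3) by (auto simp: br_def bl_def)
    then show "\<exists>i\<in>{False, True}. \<exists>us vs ws. zs = us @ vs @ ws \<and> vs \<noteq> [] \<and> set vs \<subseteq> S2 \<and>
        hd vs \<in> (if i then br else bl) \<and> last vs \<in> top"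
      using zs by (intro bexI[of _ "hd zs \<in> br"] exI[of _ "[]"] exI[of _ zs]) auto
  qed (use fin in auto)
  also have "\<dots> = cpr S2 br top + cpr S2 bl top" by simp
  also have "cpr S2 bl top = cpr S2 br top"
    using fin by (intro cpr_mirror_x[where i = "44 * n - 1"]) (auto simp: S2_def bl_def br_def top_def)
  finally have V: "q / 2 \<le> cpr S2 br top" by simp
  define a where "a = cpr S L br"
  have a0: "0 \<le> a" by (simp add: a_def cpr_nonneg)
  have "cpr S L ({43 * n - 1} \<times> {0..<43 * n}) * cpr S2 br top \<le> Kc * a"
    unfolding a_def
  proof (rule gluing_meet[OF fin(1) subset_refl])
    show "S2 \<subseteq> S" using n by (auto simp: S_def S2_def)
    show "meets S L ({43 * n - 1} \<times> {0..<43 * n}) S2 br top" unfolding meets_def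
    proof (intro allI impI)
      fix Z1 Z2 u v u' v'
      assume Z: "Z1 \<subseteq> S" "Z2 \<subseteq> S2" "u \<in> L" "v \<in> {43 * n - 1} \<times> {0..<43 * n}" "u' \<in> br" "v' \<in> top" "lconn Z1 u v" "lconn Z2 u' v'"
      show "Z1 \<inter> Z2 \<noteq> {}"
        by (rule crossing[OF Z(7) _ _ _ Z(8), of 0 "43 * n - 1" n "43 * n - 1"])
          (use Z n in \<open>auto simp: S_def S2_def L_def br_def top_def\<close>)
    qed
  qed
  moreover have "q * (q / 2) \<le> cpr S L ({43 * n - 1} \<times> {0..<43 * n}) * cpr S2 br top"
    using H V q0 by (intro mult_mono) auto
  ultimately have qa: "q\<^sup>2 / 2 \<le> Kc * a" by (simp add: power2_eq_square)
  define S' where "S' = {n..<44 * n} \<times> {0..<43 * n}"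
  define T where "T = {0..<44 * n} \<times> {0..<43 * n}"
  define L' where "L' = {44 * n - 1} \<times> {0..<43 * n}"
  have a': "cpr S' L' bl = a" unfolding a_def
    using fin by (intro cpr_mirror_x[where i = "44 * n - 1"]) (auto simp: S_def S'_def L_def L'_def bl_def br_def)
  have "cpr S L br * cpr S' L' bl \<le> Kc * cpr T L L'"
  proof (rule gluing_meet)
    show "S \<subseteq> T" "S' \<subseteq> T" using n by (auto simp: S_def S'_def T_def)
    then have ST: "S \<subseteq> T" "S' \<subseteq> T" .
    show "meets S L br S' L' bl" unfolding meets_def
    proof (intro allI impI)
      fix Z1 Z2 u v u' v'
      assume Z: "Z1 \<subseteq> S" "Z2 \<subseteq> S'" "u \<in> L" "v \<in> br" "u' \<in> L'" "v' \<in> bl" "lconn Z1 u v" "lconn Z2 u' v'"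
      obtain yu xv yu' xv' where c: "u = (0, yu)" "v = (xv, 0)" "u' = (44 * n - 1, yu')" "v' = (xv', 0)" "22 * n \<le> xv" "xv' < 22 * n"
        using Z(3-6) by (auto simp: L_def br_def L'_def bl_def)
      show "Z1 \<inter> Z2 \<noteq> {}"
        by (rule crossing_corners[OF Z(7)[unfolded c] _ Z(8)[unfolded c]])
          (use Z(1,2) ST c(5,6) in \<open>auto simp: T_def\<close>)
    qed
  qed (simp add: T_def)
  also have "cpr T L L' = lr (44 * n) (43 * n)" by (simp add: lr_def T_def L_def L'_def)
  finally have aa: "a\<^sup>2 \<le> Kc * lr (44 * n) (43 * n)" unfolding a' a_def[symmetric] by (simp add: power2_eq_square)
  have "(q\<^sup>2 / 2)\<^sup>2 \<le> (Kc * a)\<^sup>2" using qa by (intro power_mono) auto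
  also have "\<dots> = Kc\<^sup>2 * a\<^sup>2" by (simp add: power_mult_distrib)
  also have "\<dots> \<le> Kc\<^sup>2 * (Kc * lr (44 * n) (43 * n))" using aa by (intro mult_left_mono) auto
  finally have "q ^ 4 / 4 \<le> Kc ^ 3 * lr (44 * n) (43 * n)"
    by (simp add: power_divide power2_eq_square power3_eq_cube power4_eq_xxxx mult.assoc)
  then show ?thesis by (simp add: q_def)
qed

text \<open>
  A block of length n on the left wall is connected, inside the strip of width 43n, to the level b blocks above it, without going further than b blocks down.
\<close>
definition up_prob :: "int \<Rightarrow> int \<Rightarrow> real" where
  "up_prob n b = cpr ({0..<43 * n} \<times> {- b * n..<(b + 1) * n}) ({0} \<times> {0..<n}) ({0..<43 * n} \<times> {(b + 1) * n - 1})"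

text \<open>
  The left end of the crossing lies in one of 44 blocks. Consider the window reaching b blocks beyond this block in both directions. Either the path reaches the top or the bottom of the window, and both cases are equally likely by reflection, or it crosses inside the window.
\<close>
lemma lr_le_up:
  fixes n b :: int
  assumes n: "n \<ge> 1" and b: "1 \<le> b"
  shows "lr (43 * n) (44 * n) \<le> 88 * up_prob n b + 44 * lr (43 * n) ((2 * b + 1) * n)"
proof -
  let ?I = "{0..<44 :: int} \<times> {0, 1, 2 :: nat}"
  define W where "W j = {0..<43 * n} \<times> {(j - b) * n..<(j + b + 1) * n}" for j
  define blk where "blk j = {0 :: int} \<times> {j * n..<(j + 1) * n}" for j
  define G where "G j t = (if t = 2 then {0} \<times> {(j - b) * n..<(j + b + 1) * n} else blk j)" for j and t :: nat
  define H where "H j t = (if t = 0 then {0..<43 * n} \<times> {(j + b + 1) * n - 1} else if t = 1 then {0..<43 * n} \<times> {(j - b) * n}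
     else {43 * n - 1} \<times> {(j - b) * n..<(j + b + 1) * n})" for j and t :: nat
  have "lr (43 * n) (44 * n) \<le> (\<Sum>i\<in>?I. cpr (W (fst i)) (G (fst i) (snd i)) (H (fst i) (snd i)))"
    unfolding lr_def
  proof (rule cpr_subpaths)
    fix zs :: "site list"
    assume zs: "zs \<noteq> []" "successively nb zs" "set zs \<subseteq> {0..<43 * n} \<times> {0..<44 * n}"
      "hd zs \<in> {0} \<times> {0..<44 * n}" "last zs \<in> {43 * n - 1} \<times> {0..<44 * n}"
    define j where "j = snd (hd zs) div n"
    have y: "0 \<le> snd (hd zs)" "snd (hd zs) < 44 * n" "fst (hd zs) = 0" using zs(4) by (auto simp: mem_Times_iff)
    have j1: "j * n \<le> snd (hd zs)" "snd (hd zs) < (j + 1) * n"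
    proof -
      have "n * j + snd (hd zs) mod n = snd (hd zs)" unfolding j_def by (rule mult_div_mod_eq)
      moreover have "0 \<le> snd (hd zs) mod n" "snd (hd zs) mod n < n" using n by auto
      ultimately show "j * n \<le> snd (hd zs)" "snd (hd zs) < (j + 1) * n" by (simp_all add: algebra_simps)
    qed
    have "0 \<le> j" using y n by (simp add: j_def pos_imp_zdiv_nonneg_iff)
    moreover have "j < 44"
    proof (rule ccontr)
      assume "\<not> j < 44"
      then have "44 * n \<le> j * n" using n by (intro mult_right_mono) auto
      then show False using j1 y by linarith
    qed
    ultimately have j: "j \<in> {0..<44}" by simp
    have bn: "n \<le> b * n" using n b by simp
    have hb: "hd zs \<in> blk j" using y j1 by (simp add: blk_def mem_Times_iff)
    have bounds: "(j - b) * n < snd (hd zs)" "snd (hd zs) < (j + b + 1) * n - 1"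
      using j1 bn n unfolding left_diff_distrib distrib_right mult_1 by linarith+
    let ?P = "\<lambda>z. (j + b + 1) * n - 1 \<le> snd z \<or> snd z \<le> (j - b) * n"
    have xr: "0 \<le> fst z \<and> fst z < 43 * n" if "z \<in> set zs" for z
      using subsetD[OF zs(3) that] by (simp add: mem_Times_iff)
    have concl: "\<exists>i\<in>?I. \<exists>us vs ws. zs = us @ vs @ ws \<and> vs \<noteq> [] \<and> set vs \<subseteq> W (fst i) \<and>
        hd vs \<in> G (fst i) (snd i) \<and> last vs \<in> H (fst i) (snd i)"
      if t: "t \<in> {0, 1, 2}" and c: "zs = us @ vs @ ws" "vs \<noteq> []" "set vs \<subseteq> W j" "hd vs \<in> G j t" "last vs \<in> H j t"
      for t us vs ws
    proof -
      have "\<exists>us vs ws. zs = us @ vs @ ws \<and> vs \<noteq> [] \<and> set vs \<subseteq> W (fst (j, t)) \<and>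
        hd vs \<in> G (fst (j, t)) (snd (j, t)) \<and> last vs \<in> H (fst (j, t)) (snd (j, t))"
        unfolding fst_conv snd_conv using c by blast
      moreover have "(j, t) \<in> ?I" using j t by simp
      ultimately show ?thesis by blast
    qed
    show "\<exists>i\<in>?I. \<exists>us vs ws. zs = us @ vs @ ws \<and> vs \<noteq> [] \<and> set vs \<subseteq> W (fst i) \<and>
        hd vs \<in> G (fst i) (snd i) \<and> last vs \<in> H (fst i) (snd i)"
    proof (cases "\<exists>z\<in>set zs. ?P z")
      case True
      then obtain us v ws where s: "zs = us @ v # ws" "?P v" "\<forall>u\<in>set us. \<not> ?P u"
        using split_list_first_prop[of zs ?P] by blast
      have "us \<noteq> []"
      proof
        assume "us = []"
        then show False using s(1,2) bounds by simp
      qed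
      then obtain us' u where us: "us = us' @ [u]" by (cases us rule: rev_cases) auto
      have "nb u v" using zs(2) s(1) us by (simp add: successively_append_iff)
      then have uv: "\<bar>snd u - snd v\<bar> \<le> 1" by (rule nb_coord)
      have u: "snd u < (j + b + 1) * n - 1" "(j - b) * n < snd u" using s(3) us by auto
      have hd: "hd (us @ [v]) = hd zs" unfolding s(1) using \<open>us \<noteq> []\<close> by simp
      have sub: "set (us @ [v]) \<subseteq> W j"
      proof
        fix z assume z: "z \<in> set (us @ [v])"
        then have "0 \<le> fst z \<and> fst z < 43 * n" using xr[of z] s(1) by auto
        moreover have "(j - b) * n \<le> snd z \<and> snd z < (j + b + 1) * n"
        proof (cases "z = v")
          case True
          show ?thesis unfolding True using u uv by linarith
        next
          case False
          then have "\<not> ?P z" using z s(3) by simp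
          then show ?thesis by simp
        qed
        ultimately show "z \<in> W j" by (simp add: W_def mem_Times_iff)
      qed
      have vx: "0 \<le> fst v \<and> fst v < 43 * n" using xr[of v] s(1) by simp
      have "snd v = (j + b + 1) * n - 1 \<or> snd v = (j - b) * n" using s(2) u uv by linarith
      then consider "snd v = (j + b + 1) * n - 1" | "snd v = (j - b) * n" by blast
      then show ?thesis
      proof cases
        case 1
        then have "v \<in> H j 0" using vx by (simp add: H_def mem_Times_iff)
        then show ?thesis using s(1) sub hd hb by (intro concl[of 0 "[]" "us @ [v]" ws]) (auto simp: G_def)
      next
        case 2
        then have "v \<in> H j 1" using vx by (simp add: H_def mem_Times_iff)
        then show ?thesis using s(1) sub hd hb by (intro concl[of 1 "[]" "us @ [v]" ws]) (auto simp: G_def)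
      qed
    next
      case False
      have in_win: "(j - b) * n \<le> snd z \<and> snd z < (j + b + 1) * n" if "z \<in> set zs" for z
      proof -
        from False that have "\<not> ?P z" by blast
        then show ?thesis by simp
      qed
      have "set zs \<subseteq> W j"
      proof
        fix z assume "z \<in> set zs"
        then show "z \<in> W j" using in_win[of z] xr[of z] by (simp add: W_def mem_Times_iff)
      qed
      moreover have "hd zs \<in> G j 2" using in_win[OF hd_in_set[OF zs(1)]] y by (simp add: G_def mem_Times_iff)
      moreover have "last zs \<in> H j 2" using in_win[OF last_in_set[OF zs(1)]] zs(5) by (simp add: H_def mem_Times_iff)
      ultimately show ?thesis using zs(1) by (intro concl[of 2 "[]" zs "[]"]) auto
    qed
  qed (auto simp: W_def)
  also have "\<dots> = (\<Sum>j\<in>{0..<44}. \<Sum>t\<in>{0, 1, 2}. cpr (W j) (G j t) (H j t))"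
    unfolding sum.cartesian_product case_prod_unfold by (rule refl)
  also have "\<dots> = (\<Sum>j\<in>{0..<44 :: int}. 2 * up_prob n b + lr (43 * n) ((2 * b + 1) * n))"
  proof (rule sum.cong)
    fix j :: int
    have 0: "cpr (W j) (G j 0) (H j 0) = up_prob n b"
      unfolding up_prob_def by (rule cpr_shift[where i = 0 and j = "j * n"]) (auto simp: W_def G_def H_def blk_def algebra_simps)
    have 1: "cpr (W j) (G j 1) (H j 1) = up_prob n b"
      unfolding up_prob_def by (rule cpr_mirror_y[where i = "(j + 1) * n - 1"]) (auto simp: W_def G_def H_def blk_def algebra_simps)
    have 2: "cpr (W j) (G j 2) (H j 2) = lr (43 * n) ((2 * b + 1) * n)"
      unfolding lr_def by (rule cpr_shift[where i = 0 and j = "(j - b) * n"]) (auto simp: W_def G_def H_def algebra_simps)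
    show "(\<Sum>t\<in>{0, 1, 2}. cpr (W j) (G j t) (H j t)) = 2 * up_prob n b + lr (43 * n) ((2 * b + 1) * n)"
      using 0 1 2 by simp
  qed simp
  also have "\<dots> = 88 * up_prob n b + 44 * lr (43 * n) ((2 * b + 1) * n)" by simp
  finally show ?thesis .
qed

text \<open>
  The blocks 0 and l of the left wall are connected inside the strip of width 43n, between the levels -hn and hn.
\<close>
definition arc_prob :: "int \<Rightarrow> int \<Rightarrow> int \<Rightarrow> real" where
  "arc_prob n h l = cpr ({0..<43 * n} \<times> {- h * n..<h * n}) ({0} \<times> {0..<n}) ({0} \<times> {l * n..<(l + 1) * n})"

text \<open>
  The arc from block 0 to block l and its translate from block l - 1 to block 2l - 1 are interlaced, hence meet; gluing connects the outer ends.
\<close>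
lemma arc_double:
  fixes n h l :: int
  assumes n: "n \<ge> 1" and l: "l \<ge> 2"
  shows "(arc_prob n h l)\<^sup>2 \<le> Kc * arc_prob n (h + l) (2 * l - 1)"
proof -
  define S where "S = {0..<43 * n} \<times> {- (h + l) * n..<(h + l) * n}"
  define S1 where "S1 = {0..<43 * n} \<times> {- h * n..<h * n}"
  define S2 where "S2 = {0..<43 * n} \<times> {(l - 1 - h) * n..<(l - 1 + h) * n}"
  define blk where "blk j = {0 :: int} \<times> {j * n..<(j + 1) * n}" for j
  have sub: "S1 \<subseteq> S" "S2 \<subseteq> S"
  proof -
    have "h * n \<le> (h + l) * n" "(l - 1 + h) * n \<le> (h + l) * n" "- (h + l) * n \<le> - h * n" "- (h + l) * n \<le> (l - 1 - h) * n"
      using n l by (intro mult_right_mono; simp)+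
    note le = this
    show "S1 \<subseteq> S"
    proof
      fix z assume "z \<in> S1"
      then show "z \<in> S" using le unfolding S_def S1_def mem_Times_iff atLeastLessThan_iff by linarith
    qed
    show "S2 \<subseteq> S"
    proof
      fix z assume "z \<in> S2"
      then show "z \<in> S" using le unfolding S_def S2_def mem_Times_iff atLeastLessThan_iff by linarith
    qed
  qed
  have "cpr S1 (blk 0) (blk l) * cpr S2 (blk (2 * l - 1)) (blk (l - 1)) \<le> Kc * cpr S (blk 0) (blk (2 * l - 1))"
  proof (rule gluing_meet[OF _ sub])
    show "meets S1 (blk 0) (blk l) S2 (blk (2 * l - 1)) (blk (l - 1))" unfolding meets_def
    proof (intro allI impI)
      fix Z1 Z2 u v u' v'
      assume Z: "Z1 \<subseteq> S1" "Z2 \<subseteq> S2" "u \<in> blk 0" "v \<in> blk l" "u' \<in> blk (2 * l - 1)" "v' \<in> blk (l - 1)" "lconn Z1 u v" "lconn Z2 u' v'"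
      obtain s1 e1 e2 s2 where c: "u = (0, s1)" "v = (0, e1)" "u' = (0, e2)" "v' = (0, s2)"
        "s1 < n" "l * n \<le> e1" "e1 < (l + 1) * n" "(2 * l - 1) * n \<le> e2" "(l - 1) * n \<le> s2" "s2 < l * n"
        using Z(3-6) by (auto simp: blk_def)
      have "1 * n \<le> (l - 1) * n" "(l + 1) * n \<le> (2 * l - 1) * n" using n l by (auto intro!: mult_right_mono)
      then have o: "s1 < s2" "s2 < e1" "e1 < e2" using c(5-10) by linarith+
      show "Z1 \<inter> Z2 \<noteq> {}"
        by (rule crossing_arcs[OF Z(7)[unfolded c] _ lconn_sym[OF Z(8)[unfolded c]] _ o])
          (use Z(1,2) sub in \<open>auto simp: S_def\<close>)
    qed
  qed (simp add: S_def)
  moreover have "cpr S1 (blk 0) (blk l) = arc_prob n h l" by (simp add: arc_prob_def S1_def blk_def)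
  moreover have "cpr S (blk 0) (blk (2 * l - 1)) = arc_prob n (h + l) (2 * l - 1)" by (simp add: arc_prob_def S_def blk_def)
  moreover have "cpr S2 (blk (2 * l - 1)) (blk (l - 1)) = arc_prob n h l"
  proof -
    have "cpr S2 (blk (2 * l - 1)) (blk (l - 1)) = cpr S2 (blk (l - 1)) (blk (2 * l - 1))" by (rule conn_prob_sym)
    also have "\<dots> = arc_prob n h l" unfolding arc_prob_def
      by (rule cpr_shift[where i = 0 and j = "(l - 1) * n"]) (auto simp: S2_def blk_def algebra_simps)
    finally show ?thesis .
  qed
  ultimately show ?thesis by (simp add: power2_eq_square)
qed

text \<open>
  The arc passes from below level n to above level 45n, hence contains a vertical crossing of a box of height 44n. Exchanging the axes turns it into a horizontal crossing.
\<close>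
lemma arc_le_lr:
  fixes n :: int
  assumes n: "n \<ge> 1" and l: "l \<ge> 45"
  shows "arc_prob n h l \<le> lr (44 * n) (43 * n)"
proof -
  have "arc_prob n h l \<le> cpr ({0..<43 * n} \<times> {n..<n + 44 * n}) ({0..<43 * n} \<times> {n}) ({0..<43 * n} \<times> {n + 44 * n - 1})"
    unfolding arc_prob_def
  proof (rule cpr_subpath)
    fix zs :: "site list"
    assume zs: "zs \<noteq> []" "successively nb zs" "set zs \<subseteq> {0..<43 * n} \<times> {- h * n..<h * n}"
      "hd zs \<in> {0} \<times> {0..<n}" "last zs \<in> {0} \<times> {l * n..<(l + 1) * n}"
    have "successively (\<lambda>u v. \<bar>snd u - snd v\<bar> \<le> 1) zs" by (rule successively_mono[OF zs(2)]) (rule nb_coord)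
    moreover have "snd (hd zs) \<le> n" "n \<le> 45 * n - 1" using zs(4) n by (auto simp: mem_Times_iff)
    moreover have "45 * n \<le> l * n" using l n by (intro mult_right_mono) auto
    then have "45 * n - 1 \<le> snd (last zs)" using zs(5) by (auto simp: mem_Times_iff)
    ultimately obtain us vs ws where s: "zs = us @ vs @ ws" "vs \<noteq> []" "snd (hd vs) = n" "snd (last vs) = 45 * n - 1"
      "\<forall>v\<in>set vs. n \<le> snd v \<and> snd v \<le> 45 * n - 1"
      using strip_crossing[of snd zs n "45 * n - 1"] zs(1) by blast
    have xr: "0 \<le> fst v \<and> fst v < 43 * n" if "v \<in> set vs" for v
    proof -
      have "v \<in> {0..<43 * n} \<times> {- h * n..<h * n}" using that zs(3) s(1) by auto
      then show ?thesis by (simp add: mem_Times_iff)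
    qed
    have "set vs \<subseteq> {0..<43 * n} \<times> {n..<n + 44 * n}"
    proof
      fix z assume z: "z \<in> set vs"
      then have "n \<le> snd z \<and> snd z \<le> 45 * n - 1" using s(5) by blast
      then show "z \<in> {0..<43 * n} \<times> {n..<n + 44 * n}" using xr[OF z] by (simp add: mem_Times_iff)
    qed
    moreover have "hd vs \<in> {0..<43 * n} \<times> {n}" using xr[OF hd_in_set[OF s(2)]] s(3) by (simp add: mem_Times_iff)
    moreover have "last vs \<in> {0..<43 * n} \<times> {n + 44 * n - 1}" using xr[OF last_in_set[OF s(2)]] s(4) by (simp add: mem_Times_iff)
    ultimately have "zs = us @ vs @ ws \<and> vs \<noteq> [] \<and> set vs \<subseteq> {0..<43 * n} \<times> {n..<n + 44 * n} \<and>
        hd vs \<in> {0..<43 * n} \<times> {n} \<and> last vs \<in> {0..<43 * n} \<times> {n + 44 * n - 1}"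
      using s(1,2) by (intro conjI)
    then show "\<exists>us vs ws. zs = us @ vs @ ws \<and> vs \<noteq> [] \<and> set vs \<subseteq> {0..<43 * n} \<times> {n..<n + 44 * n} \<and>
        hd vs \<in> {0..<43 * n} \<times> {n} \<and> last vs \<in> {0..<43 * n} \<times> {n + 44 * n - 1}"
      by (intro exI)
  qed auto
  also have "\<dots> = lr (44 * n) (43 * n)" using lr_vertical[of 0 "43 * n" n "44 * n"] by simp
  finally show ?thesis .
qed

lemma arc_power:
  fixes n :: int
  assumes n: "n \<ge> 1"
  shows "arc_prob n 23 9 ^ 8 \<le> Kc ^ 7 * lr (44 * n) (43 * n)"
proof -
  have a0: "0 \<le> arc_prob n h l" for h l by (simp add: arc_prob_def cpr_nonneg)
  have K0: "0 \<le> Kc" using Kc_ge_1 by simp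
  have 1: "(arc_prob n 23 9)\<^sup>2 \<le> Kc * arc_prob n 32 17" using arc_double[OF n, of 9 23] by simp
  have 2: "(arc_prob n 32 17)\<^sup>2 \<le> Kc * arc_prob n 49 33" using arc_double[OF n, of 17 32] by simp
  have 3: "(arc_prob n 49 33)\<^sup>2 \<le> Kc * arc_prob n 82 65" using arc_double[OF n, of 33 49] by simp
  have "arc_prob n 23 9 ^ 8 = ((arc_prob n 23 9)\<^sup>2) ^ 4" by simp
  also have "\<dots> \<le> (Kc * arc_prob n 32 17) ^ 4" using 1 by (intro power_mono) auto
  also have "\<dots> = Kc ^ 4 * ((arc_prob n 32 17)\<^sup>2)\<^sup>2" by (simp add: power_mult_distrib)
  also have "\<dots> \<le> Kc ^ 4 * (Kc * arc_prob n 49 33)\<^sup>2" using 2 K0 by (intro mult_left_mono power_mono) auto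
  also have "\<dots> = Kc ^ 6 * (arc_prob n 49 33)\<^sup>2" by (simp add: power_mult_distrib flip: mult.assoc power_add)
  also have "\<dots> \<le> Kc ^ 6 * (Kc * arc_prob n 82 65)" using 3 K0 by (intro mult_left_mono) auto
  also have "\<dots> = Kc ^ 7 * arc_prob n 82 65" by (simp add: power_Suc2[of Kc 6, symmetric] flip: mult.assoc)
  also have "\<dots> \<le> Kc ^ 7 * lr (44 * n) (43 * n)" using K0 by (intro mult_left_mono arc_le_lr[OF n]) auto
  finally show ?thesis .
qed

text \<open>
  Apply \<open>reflection\<close> to the strip of width 43n between the levels -22n and 22n: A is block 10, connected down to level 0, and D is block 1, connected up to level 22n. The first term of the bound is an arc over 9 blocks, the second one contains the probability of a vertical crossing of height 44n.
\<close>
lemma up_dichotomy: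
  fixes n :: int
  assumes n: "n \<ge> 1" and v: "0 < v" "v \<le> up_prob n 10" "v \<le> up_prob n 20"
  shows "v\<^sup>2 \<le> 4 * Kc * lr (44 * n) (43 * n) \<or> v\<^sup>2 \<le> 2 * Kc * arc_prob n 23 9"
proof -
  define R where "R = {0..<43 * n} \<times> {- (22 * n)..<22 * n}"
  define Su where "Su = {0..<43 * n} \<times> {0..<22 * n}"
  define A where "A = {0 :: int} \<times> {10 * n..<11 * n}"
  define D where "D = {0 :: int} \<times> {n..<2 * n}"
  define B where "B = {0..<43 * n} \<times> {0 :: int}"
  define C where "C = {0..<43 * n} \<times> {22 * n - 1}"
  define C' where "C' = {0..<43 * n} \<times> {- (22 * n)}"
  have fin: "finite Su" "finite R" by (auto simp: Su_def R_def)
  have refl: "cpr Su A B * cpr R C D \<le> Kc * cpr R A D + cpr Su A B * sqrt (Kc * cpr R C C')"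
    unfolding R_def Su_def A_def B_def C_def D_def C'_def using n by (intro reflection) auto
  have "up_prob n 10 = cpr ({0..<43 * n} \<times> {0..<21 * n}) A B"
    unfolding up_prob_def by (rule cpr_mirror_y[where i = "11 * n - 1", symmetric]) (auto simp: A_def B_def)
  also have "\<dots> \<le> cpr Su A B" using n by (intro cpr_mono) (auto simp: Su_def)
  finally have x: "v \<le> cpr Su A B" using v by simp
  have "up_prob n 20 = cpr ({0..<43 * n} \<times> {- (19 * n)..<22 * n}) D C"
    unfolding up_prob_def by (rule cpr_shift[where i = 0 and j = n, symmetric]) (auto simp: D_def C_def)
  also have "\<dots> \<le> cpr R D C" using n by (intro cpr_mono) (auto simp: R_def)
  finally have y: "v \<le> cpr R C D" using v conn_prob_sym[of d k p R D C] by simp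
  have "cpr R C' C = lr (44 * n) (43 * n)"
    using lr_vertical[of 0 "43 * n" "- (22 * n)" "44 * n"] by (simp add: R_def C'_def C_def)
  then have t: "cpr R C C' = lr (44 * n) (43 * n)" using conn_prob_sym[of d k p R C C'] by simp
  have "cpr R D A = cpr ({0..<43 * n} \<times> {- (23 * n)..<21 * n}) ({0} \<times> {0..<n}) ({0} \<times> {9 * n..<10 * n})"
    by (rule cpr_shift[where i = 0 and j = n]) (auto simp: R_def D_def A_def)
  also have "\<dots> \<le> arc_prob n 23 9" unfolding arc_prob_def using n by (intro cpr_mono) auto
  finally have arc_prob: "cpr R A D \<le> arc_prob n 23 9" using conn_prob_sym[of d k p R A D] by simp
  have K0: "0 \<le> Kc" using Kc_ge_1 by simp
  show ?thesis
  proof (cases "cpr R C D \<le> 2 * sqrt (Kc * cpr R C C')")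
    case True
    then have "v\<^sup>2 \<le> (2 * sqrt (Kc * cpr R C C'))\<^sup>2" using v y by (intro power_mono) auto
    also have "\<dots> = 4 * Kc * lr (44 * n) (43 * n)"
      using K0 cpr_nonneg[of R C C'] t by (simp add: power_mult_distrib)
    finally show ?thesis by blast
  next
    case False
    then have "cpr Su A B * (2 * sqrt (Kc * cpr R C C')) \<le> cpr Su A B * cpr R C D"
      by (intro mult_left_mono cpr_nonneg) auto
    then have "cpr Su A B * cpr R C D \<le> 2 * Kc * cpr R A D" using refl by linarith
    moreover have "v\<^sup>2 \<le> cpr Su A B * cpr R C D" unfolding power2_eq_square using v x y by (intro mult_mono) auto
    moreover have "2 * Kc * cpr R A D \<le> 2 * Kc * arc_prob n 23 9" using arc_prob K0 by (intro mult_left_mono) auto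
    ultimately show ?thesis by linarith
  qed
qed

text \<open>
  If the strip of height 41n is crossed with probability at least 1/88 of that for height 44n, \<open>lr_square\<close> suffices. Otherwise \<open>lr_le_up\<close> bounds the exit probabilities for b = 10 and b = 20 from below by 1/176 of the crossing probability, because the windows have heights 21n and 41n. The exponent 16 is the product of 2 from \<open>up_dichotomy\<close> and 8 from \<open>arc_power\<close>.
\<close>
theorem lr_lower_bound:
  fixes n :: int
  assumes n: "n \<ge> 1"
  shows "lr (43 * n) (44 * n) ^ 16 \<le> 176 ^ 16 * 256 * Kc ^ 15 * lr (44 * n) (43 * n)"
proof -
  define P where "P = lr (43 * n) (44 * n)"
  define t where "t = lr (44 * n) (43 * n)"
  define q where "q = lr (43 * n) (41 * n)"
  have P: "0 \<le> P" "P \<le> 1" and t0: "0 \<le> t" and q0: "0 \<le> q"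
    by (auto simp: P_def t_def q_def lr_def cpr_nonneg intro: cpr_le_1)
  have K1: "1 \<le> Kc" by (rule Kc_ge_1)
  have Kp: "Kc ^ i * t \<le> Kc ^ 15 * t" if "i \<le> 15" for i
    using that K1 t0 by (intro mult_right_mono power_increasing) auto
  show ?thesis
  proof (cases "P / 88 \<le> q")
    case True
    have "(P / 88) ^ 4 \<le> q ^ 4" using True P by (intro power_mono) auto
    also have "\<dots> \<le> 4 * Kc ^ 3 * t" unfolding q_def t_def by (rule lr_square[OF n])
    finally have "P ^ 4 \<le> 88 ^ 4 * 4 * (Kc ^ 3 * t)" by (simp add: power_divide field_simps)
    moreover have "P ^ 16 \<le> P ^ 4" using P by (intro power_decreasing) auto
    ultimately have "P ^ 16 \<le> 88 ^ 4 * 4 * (Kc ^ 15 * t)" using Kp[of 3] by simp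
    moreover have "88 ^ 4 * 4 * (Kc ^ 15 * t) \<le> 176 ^ 16 * 256 * (Kc ^ 15 * t)"
      using K1 t0 by (intro mult_right_mono) auto
    ultimately show ?thesis unfolding P_def[symmetric] t_def[symmetric] by (simp only: mult.assoc)
  next
    case False
    define v where "v = P / 176"
    have v0: "0 < v" using False q0 by (simp add: v_def)
    have up_prob: "v \<le> up_prob n b" if b: "1 \<le> b" "b \<le> 20" for b
    proof -
      have "(2 * b + 1) * n \<le> 41 * n" using b n by (intro mult_right_mono) auto
      then have "lr (43 * n) ((2 * b + 1) * n) \<le> q" unfolding q_def by (rule lr_mono)
      then have "P \<le> 88 * up_prob n b + 44 * q" using lr_le_up[OF n b(1)] unfolding P_def by linarith
      then show ?thesis using False unfolding v_def by (simp add: field_simps)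
    qed
    have "v\<^sup>2 \<le> 4 * Kc * t \<or> v\<^sup>2 \<le> 2 * Kc * arc_prob n 23 9"
      unfolding t_def using up_prob[of 10] up_prob[of 20] v0 by (intro up_dichotomy[OF n]) auto
    then have "v ^ 16 \<le> 256 * (Kc ^ 15 * t)"
    proof
      assume *: "v\<^sup>2 \<le> 4 * Kc * t"
      have "v \<le> 1" using P by (simp add: v_def)
      then have "v ^ 16 \<le> v\<^sup>2" using v0 by (intro power_decreasing) auto
      also have "\<dots> \<le> 4 * (Kc ^ 15 * t)" using * Kp[of 1] by simp
      also have "\<dots> \<le> 256 * (Kc ^ 15 * t)" using K1 t0 by (intro mult_right_mono) auto
      finally show ?thesis .
    next
      assume "v\<^sup>2 \<le> 2 * Kc * arc_prob n 23 9"
      then have "(v\<^sup>2) ^ 8 \<le> (2 * Kc * arc_prob n 23 9) ^ 8" by (intro power_mono) auto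
      then have "v ^ 16 \<le> 256 * (Kc ^ 8 * arc_prob n 23 9 ^ 8)" by (simp add: power_mult_distrib)
      also have "\<dots> \<le> 256 * (Kc ^ 8 * (Kc ^ 7 * t))"
        unfolding t_def using K1 by (intro mult_left_mono arc_power[OF n]) auto
      also have "\<dots> = 256 * (Kc ^ 15 * t)" by (simp flip: mult.assoc power_add)
      finally show ?thesis .
    qed
    then have "P ^ 16 \<le> 176 ^ 16 * (256 * (Kc ^ 15 * t))" by (simp add: v_def power_divide field_simps)
    then show ?thesis unfolding P_def[symmetric] t_def[symmetric] by (simp only: mult.assoc)
  qed
qed

end

section \<open>The critical parameter and the conclusion\<close>

text \<open>
  The points of a half line through the origin.
\<close>
definition ray :: "nat \<Rightarrow> nat \<Rightarrow> vertex" where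
  "ray d i = (slab_origin d)(0 := int i)"

lemma ray_slab: "k \<ge> 1 \<Longrightarrow> d \<ge> 2 \<Longrightarrow> ray d i \<in> slab d k"
  unfolding ray_def by (rule slab_upd) (auto simp: slab_def slab_origin_def)

lemma ray_edge:
  assumes "k \<ge> 1" "d \<ge> 2" shows "{ray d i, ray d (Suc i)} \<in> slab_edges d k"
proof -
  have "(\<Sum>j<d. \<bar>ray d i j - ray d (Suc i) j\<bar>) = (\<Sum>j<d. if j = 0 then 1 else 0)"
    by (intro sum.cong) (auto simp: ray_def)
  also have "\<dots> = 1" using assms(2) by simp
  finally show ?thesis using ray_slab[OF assms] by (simp add: slab_edges_iff)
qed

lemma ray_path:
  assumes "k \<ge> 1" "d \<ge> 2" shows "pedges (map (ray d) [0..<Suc j]) \<subseteq> slab_edges d k"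
proof (induction j)
  case (Suc j)
  have "map (ray d) [0..<Suc (Suc j)] = map (ray d) [0..<Suc j] @ [ray d (Suc j)]" by simp
  also have "pedges \<dots> = insert {ray d j, ray d (Suc j)} (pedges (map (ray d) [0..<Suc j]))"
    by (subst pedges_snoc) auto
  finally show ?case using Suc ray_edge[OF assms, of j] by (simp only: insert_subset)
qed simp

lemma ray_hd_last: "hd (map (ray d) [0..<Suc j]) = slab_origin d" "last (map (ray d) [0..<Suc j]) = ray d j"
  if "d \<ge> 2"
proof -
  have "ray d 0 = slab_origin d" using that by (auto simp: ray_def slab_origin_def fun_eq_iff)
  then show "hd (map (ray d) [0..<Suc j]) = slab_origin d" by (simp add: hd_map del: upt_Suc)
  show "last (map (ray d) [0..<Suc j]) = ray d j" by simp
qed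

lemma open_path_iff:
  "open_path d k \<omega> xs \<longleftrightarrow> (xs \<noteq> [] \<and> set xs \<subseteq> slab d k \<and> pedges xs \<subseteq> slab_edges d k) \<and> (\<forall>e\<in>pedges xs. \<omega> e)"
proof -
  have "successively (\<lambda>x y. {x, y} \<in> slab_edges d k \<and> \<omega> {x, y}) xs \<longleftrightarrow> pedges xs \<subseteq> {e \<in> slab_edges d k. \<omega> e}"
    using successively_pedges[of "{e \<in> slab_edges d k. \<omega> e}" xs] by simp
  then show ?thesis unfolding open_path_def by blast
qed

lemma finite_pedges: "finite (pedges xs)"
  by (induction xs rule: induct_list012) auto

lemma countable_slab: "countable (slab d k)"
  unfolding slab_def by (rule countable_PiE) auto

lemma sets_countable_Bex:
  assumes "countable X" "\<And>i. {\<omega> \<in> space M. Q i \<omega>} \<in> sets M"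
  shows "{\<omega> \<in> space M. \<exists>i\<in>X. Q i \<omega>} \<in> sets M"
proof -
  have "{\<omega> \<in> space M. \<exists>i\<in>X. Q i \<omega>} = (\<Union>i\<in>X. {\<omega> \<in> space M. Q i \<omega>})" by blast
  then show ?thesis using sets.countable_UN''[OF assms(1) assms(2)] by simp
qed

lemma sets_countable_Ball:
  assumes "countable X" "\<And>i. {\<omega> \<in> space M. Q i \<omega>} \<in> sets M"
  shows "{\<omega> \<in> space M. \<forall>i\<in>X. Q i \<omega>} \<in> sets M"
proof -
  have "{\<omega> \<in> space M. \<not> Q i \<omega>} \<in> sets M" for i by (rule sets.sets_Collect_neg[OF assms(2)])
  then have "{\<omega> \<in> space M. \<exists>i\<in>X. \<not> Q i \<omega>} \<in> sets M" by (rule sets_countable_Bex[OF assms(1)])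
  from sets.sets_Collect_neg[OF this] show ?thesis by simp
qed

text \<open>
  Needed because the critical parameter is defined by a probability, which is 0 by convention for sets that are not measurable. A cluster is infinite if it is not contained in any finite set, and the slab has countably many finite subsets and finite paths.
\<close>
lemma infinite_cluster_measurable:
  "{\<omega> \<in> space (percolation d k p). infinite (open_cluster d k \<omega> x)} \<in> sets (percolation d k p)"
proof -
  let ?M = "percolation d k p"
  have path: "{\<omega> \<in> space ?M. open_path d k \<omega> xs} \<in> sets ?M" for xs
  proof (cases "xs \<noteq> [] \<and> set xs \<subseteq> slab d k \<and> pedges xs \<subseteq> slab_edges d k")
    case True
    have "{\<omega> \<in> space ?M. \<forall>e\<in>pedges xs. \<omega> e} \<in> sets ?M"
      unfolding percolation_def
      by (intro sets.sets_Collect_finite_All finite_pedges sets_Collect_single') (use True in auto)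
    then show ?thesis using True by (simp add: open_path_iff)
  next
    case False
    then have "{\<omega> \<in> space ?M. open_path d k \<omega> xs} = {}" unfolding open_path_iff by blast
    then show ?thesis by (simp only: sets.empty_sets)
  qed
  have cl: "{\<omega> \<in> space ?M. y \<in> open_cluster d k \<omega> x} \<in> sets ?M" for y
  proof -
    let ?X = "{xs \<in> lists (slab d k). hd xs = x \<and> last xs = y}"
    have "countable ?X" using countable_lists[OF countable_slab, of d k] by (rule countable_subset[rotated]) auto
    then have "{\<omega> \<in> space ?M. \<exists>xs\<in>?X. open_path d k \<omega> xs} \<in> sets ?M"
      by (rule sets_countable_Bex) (rule path)
    moreover have "y \<in> open_cluster d k \<omega> x \<longleftrightarrow> (\<exists>xs\<in>?X. open_path d k \<omega> xs)" for \<omega>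
      unfolding open_cluster_def open_connected_def by (auto simp: open_path_def in_lists_conv_set)
    ultimately show ?thesis by simp
  qed
  let ?F = "{F. finite F \<and> F \<subseteq> slab d k}"
  have inf: "infinite (open_cluster d k \<omega> x) \<longleftrightarrow> (\<forall>F\<in>?F. \<exists>y\<in>slab d k - F. y \<in> open_cluster d k \<omega> x)" for \<omega>
  proof
    have sub: "open_cluster d k \<omega> x \<subseteq> slab d k"
    proof
      fix y assume "y \<in> open_cluster d k \<omega> x"
      then obtain xs where "xs \<noteq> []" "set xs \<subseteq> slab d k" "last xs = y"
        unfolding open_cluster_def open_connected_def open_path_def by auto
      then show "y \<in> slab d k" using last_in_set[of xs] by auto
    qed
    show "infinite (open_cluster d k \<omega> x) \<Longrightarrow> \<forall>F\<in>?F. \<exists>y\<in>slab d k - F. y \<in> open_cluster d k \<omega> x"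
    proof (rule ccontr)
      assume inf: "infinite (open_cluster d k \<omega> x)" and "\<not> (\<forall>F\<in>?F. \<exists>y\<in>slab d k - F. y \<in> open_cluster d k \<omega> x)"
      then obtain F where F: "finite F" "\<forall>y\<in>slab d k - F. y \<notin> open_cluster d k \<omega> x" by blast
      then have "open_cluster d k \<omega> x \<subseteq> F" using sub by blast
      then show False using inf F(1) finite_subset by blast
    qed
    show "\<forall>F\<in>?F. \<exists>y\<in>slab d k - F. y \<in> open_cluster d k \<omega> x \<Longrightarrow> infinite (open_cluster d k \<omega> x)"
      using sub by blast
  qed
  have "countable ?F" by (rule countable_Collect_finite_subset[OF countable_slab])
  moreover have "{\<omega> \<in> space ?M. \<exists>y\<in>slab d k - F. y \<in> open_cluster d k \<omega> x} \<in> sets ?M" for F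
    by (rule sets_countable_Bex[OF countable_subset[OF Diff_subset countable_slab] cl])
  ultimately have "{\<omega> \<in> space ?M. \<forall>F\<in>?F. \<exists>y\<in>slab d k - F. y \<in> open_cluster d k \<omega> x} \<in> sets ?M"
    by (rule sets_countable_Ball)
  then show ?thesis unfolding inf .
qed

text \<open>
  This makes the set whose infimum is the critical parameter nonempty; without a member the infimum would be an unspecified number.
\<close>
lemma percolates_at_one:
  assumes "k \<ge> 1" "d \<ge> 2"
  shows "\<P>(\<omega> in percolation d k 1. infinite (open_cluster d k \<omega> (slab_origin d))) = 1"
proof -
  let ?M = "percolation d k 1"
  interpret prob_space ?M
    unfolding percolation_def by (rule prob_space_PiM) (rule prob_space_measure_pmf)
  have ce: "countable (slab_edges d k)"
  proof (rule countable_subset)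
    show "slab_edges d k \<subseteq> {F. finite F \<and> F \<subseteq> slab d k}" by (auto simp: slab_edges_def)
  qed (rule countable_Collect_finite_subset[OF countable_slab])
  have "AE \<omega> in ?M. \<omega> e" if "e \<in> slab_edges d k" for e
    unfolding percolation_def
  proof (rule AE_PiM_component[OF _ that])
    show "AE y in measure_pmf (bernoulli_pmf 1). y"
      unfolding AE_measure_pmf_iff
    proof
      fix y assume "y \<in> set_pmf (bernoulli_pmf 1)"
      then show y by (cases y) (auto simp: set_pmf_iff)
    qed
  qed (rule prob_space_measure_pmf)
  then have "AE \<omega> in ?M. \<forall>e\<in>slab_edges d k. \<omega> e" by (subst AE_ball_countable[OF ce]) blast
  then have "AE \<omega> in ?M. infinite (open_cluster d k \<omega> (slab_origin d))"
  proof (rule AE_mp, intro AE_I2 impI)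
    fix \<omega> assume w: "\<forall>e\<in>slab_edges d k. \<omega> e"
    have "ray d j \<in> open_cluster d k \<omega> (slab_origin d)" for j
      unfolding open_cluster_def open_connected_def mem_Collect_eq
    proof (intro exI conjI)
      let ?xs = "map (ray d) [0..<Suc j]"
      show "open_path d k \<omega> ?xs" unfolding open_path_iff
        using ray_path[OF assms, of j] ray_slab[OF assms] w by (auto simp del: upt_Suc)
      show "set ?xs \<subseteq> slab d k" using ray_slab[OF assms] by (auto simp del: upt_Suc)
      show "hd ?xs \<in> {slab_origin d}" "last ?xs \<in> {ray d j}" using ray_hd_last[OF assms(2)] by simp_all
    qed
    then have "range (ray d) \<subseteq> open_cluster d k \<omega> (slab_origin d)" by blast
    moreover have "inj (ray d)"
    proof (rule injI)
      fix i j assume "ray d i = ray d j"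
      then have "ray d i 0 = ray d j 0" by simp
      then show "i = j" by (simp add: ray_def)
    qed
    ultimately show "infinite (open_cluster d k \<omega> (slab_origin d))"
      by (rule infinite_super[OF _ range_inj_infinite])
  qed
  then show ?thesis using prob_Collect_eq_1[OF infinite_cluster_measurable] by blast
qed

lemma p_crit_range:
  assumes "k \<ge> 1" "d \<ge> 2" shows "0 \<le> p_crit d k" "p_crit d k \<le> 1"
proof -
  let ?Q = "{p \<in> {0..1}. \<P>(\<omega> in percolation d k p. infinite (open_cluster d k \<omega> (slab_origin d))) > 0}"
  have one: "1 \<in> ?Q" using percolates_at_one[OF assms] by simp
  show "0 \<le> p_crit d k" unfolding p_crit_def by (rule cInf_greatest) (use one in auto)
  show "p_crit d k \<le> 1" unfolding p_crit_def by (rule cInf_lower[OF one]) (auto intro!: bdd_belowI[of _ 0])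
qed

lemma cross_prob_conn_prob:
  assumes "k \<ge> 1" "d \<ge> 2"
  shows "cross_prob d k m n = conn_prob d k (p_crit d k) ({0..<int m} \<times> {0..<int n}) ({0} \<times> {0..<int n}) ({int m - 1} \<times> {0..<int n})"
  unfolding cross_prob_def slab_box_def left_side_def right_side_def
  by (rule cross_measure[OF _ p_crit_range[OF assms]]) simp

lemma bexp_0: "finite E \<Longrightarrow> bexp 0 E f = f {}"
  by (induction E rule: finite_induct) (auto simp: bexp_insert)

lemma bexp_1: "finite E \<Longrightarrow> bexp 1 E f = f E"
  by (induction E arbitrary: f rule: finite_induct) (auto simp: bexp_insert)

text \<open>
  Without open edges only single vertices are connected to themselves, and the two sides are disjoint.
\<close>
lemma cross_prob_0:
  assumes "k \<ge> 1" "d \<ge> 2" "p_crit d k = 0" "m \<ge> 2"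
  shows "cross_prob d k m n = 0"
proof -
  let ?Z = "{0..<int m} \<times> {0..<int n}"
  have "\<not> conn {} (slab_over d k ?Z) (slab_over d k ({0} \<times> {0..<int n})) (slab_over d k ({int m - 1} \<times> {0..<int n}))"
  proof
    assume "conn {} (slab_over d k ?Z) (slab_over d k ({0} \<times> {0..<int n})) (slab_over d k ({int m - 1} \<times> {0..<int n}))"
    then obtain xs where xs: "xs \<noteq> []" "pedges xs \<subseteq> {}" "hd xs \<in> slab_over d k ({0} \<times> {0..<int n})"
      "last xs \<in> slab_over d k ({int m - 1} \<times> {0..<int n})" unfolding conn_def by blast
    then obtain x where "xs = [x]" by (cases xs rule: pedges.cases) auto
    then show False using xs(3,4) assms(4) by (auto simp: slab_over_def)
  qed
  then show ?thesis unfolding cross_prob_conn_prob[OF assms(1,2)] conn_prob_def bprob_def assms(3)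
    by (subst bexp_0) (simp_all add: finite_edges_on)
qed

text \<open>
  The segment of the half line is an open crossing.
\<close>
lemma cross_prob_1:
  assumes "k \<ge> 1" "d \<ge> 2" "p_crit d k = 1" "m \<ge> 1" "n \<ge> 1"
  shows "cross_prob d k m n = 1"
proof -
  let ?Z = "{0..<int m} \<times> {0..<int n}"
  let ?xs = "map (ray d) [0..<Suc (m - 1)]"
  have r: "ray d i 0 = int i" "ray d i 1 = 0" for i using assms(2) by (auto simp: ray_def slab_origin_def)
  have sub: "set ?xs \<subseteq> slab_over d k ?Z"
    using ray_slab[OF assms(1,2)] r assms(4,5) by (auto simp: slab_over_def simp del: upt_Suc)
  have e: "pedges ?xs \<subseteq> edges_on d k ?Z"
  proof
    fix e assume e: "e \<in> pedges ?xs"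
    then have "e \<subseteq> slab_over d k ?Z" using subset_trans[OF pedges_subset sub] by blast
    then show "e \<in> edges_on d k ?Z" using subsetD[OF ray_path[OF assms(1,2)] e] by (simp add: edges_on_def)
  qed
  have "hd ?xs = ray d 0" by (simp add: hd_map del: upt_Suc)
  then have hd: "hd ?xs \<in> slab_over d k ({0} \<times> {0..<int n})"
    using ray_slab[OF assms(1,2)] r assms(5) by (simp add: slab_over_def)
  have "last ?xs = ray d (m - 1)" by simp
  then have last: "last ?xs \<in> slab_over d k ({int m - 1} \<times> {0..<int n})"
    using ray_slab[OF assms(1,2)] r assms(4,5) by (simp add: slab_over_def of_nat_diff)
  have ne: "?xs \<noteq> []" by simp
  have "conn (edges_on d k ?Z) (slab_over d k ?Z) (slab_over d k ({0} \<times> {0..<int n})) (slab_over d k ({int m - 1} \<times> {0..<int n}))"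
    unfolding conn_def by (rule exI, rule conjI[OF ne conjI[OF sub conjI[OF e conjI[OF hd last]]]])
  then show ?thesis unfolding cross_prob_conn_prob[OF assms(1,2)] conn_prob_def bprob_def assms(3)
    by (subst bexp_1) (simp_all add: finite_edges_on)
qed

lemma cross_prob_bounds:
  assumes "k \<ge> 1" "d \<ge> 2" shows "0 \<le> cross_prob d k m n" "cross_prob d k m n \<le> 1"
  unfolding cross_prob_conn_prob[OF assms] conn_prob_def using p_crit_range[OF assms]
  by (auto intro!: bprob_nonneg bprob_le_1 finite_edges_on)

text \<open>
  With the exponent \<open>m = 2 d k ^ (d - 2)\<close> of \<open>Kc\<close>, the factor \<open>2 ^ m\<close> absorbs the constants in \<open>Kc\<close>, and m is smaller than the exponent on the right.
\<close>
lemma (in slab_percolation) Kc_le: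
  assumes "k \<ge> 1"
  shows "Kc \<le> (2 / min p (1 - p)) ^ (d * 7\<^sup>2 * k ^ (d - 2))"
proof -
  let ?u = "1 / min p (1 - p)"
  have u: "1 \<le> ?u" using p by auto
  have k1: "1 \<le> k ^ (d - 2)" using assms by simp
  have "2 * 2 * 1 \<le> m" using d k1 by (intro mult_le_mono) auto
  then have m: "2 \<le> m" by linarith
  have "Kc = 1 + 2 * ?u ^ m" by (simp add: Kc_def)
  also have "\<dots> \<le> 4 * ?u ^ m" using one_le_power[OF u, of m] by linarith
  also have "\<dots> = 2 ^ 2 * ?u ^ m" by simp
  also have "\<dots> \<le> 2 ^ m * ?u ^ m" using u m p by (intro mult_right_mono power_increasing zero_le_power) auto
  also have "\<dots> = (2 / min p (1 - p)) ^ m" by (simp flip: power_mult_distrib)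
  also have "\<dots> \<le> (2 / min p (1 - p)) ^ (d * 7\<^sup>2 * k ^ (d - 2))"
  proof (rule power_increasing)
    have "2 * (d * k ^ (d - 2)) \<le> 7\<^sup>2 * (d * k ^ (d - 2))" by (intro mult_right_mono) auto
    then show "m \<le> d * 7\<^sup>2 * k ^ (d - 2)" by (simp only: mult_ac)
    show "1 \<le> 2 / min p (1 - p)" using u by linarith
  qed
  finally show ?thesis .
qed

theorem proposition6p1:
  fixes d k n :: nat
  assumes "d \<ge> 2" and "k \<ge> 2" and "n \<ge> 1"
  shows "cross_prob d k (44 * n) (43 * n) \<ge>
    c_star d k ^ 21 * cross_prob d k (43 * n) (44 * n) ^ 198 / 10 ^ 154"
proof -
  have dk: "k \<ge> 1" "d \<ge> 2" using assms by auto
  define P where "P = cross_prob d k (43 * n) (44 * n)"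
  define t where "t = cross_prob d k (44 * n) (43 * n)"
  have P: "0 \<le> P" "P \<le> 1" and t: "0 \<le> t" unfolding P_def t_def by (rule cross_prob_bounds[OF dk])+
  have "c_star d k ^ 21 * P ^ 198 / 10 ^ 154 \<le> t"
  proof -
    consider "p_crit d k = 0" | "p_crit d k = 1" | "0 < p_crit d k" "p_crit d k < 1"
      using p_crit_range[OF dk] by fastforce
    then show ?thesis
    proof cases
      case 1
      then have "P = 0" unfolding P_def using assms(3) by (intro cross_prob_0[OF dk]) auto
      then show ?thesis using t by simp
    next
      case 2
      then have t1: "t = 1" unfolding t_def using assms(3) by (intro cross_prob_1[OF dk]) auto
      have "d * 7\<^sup>2 * k ^ (d - 2) > 0" using assms by simp
      moreover have "2 / min (p_crit d k) (1 - p_crit d k) = 0" using 2 by simp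
      ultimately have "C_star d k = 0" unfolding C_star_def by (simp only: zero_power)
      then have "c_star d k = 1" by (simp add: c_star_def)
      then show ?thesis using t1 power_le_one[OF P, of 198] by simp
    next
      case 3
      interpret slab_percolation d k "p_crit d k" by unfold_locales (use 3 assms in auto)
      have K1: "1 \<le> Kc" by (rule Kc_ge_1)
      have "Kc \<le> C_star d k" using Kc_le[OF dk(1)] by (simp add: C_star_def)
      then have c: "0 \<le> c_star d k" "c_star d k \<le> 1 / Kc"
        using K1 unfolding c_star_def by (auto intro!: divide_left_mono)
      have "lr (43 * int n) (44 * int n) ^ 16 \<le> 176 ^ 16 * 256 * Kc ^ 15 * lr (44 * int n) (43 * int n)"
        using assms(3) by (intro lr_lower_bound) simp
      moreover have "lr (43 * int n) (44 * int n) = P" "lr (44 * int n) (43 * int n) = t"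
        unfolding P_def t_def lr_def cross_prob_conn_prob[OF dk] by simp_all
      ultimately have main: "P ^ 16 \<le> 176 ^ 16 * 256 * Kc ^ 15 * t" by simp
      have "c_star d k ^ 21 \<le> (1 / Kc) ^ 21" using c by (intro power_mono) auto
      also have "\<dots> \<le> (1 / Kc) ^ 15" using K1 by (intro power_decreasing) auto
      finally have cK: "c_star d k ^ 21 \<le> (1 / Kc) ^ 15" .
      have "c_star d k ^ 21 * P ^ 198 \<le> (1 / Kc) ^ 15 * P ^ 16"
        using cK P K1 by (intro mult_mono power_decreasing) auto
      also have "\<dots> \<le> (1 / Kc) ^ 15 * (176 ^ 16 * 256 * Kc ^ 15 * t)" using main K1 by (intro mult_left_mono) auto
      also have "\<dots> = 176 ^ 16 * 256 * t" using K1 by (simp add: power_one_over)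
      also have "\<dots> \<le> 10 ^ 154 * t" using t by (intro mult_right_mono) auto
      finally show ?thesis by (simp add: field_simps)
    qed
  qed
  then show ?thesis unfolding P_def t_def .
qed

end
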